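(* Let $X$ be an algebraically integrable complex planar polynomial vector field such that $X\neq c\,\frac{\partial}{\partial y}$ for all $c\in\mathbb{C}\setminus\{0\}$. For each $\delta\in\mathbb{Z}_{\geq 0}$, let $\mathcal{F}_X^\delta$ be the extension of $X$ to the Hirzebruch surface $\mathbb{F}_\delta$. Then there exists a nonnegative integer $\delta_1$ satisfying the following conditions: (i) For all integers $\delta>\delta_1$, the point $(0,1;0,1)\in\mathbb{F}_\delta$ is the unique dicritical singularity of $\mathcal{F}_X^\delta$ belonging to the curve $X_0=0$. (ii) For all nonnegative integers $\delta<\delta_1$, the point $(0,1;1,0)\in\mathbb{F}_\delta$ is a dicritical singularity of $\mathcal{F}_X^\delta$. (iii) The point $(0,1;1,0)\in\mathbb{F}_{\delta_1}$ is not a dicritical singularity of $\mathcal{F}_X^{\delta_1}$.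
   Context: A complex planar polynomial vector field is $X=a(x,y)\frac{\partial}{\partial x}+b(x,y)\frac{\partial}{\partial y}$ with $a,b\in\mathbb{C}[x,y]$ coprime; it is also given by the $1$-form $\omega_X=b\,dx-a\,dy$. It is algebraically integrable if there is $f\in\mathbb{C}(x,y)\setminus\mathbb{C}$ (a rational first integral) with $X(f)=a f_x+b f_y=0$. Hirzebruch surface. For an integer $\delta\ge 0$, $\mathbb{F}_\delta$ is the quotient of $(\mathbb{C}^2\setminus\{0\})\times(\mathbb{C}^2\setminus\{0\})$, with coordinates $(X_0,X_1;Y_0,Y_1)$, by the action of $(\mathbb{C}^* )^2$ given by $(\lambda,\mu)\cdot(X_0,X_1;Y_0,Y_1)=(\lambda X_0,\lambda X_1;\mu Y_0,\lambda^{-\delta}\mu Y_1)$. A point is denoted by its homogeneous coordinates $(X_0,X_1;Y_0,Y_1)$. The open sets $U_{ij}=\{X_i\neq 0,\ Y_j\neq 0\}$, $0\le i,j\le 1$, cover $\mathbb{F}_\delta$ and are isomorphic to $\mathbb{C}^2$ (coordinates are obtained by normalizing $X_i=1$, $Y_j=1$). $\mathbb{C}^2$ is identified with $U_{00}$ by $x=X_1/X_0$, $y=X_0^\delta Y_1/Y_0$. In $U_{10}$, with coordinates $(s,t)=(X_0/X_1,\,X_1^\delta Y_1/Y_0)$, one has $x=1/s$, $y=s^\delta t$; in $U_{11}$, with coordinates $(s,t)=(X_0/X_1,\,Y_0/(X_1^\delta Y_1))$, one has $x=1/s$, $y=s^\delta/t$; in $U_{01}$, with coordinates $(s,t)=(X_1/X_0,\,Y_0/(X_0^\delta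 Y_1))$, one has $x=s$, $y=1/t$. Extension. $\mathcal{F}_X^\delta$ is the singular algebraic foliation with isolated singularities on $\mathbb{F}_\delta$ whose restriction to $U_{00}=\mathbb{C}^2$ is the foliation defined by $\omega_X$: in each chart $U_{ij}$ it is given by the polynomial $1$-form with coprime coefficients proportional (by a rational function) to the pull-back of $\omega_X$ under the coordinate change expressing $(x,y)$ in terms of the coordinates of $U_{ij}$, namely the identity on $U_{00}$, $(x,y)=(1/s,\,s^\delta t)$ on $U_{10}$, $(x,y)=(1/s,\,s^\delta/t)$ on $U_{11}$, and $(x,y)=(s,\,1/t)$ on $U_{01}$. Dicritical singularities. Let $\mathcal{G}$ be a foliation with isolated singularities on a smooth surface, given near a point $p$, in local coordinates $(x,y)$ centred at $p$, by $\omega=P\,dx+Q\,dy$ ($P,Q$ without common factor). Let $\omega_m=p_m\,dx+q_m\,dy$ be the first nonvanishing jet of $\omega$ ($p_m,q_m$ homogeneous of degree $m$). Then $p$ is a singularity iff $m\ge 1$. A singularity $p$ is terminal dicritical if $x p_m+y q_m$ is the zero polynomial. It is simple if $m=1$ and the matrix $\begin{pmatrix}\partial q_1/\partial x&\partial q_1/\partial y\\-\partial p_1/\partial x&-\partial p_1/\partial y\end{pmatrix}$ has eigenvalues $\lambda_1,\lambda_2$ such that either $\lambda_1\lambda_2\ne 0$ and $\lambda_1/\lambda_2$ is not a positive rational number, or $\lambda_1\lambda_2=0$ and $\lambda_1^2+\lambda_2^2\neq 0$. Nonsimple singularities are called ordinary. The strict transform of $\mathcal{G}$ under the blowup at $p$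 is given by the pull-back of $\omega$ divided by the largest possible power of a local equation of the exceptional divisor. After finitely many blowups at ordinary singularities of $\mathcal{G}$ and of its successive strict transforms one reaches a foliation without ordinary singularities; the set of blowup centres is the singular configuration $\mathcal{C}_{\mathcal{G}}$. A point $q$ is infinitely near $p$ if $q=p$ or $q$ lies on an exceptional divisor created by successively blowing up $p$ and points over $p$. An ordinary singularity $p\in\mathcal{C}_{\mathcal{G}}$ is a dicritical singularity of $\mathcal{G}$ if there is $q\in\mathcal{C}_{\mathcal{G}}$ infinitely near $p$ (possibly $q=p$) which is a terminal dicritical singularity of the strict transform of $\mathcal{G}$ on the surface containing $q$. *)

theory Defs
  imports
    "HOL-Computational_Algebra.Computational_Algebra"
    "HOL-Computational_Algebra.Field_as_Ring"
    "Jordan_Normal_Form.Char_Poly"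
begin

text \<open>
  \<^typ>\<open>complex poly poly\<close> is the polynomial ring in two variables: the inner variable is the first
  one ($x$, or $s$ in a chart), the outer variable is the second one ($y$, or $t$ in a chart). So
  the coefficient of $x^i y^j$ in $P$ is \<open>coeff (coeff P j) i\<close>.
\<close>

type_synonym bipoly = "complex poly poly"
type_synonym birat = "complex poly poly fract"

abbreviation const2 :: "complex \<Rightarrow> bipoly" where
  "const2 c \<equiv> [:[:c:]:]"

abbreviation var1 :: bipoly where
  "var1 \<equiv> [:[:0, 1:]:]"

abbreviation var2 :: bipoly where
  "var2 \<equiv> [:0, 1:]"

definition D1 :: "bipoly \<Rightarrow> bipoly" where
  "D1 P = map_poly pderiv P"

definition D2 :: "bipoly \<Rightarrow> bipoly" where
  "D2 P = pderiv P"

text \<open>The quotient rule, for the representative of a fraction in lowest terms; the choice of the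
  representative is irrelevant, see \<open>fract_deriv_Fract\<close> below.\<close>

definition fract_deriv :: "(bipoly \<Rightarrow> bipoly) \<Rightarrow> birat \<Rightarrow> birat" where
  "fract_deriv D f = (case quot_of_fract f of (p, q) \<Rightarrow> Fract (D p * q - p * D q) (q ^ 2))"

text \<open>The value \<open>P(u, v)\<close> in a commutative ring into which the complex numbers are mapped by \<open>\<iota>\<close>.\<close>

definition subst2 :: "(complex \<Rightarrow> 'a::comm_ring_1) \<Rightarrow> bipoly \<Rightarrow> 'a \<Rightarrow> 'a \<Rightarrow> 'a" where
  "subst2 \<iota> P u v = poly (map_poly (\<lambda>c. poly (map_poly \<iota> c) u) P) v"

text \<open>A pair \<open>(P, Q)\<close> stands for the 1-form $P\,dx + Q\,dy$. The pull-back is taken along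
  $(x, y) = (\varphi, \psi)$, where \<open>d1\<close> and \<open>d2\<close> are the partial derivatives of the target ring.\<close>

type_synonym form = "bipoly \<times> bipoly"

definition pullback ::
  "(complex \<Rightarrow> 'a::comm_ring_1) \<Rightarrow> ('a \<Rightarrow> 'a) \<Rightarrow> ('a \<Rightarrow> 'a) \<Rightarrow> 'a \<times> 'a \<Rightarrow> form \<Rightarrow> 'a \<times> 'a"
where
  "pullback \<iota> d1 d2 = (\<lambda>(\<phi>, \<psi>) (P, Q).
     let P' = subst2 \<iota> P \<phi> \<psi>; Q' = subst2 \<iota> Q \<phi> \<psi>
     in (P' * d1 \<phi> + Q' * d1 \<psi>, P' * d2 \<phi> + Q' * d2 \<psi>))"

abbreviation poly_pullback :: "bipoly \<times> bipoly \<Rightarrow> form \<Rightarrow> form" where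
  "poly_pullback \<equiv> pullback const2 D1 D2"

abbreviation rat_pullback :: "birat \<times> birat \<Rightarrow> form \<Rightarrow> birat \<times> birat" where
  "rat_pullback \<equiv> pullback (\<lambda>c. to_fract (const2 c)) (fract_deriv D1) (fract_deriv D2)"


section \<open>Planar polynomial vector fields\<close>

text \<open>A pair \<open>(a, b)\<close> stands for the vector field
  $a\,\partial/\partial x + b\,\partial/\partial y$.\<close>

definition rational_first_integral :: "bipoly \<times> bipoly \<Rightarrow> birat \<Rightarrow> bool" where
  "rational_first_integral = (\<lambda>(a, b) f.
     f \<notin> range (\<lambda>c. to_fract (const2 c)) \<and>
     to_fract a * fract_deriv D1 f + to_fract b * fract_deriv D2 f = 0)"

definition algebraically_integrable :: "bipoly \<times> bipoly \<Rightarrow> bool" where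
  "algebraically_integrable X \<longleftrightarrow> (\<exists>f. rational_first_integral X f)"

definition form_of_field :: "bipoly \<times> bipoly \<Rightarrow> form" where
  "form_of_field = (\<lambda>(a, b). (b, - a))"


section \<open>Dicritical singularities\<close>

definition hom_part :: "nat \<Rightarrow> bipoly \<Rightarrow> bipoly" where
  "hom_part m P = (\<Sum>i\<le>m. monom (monom (coeff (coeff P (m - i)) i) i) (m - i))"

text \<open>Forms are centred: the predicates up to \<open>dicritical_form\<close> concern the origin.\<close>

definition mult_form :: "form \<Rightarrow> nat" where
  "mult_form = (\<lambda>(P, Q). LEAST m. hom_part m P \<noteq> 0 \<or> hom_part m Q \<noteq> 0)"

definition first_jet :: "form \<Rightarrow> form" where
  "first_jet \<omega> = (hom_part (mult_form \<omega>) (fst \<omega>), hom_part (mult_form \<omega>) (snd \<omega>))"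

definition singular :: "form \<Rightarrow> bool" where
  "singular \<omega> \<longleftrightarrow> mult_form \<omega> \<ge> 1"

definition terminal_dicritical :: "form \<Rightarrow> bool" where
  "terminal_dicritical \<omega> \<longleftrightarrow>
     singular \<omega> \<and> var1 * fst (first_jet \<omega>) + var2 * snd (first_jet \<omega>) = 0"

definition linear_part :: "form \<Rightarrow> complex mat" where
  "linear_part \<omega> = (case first_jet \<omega> of (p, q) \<Rightarrow>
     let ev = (\<lambda>P. subst2 (\<lambda>c. c) P 0 0)
     in mat_of_rows_list 2 [[ev (D1 q), ev (D2 q)], [- ev (D1 p), - ev (D2 p)]])"

definition simple_sing :: "form \<Rightarrow> bool" where
  "simple_sing \<omega> \<longleftrightarrow> mult_form \<omega> = 1 \<and>
     (\<exists>l1 l2. char_poly (linear_part \<omega>) = [:- l1, 1:] * [:- l2, 1:] \<and>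
        (l1 * l2 \<noteq> 0 \<and> \<not> (\<exists>r::rat. r > 0 \<and> l1 / l2 = of_rat r) \<or>
         l1 * l2 = 0 \<and> l1 ^ 2 + l2 ^ 2 \<noteq> 0))"

definition ordinary_sing :: "form \<Rightarrow> bool" where
  "ordinary_sing \<omega> \<longleftrightarrow> singular \<omega> \<and> \<not> simple_sing \<omega>"

definition divide_max_power :: "bipoly \<Rightarrow> form \<Rightarrow> form" where
  "divide_max_power e = (\<lambda>(P, Q).
     let k = (GREATEST k. e ^ k dvd P \<and> e ^ k dvd Q) in (P div e ^ k, Q div e ^ k))"

text \<open>
  The exceptional divisor of the blowup of the origin is covered by two charts:
  $(x, y) = (u, uv)$, where it is $u = 0$, and $(x, y) = (uv, v)$, where it is $v = 0$. Its points
  are \<open>Slope c\<close>, which is $(u, v) = (0, c)$ in the first chart, and \<open>Vertical\<close>, the origin of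
  the second chart. The strict transform at such a point is again centred, so \<open>v\<close> is replaced by
  \<open>v + c\<close> in the first chart.
\<close>

datatype exc_point = Slope complex | Vertical

fun strict_transform :: "exc_point \<Rightarrow> form \<Rightarrow> form" where
  "strict_transform (Slope c) \<omega> =
     divide_max_power var1 (poly_pullback (var1, var1 * (var2 + const2 c)) \<omega>)"
| "strict_transform Vertical \<omega> =
     divide_max_power var2 (poly_pullback (var1 * var2, var2) \<omega>)"

text \<open>A point infinitely near the origin is the list of successive points on the last exceptional
  divisor that lead to it; the empty list is the origin itself.\<close>

fun transform_at :: "form \<Rightarrow> exc_point list \<Rightarrow> form" where
  "transform_at \<omega> [] = \<omega>"
| "transform_at \<omega> (q # qs) = transform_at (strict_transform q \<omega>) qs"

text \<open>The part over the origin of the singular configuration: a point is blown up iff it is an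
  ordinary singularity, and it is present iff all points preceding it have been blown up.\<close>

definition singular_configuration :: "form \<Rightarrow> exc_point list set" where
  "singular_configuration \<omega> =
     {qs. \<forall>k\<le>length qs. ordinary_sing (transform_at \<omega> (take k qs))}"

definition dicritical_form :: "form \<Rightarrow> bool" where
  "dicritical_form \<omega> \<longleftrightarrow> [] \<in> singular_configuration \<omega> \<and>
     (\<exists>qs\<in>singular_configuration \<omega>. terminal_dicritical (transform_at \<omega> qs))"

definition dicritical_form_at :: "form \<Rightarrow> complex \<times> complex \<Rightarrow> bool" where
  "dicritical_form_at \<omega> = (\<lambda>(s, t).
     dicritical_form (poly_pullback (var1 + const2 s, var2 + const2 t) \<omega>))"


section \<open>Hirzebruch surfaces\<close>

text \<open>Homogeneous coordinates are ordered as $(X_0, X_1, Y_0, Y_1)$.\<close>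

type_synonym hcoords = "complex \<times> complex \<times> complex \<times> complex"

definition hirz_coords :: "hcoords set" where
  "hirz_coords = {(X0, X1, Y0, Y1). (X0, X1) \<noteq> (0, 0) \<and> (Y0, Y1) \<noteq> (0, 0)}"

definition hirz_rel :: "nat \<Rightarrow> (hcoords \<times> hcoords) set" where
  "hirz_rel \<delta> = {((X0, X1, Y0, Y1), (X0', X1', Y0', Y1')).
     (X0, X1, Y0, Y1) \<in> hirz_coords \<and>
     (\<exists>l m. l \<noteq> 0 \<and> m \<noteq> 0 \<and> X0' = l * X0 \<and> X1' = l * X1 \<and>
        Y0' = m * Y0 \<and> Y1' = inverse (l ^ \<delta>) * m * Y1)}"

definition hirzebruch :: "nat \<Rightarrow> hcoords set set" where
  "hirzebruch \<delta> = hirz_coords // hirz_rel \<delta>"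

definition hpoint :: "nat \<Rightarrow> hcoords \<Rightarrow> hcoords set" where
  "hpoint \<delta> h = hirz_rel \<delta> `` {h}"

definition X0_curve :: "nat \<Rightarrow> hcoords set set" where
  "X0_curve \<delta> = {hpoint \<delta> (X0, X1, Y0, Y1) | X0 X1 Y0 Y1.
     (X0, X1, Y0, Y1) \<in> hirz_coords \<and> X0 = 0}"

datatype chart = U00 | U10 | U11 | U01

fun chart_dom :: "chart \<Rightarrow> hcoords set" where
  "chart_dom U00 = {(X0, X1, Y0, Y1). X0 \<noteq> 0 \<and> Y0 \<noteq> 0}"
| "chart_dom U10 = {(X0, X1, Y0, Y1). X1 \<noteq> 0 \<and> Y0 \<noteq> 0}"
| "chart_dom U11 = {(X0, X1, Y0, Y1). X1 \<noteq> 0 \<and> Y1 \<noteq> 0}"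
| "chart_dom U01 = {(X0, X1, Y0, Y1). X0 \<noteq> 0 \<and> Y1 \<noteq> 0}"

fun chart_coords :: "nat \<Rightarrow> chart \<Rightarrow> hcoords \<Rightarrow> complex \<times> complex" where
  "chart_coords \<delta> U00 (X0, X1, Y0, Y1) = (X1 / X0, X0 ^ \<delta> * Y1 / Y0)"
| "chart_coords \<delta> U10 (X0, X1, Y0, Y1) = (X0 / X1, X1 ^ \<delta> * Y1 / Y0)"
| "chart_coords \<delta> U11 (X0, X1, Y0, Y1) = (X0 / X1, Y0 / (X1 ^ \<delta> * Y1))"
| "chart_coords \<delta> U01 (X0, X1, Y0, Y1) = (X1 / X0, Y0 / (X0 ^ \<delta> * Y1))"

text \<open>The affine coordinates $(x, y)$ of \<open>U00\<close> in terms of the coordinates $(s, t)$ of a chart.\<close>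

fun chart_change :: "nat \<Rightarrow> chart \<Rightarrow> birat \<times> birat" where
  "chart_change \<delta> U00 = (to_fract var1, to_fract var2)"
| "chart_change \<delta> U10 = (1 / to_fract var1, to_fract var1 ^ \<delta> * to_fract var2)"
| "chart_change \<delta> U11 = (1 / to_fract var1, to_fract var1 ^ \<delta> / to_fract var2)"
| "chart_change \<delta> U01 = (to_fract var1, 1 / to_fract var2)"

text \<open>\<open>extension_form \<delta> X c \<omega>\<close>: the polynomial 1-form \<open>\<omega>\<close> with coprime coefficients defines, in the
  chart \<open>c\<close>, the extension of \<open>X\<close>. It is unique up to a nonzero constant.\<close>

definition extension_form :: "nat \<Rightarrow> bipoly \<times> bipoly \<Rightarrow> chart \<Rightarrow> form \<Rightarrow> bool" where
  "extension_form \<delta> X c \<omega> \<longleftrightarrow> coprime (fst \<omega>) (snd \<omega>) \<and>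
     (case rat_pullback (chart_change \<delta> c) (form_of_field X) of (F, G) \<Rightarrow>
        \<exists>g. g \<noteq> 0 \<and> to_fract (fst \<omega>) = g * F \<and> to_fract (snd \<omega>) = g * G)"

definition dicritical_singularity :: "nat \<Rightarrow> bipoly \<times> bipoly \<Rightarrow> hcoords set \<Rightarrow> bool" where
  "dicritical_singularity \<delta> X p \<longleftrightarrow> p \<in> hirzebruch \<delta> \<and>
     (\<exists>c h \<omega>. h \<in> p \<and> h \<in> chart_dom c \<and> extension_form \<delta> X c \<omega> \<and>
        dicritical_form_at \<omega> (chart_coords \<delta> c h))"


section \<open>Well-definedness\<close>

lemma D2_mult: "D2 (p * q) = p * D2 q + q * D2 p"
  by (simp add: D2_def pderiv_mult)

lemma D1_mult: "D1 (p * q) = p * D1 q + q * D1 p"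
proof (rule poly_eqI)
  fix n
  have "coeff (D1 (p * q)) n = (\<Sum>i\<le>n. pderiv (coeff p i * coeff q (n - i)))"
    by (simp add: D1_def coeff_map_poly coeff_mult pderiv_sum)
  also have "\<dots> = (\<Sum>i\<le>n. coeff p i * pderiv (coeff q (n - i))) +
                   (\<Sum>i\<le>n. pderiv (coeff p i) * coeff q (n - i))"
    by (simp add: pderiv_mult sum.distrib mult.commute)
  also have "\<dots> = coeff (p * D1 q + D1 p * q) n"
    by (simp add: D1_def coeff_map_poly coeff_mult)
  finally show "coeff (D1 (p * q)) n = coeff (p * D1 q + q * D1 p) n"
    by (simp add: mult.commute)
qed

lemma fract_deriv_Fract:
  assumes D: "\<And>u v. D (u * v) = u * D v + v * D u" and "q \<noteq> 0"
  shows "fract_deriv D (Fract p q) = Fract (D p * q - p * D q) (q ^ 2)"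
proof -
  obtain u v where uv: "quot_of_fract (Fract p q) = (u, v)"
    by (cases "quot_of_fract (Fract p q)") auto
  have v: "v \<noteq> 0"
    using uv by (metis snd_conv snd_quot_of_fract_nonzero)
  have "Fract u v = Fract p q"
    using uv by (metis Fract_quot_of_fract fst_conv snd_conv)
  hence e: "u * q = p * v"
    using v \<open>q \<noteq> 0\<close> by (simp add: eq_fract)
  hence "u * D q + q * D u = p * D v + v * D p"
    using D by metis
  hence d: "q * D u = p * D v + v * D p - u * D q"
    by (simp add: algebra_simps)
  have "(D u * v - u * D v) * q ^ 2 = (q * D u) * (q * v) - (u * q) * (q * D v)"
    by (simp add: power2_eq_square algebra_simps)
  also have "\<dots> = q * D p * v ^ 2 - (u * q) * (v * D q)"
    unfolding d e by (simp add: e[symmetric] power2_eq_square algebra_simps)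
  also have "\<dots> = (D p * q - p * D q) * v ^ 2"
    unfolding e by (simp add: power2_eq_square algebra_simps)
  finally have "(D u * v - u * D v) * q ^ 2 = (D p * q - p * D q) * v ^ 2" .
  thus ?thesis
    using uv v \<open>q \<noteq> 0\<close> by (simp add: fract_deriv_def eq_fract)
qed

lemma equiv_hirz_rel: "equiv hirz_coords (hirz_rel \<delta>)"
proof (rule equivI)
  show "hirz_rel \<delta> \<subseteq> hirz_coords \<times> hirz_coords"
    by (auto simp: hirz_rel_def hirz_coords_def)
  show "refl_on hirz_coords (hirz_rel \<delta>)"
    unfolding refl_on_def hirz_rel_def by (auto intro!: exI[of _ 1])
  show "sym (hirz_rel \<delta>)"
  proof (rule symI)
    fix h h' assume "(h, h') \<in> hirz_rel \<delta>"
    then obtain X0 X1 Y0 Y1 l m where *: "h = (X0, X1, Y0, Y1)" "h \<in> hirz_coords" "l \<noteq> 0" "m \<noteq> 0"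
      "h' = (l * X0, l * X1, m * Y0, inverse (l ^ \<delta>) * m * Y1)"
      by (auto simp: hirz_rel_def)
    have "h' \<in> hirz_coords"
      using * by (auto simp: hirz_coords_def)
    moreover have "X0 = inverse l * (l * X0)" "X1 = inverse l * (l * X1)"
      "Y0 = inverse m * (m * Y0)"
      "Y1 = inverse (inverse l ^ \<delta>) * inverse m * (inverse (l ^ \<delta>) * m * Y1)"
      using * by (auto simp: field_simps)
    moreover have "inverse l \<noteq> 0" "inverse m \<noteq> 0"
      using * by auto
    ultimately show "(h', h) \<in> hirz_rel \<delta>"
      unfolding *(1) *(5) hirz_rel_def by blast
  qed
  show "trans (hirz_rel \<delta>)"
  proof (rule transI)
    fix h h' h'' assume "(h, h') \<in> hirz_rel \<delta>" "(h', h'') \<in> hirz_rel \<delta>"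
    then obtain X0 X1 Y0 Y1 l m l' m' where *: "h = (X0, X1, Y0, Y1)" "h \<in> hirz_coords"
      "l \<noteq> 0" "m \<noteq> 0" "l' \<noteq> 0" "m' \<noteq> 0"
      "h'' = (l' * (l * X0), l' * (l * X1), m' * (m * Y0),
              inverse (l' ^ \<delta>) * m' * (inverse (l ^ \<delta>) * m * Y1))"
      by (auto simp: hirz_rel_def)
    have "h'' = ((l' * l) * X0, (l' * l) * X1, (m' * m) * Y0,
                 inverse ((l' * l) ^ \<delta>) * (m' * m) * Y1)"
      by (simp add: *(7) power_mult_distrib mult_ac)
    moreover have "l' * l \<noteq> 0" "m' * m \<noteq> 0"
      using * by auto
    ultimately show "(h, h'') \<in> hirz_rel \<delta>"
      using *(2) unfolding *(1) hirz_rel_def by blast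
  qed
qed

end

theory Submission
  imports Defs "HOL-Analysis.Continuum_Not_Denumerable"
begin

text \<open>
  Write a rational first integral as \<open>f = A / B\<close> with coprime \<open>A\<close> and \<open>B\<close>. A point is a dicritical
  singularity iff it is a base point of the pencil spanned by \<open>A\<close> and \<open>B\<close>. Where \<open>f\<close> is defined it is constant
  on all divisors over the point, and these are invariant. At a base point, choose a value \<open>c\<close> which \<open>f\<close> does
  not take identically on any of the countably many divisors created by blowing up base points, and a
  Puiseux arc on which \<open>f = c\<close>. Blowing up along the arc lowers the order of \<open>B\<close> on it, so one reaches
  a divisor on which \<open>f\<close> is not constant; its centre is a terminal dicritical singularity. The points
  passed on the way are ordinary, since over regular and simple points there are only such points.

  Let \<open>S\<close> be the set of exponents \<open>(i, j)\<close> of monomials \<open>x^i y^j\<close> of \<open>A\<close> or \<open>B\<close>, and \<open>d\<close> the largest \<open>i\<close> with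
  \<open>(i, 0) \<in> S\<close>. Clearing denominators in \<open>f(1/s, s^\<delta> t)\<close> shows that $(0,1;1,0)$ is a base point iff
  \<open>i > d + \<delta> j\<close> for some \<open>(i, j) \<in> S\<close>, so \<open>\<delta>\<^sub>1\<close> is the least \<open>\<delta>\<close> for which this fails. For
  \<open>\<delta> > \<delta>\<^sub>1\<close> one has \<open>i < d + \<delta> j\<close> on \<open>S\<close> whenever \<open>j > 0\<close>. Hence, in the chart around $(0,1;0,1)$,
  numerator and denominator of \<open>f\<close> restrict to constant multiples of \<open>t^n\<close> on $X_0 = 0$, not both zero, where
  \<open>n\<close> is the degree of the pencil in \<open>y\<close>, and $(0,1;0,1)$ is the only base point on this curve. If \<open>n = 0\<close>,
  then \<open>f\<close> depends on \<open>x\<close> only, which is the excluded case.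
\<close>

section \<open>Substitution and derivations\<close>

text \<open>One relation carries the foliation through all charts and blowups:
  \<open>first_int\<close>, which says that the wedge of \<omega> with \<open>B dA - A dB\<close>
  vanishes. A common factor of \<open>A\<close> and \<open>B\<close> enters this Wronskian form only
  through its square. So the relation survives pull-back, division of \<omega> by a power of the
  exceptional equation, and cancellation of a common factor from the pencil, and lowest terms never
  have to be restored on the way. The obstacle is to end the search for a terminal dicritical point.
  It is bounded by a number attached to one arc, so an arc has to be produced, whence ramified power
  series. The bound is void if \<open>A\<close> and \<open>B\<close> both vanish identically on the
  arc, so coprimality in two polynomial variables has to be carried over to power series. The bridge
  is a nonzero polynomial in \<open>x\<close> alone of the form \<open>U * A + V * B\<close>: along
  an arc off the curve at infinity it would have to vanish at the inverse of a power series that is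
  transcendental over the constants.\<close>

lemma bipoly_induct [case_names const var1 var2 add mult]:
  fixes P :: bipoly
  assumes "\<And>c. R (const2 c)" and "R var1" and "R var2"
    and "\<And>P Q. R P \<Longrightarrow> R Q \<Longrightarrow> R (P + Q)" and "\<And>P Q. R P \<Longrightarrow> R Q \<Longrightarrow> R (P * Q)"
  shows "R P"
proof (induction P)
  case 0
  show ?case using assms(1)[of 0] by simp
next
  case (pCons p P)
  have "R [:p:]"
  proof (induction p)
    case 0
    show ?case using assms(1)[of 0] by simp
  next
    case (pCons c p)
    have "[:pCons c p:] = const2 c + var1 * [:p:]"
      by simp
    then show ?case
      using pCons assms by metis
  qed
  moreover have "pCons p P = [:p:] + var2 * P"
    by simp
  ultimately show ?case
    using pCons assms by metis
qed

text \<open>The target ring varies: polynomials, rational functions, numbers, power series,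
  fractions of power series, and polynomials in a grading variable. All of these substitutions are
  instances of this locale.\<close>

locale complex_hom = comm_ring_hom hom for hom :: "complex \<Rightarrow> 'a::comm_ring_1"
begin

lemma eval_hom: "comm_ring_hom (\<lambda>c. poly (map_poly hom c) u)"
proof -
  interpret h1: map_poly_comm_ring_hom hom ..
  show ?thesis
    by unfold_locales (auto simp: hom_distribs)
qed

lemma subst2_hom: "comm_ring_hom (\<lambda>P. subst2 hom P u v)"
proof -
  interpret h2: comm_ring_hom "\<lambda>c. poly (map_poly hom c) u"
    by (rule eval_hom)
  interpret h3: map_poly_comm_ring_hom "\<lambda>c. poly (map_poly hom c) u" ..
  show ?thesis
    unfolding subst2_def
    by unfold_locales (auto simp: h3.hom_add h3.hom_mult)
qed

sublocale subst2: comm_ring_hom "\<lambda>P. subst2 hom P u v"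
  by (rule subst2_hom)

lemma subst2_pCons: "subst2 hom (pCons p P) u v = poly (map_poly hom p) u + v * subst2 hom P u v"
proof -
  interpret h2: comm_ring_hom "\<lambda>c. poly (map_poly hom c) u"
    by (rule eval_hom)
  interpret h3: map_poly_comm_ring_hom "\<lambda>c. poly (map_poly hom c) u" ..
  show ?thesis
    unfolding subst2_def by (simp add: h2.map_poly_pCons_hom)
qed

lemma subst2_0 [simp]: "subst2 hom 0 u v = 0"
  by (rule subst2.hom_zero)

lemma subst2_const2 [simp]: "subst2 hom [:[:c:]:] u v = hom c"
  by (simp add: subst2_pCons map_poly_pCons_hom)

lemma subst2_var1 [simp]: "subst2 hom [:[:0, 1:]:] u v = u"
  by (simp add: subst2_pCons map_poly_pCons_hom)

lemma subst2_var2 [simp]: "subst2 hom [:0, 1:] u v = v"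
  by (simp add: subst2_pCons map_poly_pCons_hom)

lemma subst2_1 [simp]: "subst2 hom 1 u v = 1"
  by (rule subst2.hom_one)

lemma subst2_var2_plus [simp]: "subst2 hom [:[:c:], 1:] u v = hom c + v"
  by (simp add: subst2_pCons map_poly_pCons_hom)

lemma subst2_var1_plus [simp]: "subst2 hom [:[:c, 1:]:] u v = hom c + u"
  by (simp add: subst2_pCons map_poly_pCons_hom)

lemmas subst2_eval = subst2_const2 subst2_var1 subst2_var2 subst2_0 subst2_1 subst2_var2_plus
  subst2_var1_plus

lemmas subst2_simps = subst2.hom_add subst2.hom_mult subst2.hom_minus subst2.hom_uminus
  subst2.hom_power subst2.hom_sum

lemma subst2_unique:
  assumes "comm_ring_hom k" and "\<And>c. k (const2 c) = hom c" and "k var1 = u" and "k var2 = v"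
  shows "k P = subst2 hom P u v"
proof -
  interpret k: comm_ring_hom k by fact
  show ?thesis
    by (induction P rule: bipoly_induct) (auto simp: assms k.hom_add k.hom_mult subst2_simps)
qed

end

lemma complex_hom_const2: "complex_hom const2"
  by unfold_locales (auto simp: one_pCons)

lemma complex_hom_ident: "complex_hom (\<lambda>c. c)"
  by unfold_locales auto

lemma complex_hom_fps_const: "complex_hom fps_const"
  by unfold_locales (simp_all flip: fps_const_add fps_const_mult)

lemmas const2_subst2_simps = complex_hom.subst2_simps[OF complex_hom_const2]
lemmas const2_subst2_eval [simp] = complex_hom.subst2_eval[OF complex_hom_const2]
lemmas fps_subst2_simps = complex_hom.subst2_simps[OF complex_hom_fps_const]
lemmas fps_subst2_eval [simp] = complex_hom.subst2_eval[OF complex_hom_fps_const]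

lemma subst2_const2_ident [simp]: "subst2 const2 P var1 var2 = P"
  by (rule complex_hom.subst2_unique[OF complex_hom_const2, symmetric]) (unfold_locales, auto)

lemma subst2_comp:
  assumes "complex_hom \<iota>" and "comm_ring_hom h"
  shows "h (subst2 \<iota> P u v) = subst2 (\<lambda>c. h (\<iota> c)) P (h u) (h v)"
proof -
  interpret i: complex_hom \<iota> by fact
  interpret h: comm_ring_hom h by fact
  interpret hi: complex_hom "\<lambda>c. h (\<iota> c)"
    by unfold_locales (auto simp: i.hom_add i.hom_mult h.hom_add h.hom_mult)
  show ?thesis
    by (induction P rule: bipoly_induct)
       (auto simp: i.subst2_simps hi.subst2_simps h.hom_add h.hom_mult)
qed

lemma subst2_subst2:
  assumes "complex_hom \<iota>"
  shows "subst2 \<iota> (subst2 const2 P U V) u v = subst2 \<iota> P (subst2 \<iota> U u v) (subst2 \<iota> V u v)"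
proof -
  interpret i: complex_hom \<iota> by fact
  have "subst2 \<iota> (subst2 const2 P U V) u v =
      subst2 (\<lambda>c. subst2 \<iota> (const2 c) u v) P (subst2 \<iota> U u v) (subst2 \<iota> V u v)"
    by (rule subst2_comp) (auto intro: complex_hom_const2 i.subst2_hom)
  then show ?thesis by simp
qed

lemma D1_add: "D1 (P + Q) = D1 P + D1 Q"
  by (auto simp: D1_def pderiv_add coeff_map_poly intro!: poly_eqI)

lemma D2_add: "D2 (P + Q) = D2 P + D2 Q"
  by (simp add: D2_def pderiv_add)

lemma D1_const2 [simp]: "D1 [:[:c:]:] = 0"
  by (rule poly_eqI) (simp add: D1_def coeff_map_poly coeff_pCons pderiv_pCons split: nat.split)

lemma D1_simps [simp]: "D1 [:[:0, 1:]:] = 1" "D1 [:0, 1:] = 0" "D1 1 = 0" "D1 0 = 0"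
  and D2_simps [simp]: "D2 [:p:] = 0" "D2 [:0, 1:] = 1" "D2 1 = 0" "D2 0 = 0"
  by (simp_all add: D1_def D2_def map_poly_pCons pderiv_pCons map_poly_1 flip: one_pCons)

locale derivation =
  fixes \<iota> :: "complex \<Rightarrow> 'a::comm_ring_1" and d :: "'a \<Rightarrow> 'a"
  assumes hom: "complex_hom \<iota>"
    and d_add: "d (x + y) = d x + d y"
    and d_mult: "d (x * y) = x * d y + y * d x"
    and d_const [simp]: "d (\<iota> c) = 0"
begin

sublocale complex_hom \<iota> by (rule hom)

lemma d_0 [simp]: "d 0 = 0" and d_1 [simp]: "d 1 = 0"
  using d_const[of 0] d_const[of 1] by simp_all

lemma d_uminus: "d (- x) = - d x"
  using d_add[of x "- x"] by (simp add: eq_neg_iff_add_eq_0 add.commute)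

lemma d_diff: "d (x - y) = d x - d y"
  using d_add[of x "- y"] by (simp add: d_uminus)

text \<open>Both sides are additive in \<open>P\<close> and obey the same product rule, so the chain
  rule only has to be checked on constants and on the two variables.\<close>

lemma d_subst2:
  "d (subst2 \<iota> P u v) = subst2 \<iota> (D1 P) u v * d u + subst2 \<iota> (D2 P) u v * d v"
proof (induction P rule: bipoly_induct)
  case (add P Q)
  then show ?case
    by (simp add: D1_add D2_add subst2_simps d_add algebra_simps)
next
  case (mult P Q)
  then show ?case
    by (simp add: subst2_simps d_mult D1_mult D2_mult algebra_simps)
qed simp_all

end

lemma derivation_D1: "derivation const2 D1"
  by (rule derivation.intro) (simp_all add: complex_hom_const2 D1_add D1_mult)

lemma derivation_D2: "derivation const2 D2"
  by (rule derivation.intro) (simp_all add: complex_hom_const2 D2_add D2_mult)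

text \<open>The equation \<omega> wedge \<open>d(A / B)\<close> = 0 after multiplication by
  \<open>B\<^sup>2\<close>. Swapping \<open>A\<close> and \<open>B\<close> only changes the sign of
  both sides, so zeros and poles of the first integral are treated alike.\<close>

definition first_int :: "form \<Rightarrow> bipoly \<Rightarrow> bipoly \<Rightarrow> bool" where
  "first_int \<omega> A B \<longleftrightarrow>
     fst \<omega> * (B * D2 A - A * D2 B) = snd \<omega> * (B * D1 A - A * D1 B)"

text \<open>Pulling back multiplies the wedge of two 1-forms by the Jacobian, which is the factor
  \<open>u1 * v2 - u2 * v1\<close> in the proof.\<close>

lemma wedge_identity:
  fixes p q :: "'a::comm_ring_1"
  assumes "p * (b * ay - a * bY) = q * (b * ax - a * bx)"
  shows "(p * u1 + q * v1) * (b * (ax * u2 + ay * v2) - a * (bx * u2 + bY * v2)) =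
         (p * u2 + q * v2) * (b * (ax * u1 + ay * v1) - a * (bx * u1 + bY * v1))"
proof -
  have "(p * u1 + q * v1) * (b * (ax * u2 + ay * v2) - a * (bx * u2 + bY * v2)) -
         (p * u2 + q * v2) * (b * (ax * u1 + ay * v1) - a * (bx * u1 + bY * v1)) =
         (p * (b * ay - a * bY) - q * (b * ax - a * bx)) * (u1 * v2 - u2 * v1)"
    by (simp add: algebra_simps)
  then show ?thesis
    using assms by simp
qed

lemma pullback_wronskian:
  assumes d1: "derivation \<iota> d1" and d2: "derivation \<iota> d2"
    and "first_int \<omega> A B" and a_def: "a = subst2 \<iota> A u v" and b_def: "b = subst2 \<iota> B u v"
  shows "fst (pullback \<iota> d1 d2 (u, v) \<omega>) * (b * d2 a - a * d2 b) =
         snd (pullback \<iota> d1 d2 (u, v) \<omega>) * (b * d1 a - a * d1 b)"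
proof -
  interpret d1: derivation \<iota> d1 by fact
  interpret d2: derivation \<iota> d2 by fact
  obtain P Q where \<omega>: "\<omega> = (P, Q)" by force
  have "P * (B * D2 A - A * D2 B) = Q * (B * D1 A - A * D1 B)"
    using assms(3) by (simp add: first_int_def \<omega>)
  then have "subst2 \<iota> (P * (B * D2 A - A * D2 B)) u v = subst2 \<iota> (Q * (B * D1 A - A * D1 B)) u v"
    by (rule arg_cong)
  then have e: "subst2 \<iota> P u v * (b * subst2 \<iota> (D2 A) u v - a * subst2 \<iota> (D2 B) u v) =
      subst2 \<iota> Q u v * (b * subst2 \<iota> (D1 A) u v - a * subst2 \<iota> (D1 B) u v)"
    by (simp add: d1.subst2_simps a_def b_def)
  show ?thesis
    \<comment> \<open>The definitions of \<open>a\<close> and \<open>b\<close> are opened only where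
      the chain rule applies and then folded back, which brings the goal into the shape of
      \<open>wedge_identity\<close>.\<close>
    unfolding \<omega> pullback_def Let_def a_def[symmetric] b_def[symmetric] split fst_conv snd_conv
    unfolding a_def d1.d_subst2 d2.d_subst2 unfolding a_def[symmetric]
    unfolding b_def d1.d_subst2 d2.d_subst2 unfolding b_def[symmetric]
    by (rule wedge_identity) (rule e)
qed

text \<open>The terms containing the derivative of the common factor \<open>x\<close> cancel. This
  lets powers of the exceptional equation and denominators be removed from the pencil.\<close>

lemma wronskian_scale:
  assumes "derivation \<iota> d"
  shows "(x * b) * d (x * a) - (x * a) * d (x * b) = x\<^sup>2 * (b * d a - a * d b)"
proof -
  interpret derivation \<iota> d by fact
  show ?thesis by (simp add: d_mult algebra_simps power2_eq_square)
qed

section \<open>Homogeneous parts\<close>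

lemma coeff_hom_part:
  "coeff (coeff (hom_part m P) j) i = (if i + j = m then coeff (coeff P j) i else 0)"
proof -
  have "coeff (coeff (hom_part m P) j) i =
      (\<Sum>l\<le>m. if l = i then (if i + j = m then coeff (coeff P j) i else 0) else 0)"
    unfolding hom_part_def coeff_sum by (rule sum.cong) (auto simp: coeff_monom)
  also have "\<dots> = (if i + j = m then coeff (coeff P j) i else 0)"
    by (simp add: sum.delta)
  finally show ?thesis .
qed

lemma bipoly_eqI:
  assumes "\<And>i j. coeff (coeff P j) i = coeff (coeff Q j) i"
  shows "P = (Q :: bipoly)"
  using assms by (intro poly_eqI) blast

lemma hom_part_0 [simp]: "hom_part m 0 = 0"
  by (rule bipoly_eqI) (simp add: coeff_hom_part)

lemma hom_part_diff: "hom_part m (P - Q) = hom_part m P - hom_part m Q"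
  by (rule bipoly_eqI) (simp add: coeff_hom_part)

lemma hom_part_const2_mult: "hom_part m ([:[:c:]:] * P) = const2 c * hom_part m P"
  by (rule bipoly_eqI) (simp add: coeff_hom_part)

lemma bipoly_eq_0_iff_hom_part: "P = 0 \<longleftrightarrow> (\<forall>m. hom_part m P = 0)"
proof
  assume *: "\<forall>m. hom_part m P = 0"
  show "P = 0"
  proof (rule bipoly_eqI)
    fix i j
    have "coeff (coeff (hom_part (i + j) P) j) i = 0"
      using * by simp
    then show "coeff (coeff P j) i = coeff (coeff 0 j) i"
      by (simp add: coeff_hom_part)
  qed
qed simp

lemma coeff_of_nat_mult: "coeff (of_nat n * p) i = of_nat n * coeff p i"
  by (simp add: of_nat_poly)

lemma hom_part_D1: "hom_part m (D1 P) = D1 (hom_part (Suc m) P)"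
  by (rule bipoly_eqI) (simp add: coeff_hom_part D1_def coeff_map_poly coeff_pderiv)

lemma hom_part_D2: "hom_part m (D2 P) = D2 (hom_part (Suc m) P)"
  by (rule bipoly_eqI) (simp add: coeff_hom_part D2_def coeff_pderiv coeff_of_nat_mult del: of_nat_Suc)

text \<open>Euler's identity. It evaluates the radial contraction of a form in two opposite
  situations: for the differential of one homogeneous polynomial of positive degree the result is
  not zero, while for the Wronskian form of two of equal degree it cancels.\<close>

lemma euler_hom_part:
  "var1 * D1 (hom_part m P) + var2 * D2 (hom_part m P) = of_nat m * hom_part m P"
  by (rule bipoly_eqI)
     (auto simp: coeff_hom_part D1_def D2_def coeff_map_poly coeff_pderiv coeff_pCons coeff_of_nat_mult
       algebra_simps simp del: of_nat_Suc split: nat.split, simp flip: distrib_right of_nat_add)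

text \<open>$P(zx, zy)$ as a polynomial in $z$: its coefficients are the homogeneous parts of $P$.\<close>

definition graded :: "bipoly \<Rightarrow> bipoly poly" where
  "graded P = subst2 (\<lambda>c. [:const2 c:]) P [:0, var1:] [:0, var2:]"

lemma complex_hom_const3: "complex_hom (\<lambda>c. [:const2 c:])"
  by unfold_locales (simp_all flip: one_pCons)

lemma coeff_graded: "coeff (graded P) m = hom_part m P"
proof -
  interpret h: complex_hom "\<lambda>c. [:const2 c:]"
    by (rule complex_hom_const3)
  have *: "coeff (poly (map_poly (\<lambda>c. [:const2 c:]) p) [:0, var1:]) m = hom_part m [:p:]" for p m
  proof (induction p arbitrary: m)
    case (pCons c p)
    have "hom_part m [:pCons c p:] = (if m = 0 then const2 c else var1 * hom_part (m - 1) [:p:])"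
      by (rule bipoly_eqI) (auto simp: coeff_hom_part coeff_pCons split: nat.splits)
    then show ?case
      by (cases m) (simp_all add: h.map_poly_pCons_hom pCons.IH)
  qed simp
  show ?thesis
  proof (induction P arbitrary: m)
    case (pCons p P)
    have "hom_part m (pCons p P) = hom_part m [:p:] + (if m = 0 then 0 else var2 * hom_part (m - 1) P)"
      by (rule bipoly_eqI) (auto simp: coeff_hom_part coeff_pCons split: nat.splits)
    then show ?case
      using pCons.IH
      by (cases m) (simp_all add: graded_def h.subst2_pCons *)
  qed (simp add: graded_def)
qed

text \<open>Substituting \<open>zx\<close> and \<open>zy\<close> is a ring homomorphism, so this is
  the Cauchy product of two polynomials in \<open>z\<close>.\<close>

lemma hom_part_mult: "hom_part n (P * Q) = (\<Sum>k\<le>n. hom_part k P * hom_part (n - k) Q)"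
proof -
  interpret h: complex_hom "\<lambda>c. [:const2 c:]"
    by (rule complex_hom_const3)
  have "graded (P * Q) = graded P * graded Q"
    by (simp add: graded_def h.subst2_simps)
  then show ?thesis
    by (simp add: coeff_graded[symmetric] coeff_mult)
qed

lemma hom_part_mult_below:
  assumes "\<And>k. k < m \<Longrightarrow> hom_part k P = 0" and "\<And>k. k < n \<Longrightarrow> hom_part k Q = 0"
  shows "hom_part (m + n) (P * Q) = hom_part m P * hom_part n Q"
    and "l < m + n \<Longrightarrow> hom_part l (P * Q) = 0"
proof -
  have "hom_part (m + n) (P * Q) =
      (\<Sum>k\<le>m + n. if k = m then hom_part m P * hom_part n Q else 0)"
    unfolding hom_part_mult
  proof (rule sum.cong)
    fix k assume "k \<in> {..m + n}"
    then show "hom_part k P * hom_part (m + n - k) Q =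
        (if k = m then hom_part m P * hom_part n Q else 0)"
      using assms(1)[of k] assms(2)[of "m + n - k"] by (cases "k < m"; cases "k = m") auto
  qed simp
  then show "hom_part (m + n) (P * Q) = hom_part m P * hom_part n Q"
    by simp
  show "hom_part l (P * Q) = 0" if "l < m + n"
    unfolding hom_part_mult
  proof (rule sum.neutral, intro ballI)
    fix k assume "k \<in> {..l}"
    then show "hom_part k P * hom_part (l - k) Q = 0"
      using assms(1)[of k] assms(2)[of "l - k"] that by (cases "k < m") auto
  qed
qed

lemma mult_form_below:
  assumes "k < mult_form (P, Q)"
  shows "hom_part k P = 0" "hom_part k Q = 0"
  using not_less_Least[of k "\<lambda>m. hom_part m P \<noteq> 0 \<or> hom_part m Q \<noteq> 0"] assms
  by (auto simp: mult_form_def)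

lemma mult_form_nonzero:
  assumes "(P, Q) \<noteq> (0, 0)"
  shows "hom_part (mult_form (P, Q)) P \<noteq> 0 \<or> hom_part (mult_form (P, Q)) Q \<noteq> 0"
proof -
  obtain m where "hom_part m P \<noteq> 0 \<or> hom_part m Q \<noteq> 0"
    using assms bipoly_eq_0_iff_hom_part[of P] bipoly_eq_0_iff_hom_part[of Q] by blast
  then show ?thesis
    unfolding mult_form_def case_prod_conv by (rule LeastI)
qed

lemma mult_form_eqI:
  assumes "\<And>k. k < m \<Longrightarrow> hom_part k P = 0 \<and> hom_part k Q = 0"
    and "hom_part m P \<noteq> 0 \<or> hom_part m Q \<noteq> 0"
  shows "mult_form (P, Q) = m"
  unfolding mult_form_def case_prod_conv
  by (rule Least_equality) (use assms not_le_imp_less in blast)+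

lemma (in complex_hom) subst2_monom:
  "subst2 hom (monom (monom c i) j) u v = hom c * u ^ i * v ^ j"
proof -
  have "monom (monom c i) j = const2 c * var1 ^ i * var2 ^ j"
    by (simp add: poly_const_pow monom_altdef smult_monom flip: x_pow_n)
  then show ?thesis
    by (simp only: subst2_simps subst2_const2 subst2_var1 subst2_var2)
qed

lemma (in complex_hom) subst2_hom_part:
  "subst2 hom (hom_part m P) u v = (\<Sum>i\<le>m. hom (coeff (coeff P (m - i)) i) * u ^ i * v ^ (m - i))"
  by (simp add: hom_part_def subst2_simps subst2_monom)

lemma (in complex_hom) subst2_hom_part_scale:
  "subst2 hom (hom_part m P) (w * u) (w * v) = w ^ m * subst2 hom (hom_part m P) u v"
  unfolding subst2_hom_part sum_distrib_left
proof (rule sum.cong)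
  fix i assume "i \<in> {..m}"
  then have "w ^ m = w ^ i * w ^ (m - i)"
    by (simp flip: power_add)
  then show "hom (coeff (coeff P (m - i)) i) * (w * u) ^ i * (w * v) ^ (m - i) =
      w ^ m * (hom (coeff (coeff P (m - i)) i) * u ^ i * v ^ (m - i))"
    by (simp add: power_mult_distrib mult_ac)
qed simp

lemma sum_hom_part: 
  assumes "degree (graded P) \<le> N"
  shows "(\<Sum>k\<le>N. hom_part k P) = P"
proof -
  interpret h: complex_hom "\<lambda>c. [:const2 c:]"
    by (rule complex_hom_const3)
  \<comment> \<open>Setting \<open>z = 1\<close> in the graded polynomial gives back
    \<open>P\<close> and adds up its homogeneous parts.\<close>
  have "poly (graded P) 1 = subst2 (\<lambda>c. poly [:const2 c:] 1) P (poly [:0, var1:] 1) (poly [:0, var2:] 1)"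
    unfolding graded_def by (rule subst2_comp[OF complex_hom_const3]) (unfold_locales, auto)
  then have "poly (graded P) 1 = P"
    by simp
  moreover have "poly (graded P) 1 = (\<Sum>k\<le>N. hom_part k P)"
    unfolding poly_altdef using assms
    by (intro sum.mono_neutral_cong_left) (auto simp: coeff_graded[symmetric] coeff_eq_0)
  ultimately show ?thesis by simp
qed

lemmas const2_subst2_hom_part = complex_hom.subst2_hom_part[OF complex_hom_const2]
lemmas const2_subst2_hom_part_scale = complex_hom.subst2_hom_part_scale[OF complex_hom_const2]

section \<open>Blowing up\<close>

text \<open>In the chart of the blowup at \<open>q\<close> one has \<open>(x, y) = exc_eq q * exc_dir q\<close>, where \<open>exc_eq q\<close> is the
  equation of the exceptional divisor. This makes the two charts accessible to the same argument.\<close>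

fun exc_eq :: "exc_point \<Rightarrow> bipoly" where
  "exc_eq (Slope c) = var1" | "exc_eq Vertical = var2"

fun exc_dir :: "exc_point \<Rightarrow> bipoly \<times> bipoly" where
  "exc_dir (Slope c) = (1, var2 + const2 c)" | "exc_dir Vertical = (var1, 1)"

definition blowup :: "exc_point \<Rightarrow> bipoly \<Rightarrow> bipoly" where
  "blowup q P = subst2 const2 P (exc_eq q * fst (exc_dir q)) (exc_eq q * snd (exc_dir q))"

text \<open>Dehomogenization in the chart at \<open>q\<close>: on a homogeneous polynomial it is
  what the blowup leaves once the power of \<open>exc_eq q\<close> is split off.\<close>

definition dehom :: "exc_point \<Rightarrow> bipoly \<Rightarrow> bipoly" where
  "dehom q P = subst2 const2 P (fst (exc_dir q)) (snd (exc_dir q))"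

lemma blowup_simps:
  "blowup q (P + Q) = blowup q P + blowup q Q" "blowup q (P * Q) = blowup q P * blowup q Q"
  "blowup q (P - Q) = blowup q P - blowup q Q" "blowup q [:[:c:]:] = const2 c" "blowup q 0 = 0"
  by (simp_all add: blowup_def const2_subst2_simps)

lemma dehom_simps:
  "dehom q (P + Q) = dehom q P + dehom q Q" "dehom q (P * Q) = dehom q P * dehom q Q"
  "dehom q (P - Q) = dehom q P - dehom q Q" "dehom q [:[:c:]:] = const2 c" "dehom q 0 = 0"
  by (simp_all add: dehom_def const2_subst2_simps)

lemma exc_eq_nonzero [simp]: "exc_eq q \<noteq> 0"
  by (cases q) auto

lemma exc_eq_not_unit: "\<not> is_unit (exc_eq q)"
  by (cases q) (auto simp: is_unit_poly_iff is_unit_pCons_iff)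

lemma blowup_hom_part: "blowup q (hom_part m P) = exc_eq q ^ m * dehom q (hom_part m P)"
  by (simp add: blowup_def dehom_def const2_subst2_hom_part_scale)

text \<open>The part of degree \<open>k\<close> contributes \<open>exc_eq q ^ k\<close> times its
  dehomogenization, so everything above degree \<open>m\<close> disappears on the exceptional
  divisor after division by \<open>exc_eq q ^ m\<close>.\<close>

lemma blowup_order:
  assumes "\<And>k. k < m \<Longrightarrow> hom_part k P = 0"
  shows "\<exists>R. blowup q P = exc_eq q ^ m * (dehom q (hom_part m P) + exc_eq q * R)"
proof -
  define N where "N = max m (degree (graded P))"
  have "blowup q P = blowup q (\<Sum>k\<le>N. hom_part k P)"
    using sum_hom_part[of P N] by (simp add: N_def)
  also have "\<dots> = (\<Sum>k\<le>N. exc_eq q ^ k * dehom q (hom_part k P))"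
    by (simp add: blowup_hom_part[symmetric]) (simp add: blowup_def const2_subst2_simps)
  also have "\<dots> = (\<Sum>k\<in>{m..N}. exc_eq q ^ k * dehom q (hom_part k P))"
    using assms by (intro sum.mono_neutral_right) (auto simp: dehom_simps)
  also have "\<dots> = exc_eq q ^ m * dehom q (hom_part m P) +
      (\<Sum>k\<in>{Suc m..N}. exc_eq q ^ k * dehom q (hom_part k P))"
    by (subst sum.atLeast_Suc_atMost) (auto simp: N_def)
  also have "(\<Sum>k\<in>{Suc m..N}. exc_eq q ^ k * dehom q (hom_part k P)) =
      (\<Sum>k\<in>{Suc m..N}. exc_eq q ^ Suc m * (exc_eq q ^ (k - Suc m) * dehom q (hom_part k P)))"
    by (rule sum.cong) (auto simp flip: power_add mult.assoc power_Suc)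
  also have "\<dots> = exc_eq q ^ m * (exc_eq q * (\<Sum>k\<in>{Suc m..N}. exc_eq q ^ (k - Suc m) * dehom q (hom_part k P)))"
    by (simp flip: sum_distrib_left add: mult_ac)
  finally show ?thesis
    by (auto simp: distrib_left)
qed

definition at_origin :: "bipoly \<Rightarrow> complex" where
  "at_origin P = coeff (coeff P 0) 0"

lemma at_origin_subst2: "subst2 (\<lambda>c. c) P 0 0 = at_origin P"
proof -
  have "map_poly (\<lambda>c. poly (map_poly (\<lambda>c. c) c) 0) P = map_poly (\<lambda>p. coeff p 0) P"
    by (rule map_poly_cong) (simp add: map_poly_idI poly_0_coeff_0)
  then show ?thesis
    by (simp add: subst2_def at_origin_def poly_0_coeff_0 coeff_map_poly)
qed

lemma at_origin_simps [simp]: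
  "at_origin (P + Q) = at_origin P + at_origin Q" "at_origin (P * Q) = at_origin P * at_origin Q"
  "at_origin (P - Q) = at_origin P - at_origin Q" "at_origin [:[:c:]:] = c" "at_origin 0 = 0"
  "at_origin [:[:0, 1:]:] = 0" "at_origin [:0, 1:] = 0" "at_origin 1 = 1"
  by (simp_all add: at_origin_def coeff_mult_0)

lemma at_origin_exc_eq [simp]: "at_origin (exc_eq q) = 0"
  by (cases q) auto

lemma hom_part_0_eq: "hom_part 0 P = const2 (at_origin P)"
  by (simp add: hom_part_def at_origin_def monom_0)

lemma at_origin_hom_part_0: "at_origin P = 0 \<longleftrightarrow> hom_part 0 P = 0"
  by (simp add: hom_part_0_eq)

lemma at_origin_blowup [simp]: "at_origin (blowup q P) = at_origin P"
proof -
  have "at_origin (blowup q P) = at_origin (subst2 const2 P (exc_eq q * fst (exc_dir q)) (exc_eq q * snd (exc_dir q)))"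
    by (simp add: blowup_def)
  also have "\<dots> = subst2 (\<lambda>c. at_origin (const2 c)) P (at_origin (exc_eq q * fst (exc_dir q))) (at_origin (exc_eq q * snd (exc_dir q)))"
    by (rule subst2_comp[OF complex_hom_const2]) (unfold_locales, auto)
  also have "\<dots> = at_origin P"
    by (simp add: at_origin_subst2)
  finally show ?thesis .
qed

text \<open>A homogeneous part of degree \<open>m\<close> has one coefficient for each power of one
  variable, and restricting its dehomogenization to the divisor keeps all of them. In the chart at
  \<open>Slope c\<close> the translation by \<open>c\<close> is undone first.\<close>

lemma exc_eq_dvd_dehom:
  "exc_eq q dvd dehom q (hom_part m P) \<longleftrightarrow> hom_part m P = 0"
proof (cases q)
  case (Slope c)
  show ?thesis
  proof
    assume "exc_eq q dvd dehom q (hom_part m P)"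
    then obtain R where "dehom q (hom_part m P) = var1 * R"
      by (auto simp: Slope elim: dvdE)
    then have "subst2 const2 (dehom q (hom_part m P)) 0 (var2 - const2 c) = subst2 const2 (var1 * R) 0 (var2 - const2 c)"
      by simp
    then have "subst2 const2 (hom_part m P) 1 var2 = 0"
      by (simp add: Slope dehom_def subst2_subst2[OF complex_hom_const2] const2_subst2_simps del: mult_pCons_left)
    then have *: "(\<Sum>i\<le>m. monom [:coeff (coeff P (m - i)) i:] (m - i)) = 0"
      by (simp add: const2_subst2_hom_part monom_altdef)
    have "coeff (coeff P j) i = 0" if "i + j = m" for i j
    proof -
      have "0 = coeff (coeff (\<Sum>l\<le>m. monom [:coeff (coeff P (m - l)) l:] (m - l)) j) 0"
        by (simp add: *)
      also have "\<dots> = (\<Sum>l\<le>m. if l = i then coeff (coeff P j) i else 0)"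
        unfolding coeff_sum by (rule sum.cong) (use that in \<open>auto simp: coeff_monom\<close>)
      also have "\<dots> = coeff (coeff P j) i"
        using that by (simp add: sum.delta)
      finally show ?thesis by simp
    qed
    then show "hom_part m P = 0"
      by (intro bipoly_eqI) (simp add: coeff_hom_part)
  qed (simp add: dehom_simps)
next
  case Vertical
  show ?thesis
  proof
    assume "exc_eq q dvd dehom q (hom_part m P)"
    then obtain R where "dehom q (hom_part m P) = var2 * R"
      by (auto simp: Vertical elim: dvdE)
    then have "subst2 const2 (dehom q (hom_part m P)) var1 0 = subst2 const2 (var2 * R) var1 0"
      by simp
    then have "subst2 const2 (hom_part m P) var1 1 = 0"
      by (simp add: Vertical dehom_def subst2_subst2[OF complex_hom_const2] const2_subst2_simps del: mult_pCons_left)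
    then have *: "(\<Sum>i\<le>m. [:monom (coeff (coeff P (m - i)) i) i:]) = 0"
      by (simp add: const2_subst2_hom_part monom_altdef poly_const_pow)
    have "coeff (coeff P j) i = 0" if "i + j = m" for i j
    proof -
      have "0 = coeff (coeff (\<Sum>l\<le>m. [:monom (coeff (coeff P (m - l)) l) l:]) 0) i"
        by (simp add: *)
      also have "\<dots> = (\<Sum>l\<le>m. if l = i then coeff (coeff P j) i else 0)"
        unfolding coeff_sum by (rule sum.cong) (use that in \<open>auto simp: coeff_monom\<close>)
      also have "\<dots> = coeff (coeff P j) i"
        using that by (simp add: sum.delta)
      finally show ?thesis by simp
    qed
    then show "hom_part m P = 0"
      by (intro bipoly_eqI) (simp add: coeff_hom_part)
  qed (simp add: dehom_simps)
qed

lemma blowup_eq_0_iff [simp]: "blowup q P = 0 \<longleftrightarrow> P = 0"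
proof
  assume *: "blowup q P = 0"
  show "P = 0"
  proof (rule ccontr)
    assume "P \<noteq> 0"
    then have "hom_part (mult_form (P, P)) P \<noteq> 0"
      using mult_form_nonzero[of P P] by auto
    moreover obtain R where "blowup q P = exc_eq q ^ mult_form (P, P) * (dehom q (hom_part (mult_form (P, P)) P) + exc_eq q * R)"
      using blowup_order[of "mult_form (P, P)" P q] mult_form_below[of _ P P] by blast
    then have "dehom q (hom_part (mult_form (P, P)) P) + exc_eq q * R = 0"
      using * by simp
    then have "exc_eq q dvd dehom q (hom_part (mult_form (P, P)) P)"
      by (metis add_eq_0_iff dvd_minus_iff dvd_triv_left)
    ultimately show False
      by (simp add: exc_eq_dvd_dehom)
  qed
qed (simp add: blowup_simps)

definition form_blowup :: "exc_point \<Rightarrow> form \<Rightarrow> form" where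
  "form_blowup q = poly_pullback (exc_eq q * fst (exc_dir q), exc_eq q * snd (exc_dir q))"

lemma form_blowup_Slope:
  "form_blowup (Slope c) (P, Q) =
     (blowup (Slope c) P + (var2 + const2 c) * blowup (Slope c) Q, var1 * blowup (Slope c) Q)"
proof -
  have "D1 (var1 * (var2 + const2 c)) = var2 + const2 c" "D2 (var1 * (var2 + const2 c)) = var1"
    by (simp_all add: D1_mult D2_mult D1_add D2_add del: mult_pCons_left mult_pCons_right add_pCons)
  then show ?thesis
    by (simp add: form_blowup_def pullback_def blowup_def Let_def ac_simps
        del: mult_pCons_left mult_pCons_right add_pCons)
qed

lemma form_blowup_Vertical:
  "form_blowup Vertical (P, Q) =
     (var2 * blowup Vertical P, var1 * blowup Vertical P + blowup Vertical Q)"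
proof -
  have "D1 (var2 * var1) = var2" "D2 (var2 * var1) = var1"
    by (simp_all add: D1_mult D2_mult del: mult_pCons_left mult_pCons_right)
  then show ?thesis
    by (simp add: form_blowup_def pullback_def blowup_def Let_def ac_simps
        del: mult_pCons_left mult_pCons_right)
qed

lemma strict_transform_eq:
  "strict_transform q \<omega> = divide_max_power (exc_eq q) (form_blowup q \<omega>)"
  by (cases q) (simp_all add: form_blowup_def mult.commute del: mult_pCons_left mult_pCons_right)

lemma divide_max_power_eqI:
  assumes "e \<noteq> 0" and "\<not> (e dvd p \<and> e dvd q)"
  shows "divide_max_power e (e ^ k * p, e ^ k * q) = (p, q)"
proof -
  have "(GREATEST j. e ^ j dvd e ^ k * p \<and> e ^ j dvd e ^ k * q) = k"
  proof (rule Greatest_equality)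
    fix j assume *: "e ^ j dvd e ^ k * p \<and> e ^ j dvd e ^ k * q"
    show "j \<le> k"
    proof (rule ccontr)
      assume "\<not> j \<le> k"
      then have "e ^ k * e dvd e ^ j"
        by (metis not_less_eq_eq le_imp_power_dvd power_Suc2)
      then have "e ^ k * e dvd e ^ k * p" "e ^ k * e dvd e ^ k * q"
        using * dvd_trans by blast+
      then show False
        using assms by simp
    qed
  qed simp
  then show ?thesis
    using assms by (simp add: divide_max_power_def)
qed

text \<open>Since \<open>e\<close> is not a unit and one of \<open>F\<close>, \<open>G\<close> is
  nonzero, the admissible exponents are bounded, and so the value chosen by \<open>GREATEST\<close>
  is itself admissible.\<close>

lemma divide_max_power_spec:
  assumes "\<not> is_unit e" and "(F, G) \<noteq> (0, 0)"
  obtains k where "F = e ^ k * fst (divide_max_power e (F, G))"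
    "G = e ^ k * snd (divide_max_power e (F, G))"
proof -
  define k where "k = (GREATEST k. e ^ k dvd F \<and> e ^ k dvd G)"
  have "finite {n. e ^ n dvd F \<and> e ^ n dvd G}"
  proof (cases "F = 0")
    case True
    then show ?thesis
      using assms finite_divisor_powers[of G e] by (auto elim: rev_finite_subset)
  next
    case False
    then show ?thesis
      using assms finite_divisor_powers[of F e] by (auto elim: rev_finite_subset)
  qed
  then obtain b where b: "\<forall>n. e ^ n dvd F \<and> e ^ n dvd G \<longrightarrow> n \<le> b"
    unfolding finite_nat_set_iff_bounded_le by blast
  have "e ^ k dvd F \<and> e ^ k dvd G"
    unfolding k_def by (rule GreatestI_nat[where k = 0 and b = b]) (unfold power_0, intro conjI one_dvd, use b in blast)
  then show ?thesis
    by (intro that[of k]) (simp_all add: divide_max_power_def flip: k_def)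
qed

lemma strict_transform_spec:
  assumes "\<omega> \<noteq> (0, 0)"
  obtains k where "form_blowup q \<omega> = (exc_eq q ^ k * fst (strict_transform q \<omega>), exc_eq q ^ k * snd (strict_transform q \<omega>))"
    and "strict_transform q \<omega> \<noteq> (0, 0)"
proof -
  obtain P Q where \<omega>: "\<omega> = (P, Q)" by force
  obtain F G where FG: "form_blowup q \<omega> = (F, G)" by force
  have nz: "(F, G) \<noteq> (0, 0)"
  proof
    assume "(F, G) = (0, 0)"
    then have "P = 0 \<and> Q = 0"
      using FG \<omega>
      by (cases q) (auto simp: form_blowup_Slope form_blowup_Vertical blowup_simps simp del: mult_pCons_left mult_pCons_right)
    with assms \<omega> show False by simp
  qed
  obtain k where "F = exc_eq q ^ k * fst (strict_transform q \<omega>)" "G = exc_eq q ^ k * snd (strict_transform q \<omega>)"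
    using divide_max_power_spec[OF exc_eq_not_unit nz, of q] unfolding strict_transform_eq FG by metis
  then show ?thesis
    using nz by (intro that[of k]) (auto simp: FG)
qed

section \<open>Regular and simple points\<close>

definition nonresonant :: "complex \<Rightarrow> complex \<Rightarrow> bool" where
  "nonresonant l1 l2 \<longleftrightarrow>
     l1 * l2 \<noteq> 0 \<and> \<not> (\<exists>r::rat. r > 0 \<and> l1 / l2 = of_rat r) \<or>
     l1 * l2 = 0 \<and> l1 ^ 2 + l2 ^ 2 \<noteq> 0"

lemma nonresonant_sym: "nonresonant l1 l2 \<Longrightarrow> nonresonant l2 l1"
proof -
  have "\<exists>r::rat. r > 0 \<and> l1 / l2 = of_rat r" if "r > 0" "l2 / l1 = of_rat r" for r :: rat
  proof (intro exI conjI)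
    show "l1 / l2 = of_rat (inverse r)"
      using that by (metis inverse_divide of_rat_inverse)
  qed (use that in simp)
  then show "nonresonant l1 l2 \<Longrightarrow> nonresonant l2 l1"
    by (auto simp: nonresonant_def mult.commute add.commute)
qed

lemma not_nonresonant_refl: "\<not> nonresonant l l"
  by (auto simp: nonresonant_def intro!: exI[of _ 1])

lemma nonresonant_uminus: "l \<noteq> 0 \<Longrightarrow> nonresonant l (- l)"
proof -
  have "- 1 \<noteq> (of_rat r :: complex)" if "r > 0" for r :: rat
  proof
    assume "- 1 = (of_rat r :: complex)"
    then have "(of_rat (- 1) :: complex) = of_rat r"
      by (simp add: of_rat_minus)
    then have "r = - 1"
      unfolding of_rat_eq_iff by simp
    with that show False by simp
  qed
  then show "l \<noteq> 0 \<Longrightarrow> nonresonant l (- l)"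
    by (auto simp: nonresonant_def)
qed

text \<open>If \<open>l1 / (l2 - l1)\<close> were a positive rational \<open>r\<close>, then
  \<open>l1 / l2\<close> would be the positive rational \<open>r / (1 + r)\<close>. If
  \<open>l1 = 0\<close> the pair does not change, and if \<open>l2 = 0\<close> it becomes
  \<open>l1\<close>, \<open>- l1\<close> with ratio -1.\<close>

lemma nonresonant_diff:
  assumes "nonresonant l1 l2"
  shows "nonresonant l1 (l2 - l1)"
proof (cases "l1 * l2 = 0")
  case True
  then show ?thesis
    using assms nonresonant_uminus[of l1] by (auto simp: nonresonant_def)
next
  case False
  have ne: "l2 - l1 \<noteq> 0"
    using assms not_nonresonant_refl by auto
  have "\<exists>s::rat. s > 0 \<and> l1 / l2 = of_rat s" if r: "r > 0" "l1 / (l2 - l1) = of_rat r" for r :: rat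
  proof (intro exI conjI)
    have "l1 = of_rat r * (l2 - l1)"
      using r ne by (simp add: field_simps)
    then have "l1 * (1 + of_rat r) = of_rat r * l2"
      by (simp add: algebra_simps)
    moreover have "(1 + of_rat r :: complex) = of_rat (1 + r)"
      by (simp add: of_rat_add)
    moreover have "of_rat (1 + r) \<noteq> (0 :: complex)"
      using r by simp
    ultimately have "l1 / l2 = of_rat r / of_rat (1 + r)"
      using False by (simp add: field_simps)
    then show "l1 / l2 = of_rat (r / (1 + r))"
      by (simp add: of_rat_divide)
  qed (use r in simp)
  then show ?thesis
    using assms False ne by (auto simp: nonresonant_def)
qed

section \<open>Linear parts and simple singularities\<close>

lemma det_carrier_mat_2:
  fixes A :: "'a::comm_ring_1 mat"
  assumes A: "A \<in> carrier_mat 2 2"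
  shows "det A = A $$ (0,0) * A $$ (1,1) - A $$ (0,1) * A $$ (1,0)"
proof -
  have *: "mat_delete A 0 j \<in> carrier_mat 1 1" for j
    using A by (intro carrier_matI) auto
  have d: "det (mat_delete A 0 0) = A $$ (1, 1)" "det (mat_delete A 0 1) = A $$ (1, 0)"
    using A unfolding det_single[OF *] by (simp_all add: mat_delete_def)
  have "det A = (\<Sum>j<2. A $$ (0, j) * cofactor A 0 j)"
    using A by (rule laplace_expansion_row) simp
  then show ?thesis
    using d by (simp add: numeral_2_eq_2 cofactor_def)
qed

lemma char_poly_2:
  "char_poly (mat_of_rows_list 2 [[a, b], [c, d]]) = [:a * d - b * c, - (a + d), 1:]"
  for a b c d :: complex
proof -
  let ?A = "mat_of_rows_list 2 [[a, b], [c, d]]"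
  have A: "?A \<in> carrier_mat 2 2"
    by (intro carrier_matI) (simp_all add: mat_of_rows_list_def)
  have dim: "char_poly_matrix ?A \<in> carrier_mat 2 2"
    by (rule char_poly_matrix_closed[OF A])
  have "char_poly ?A = det (char_poly_matrix ?A)"
    by (simp add: char_poly_def)
  also have "\<dots> = char_poly_matrix ?A $$ (0,0) * char_poly_matrix ?A $$ (1,1) -
      char_poly_matrix ?A $$ (0,1) * char_poly_matrix ?A $$ (1,0)"
    by (rule det_carrier_mat_2[OF dim])
  also have "\<dots> = [:a * d - b * c, - (a + d), 1:]"
    by (simp add: char_poly_matrix_def mat_of_rows_list_def)
  finally show ?thesis .
qed

text \<open>The two equations prescribe trace and determinant of \<open>linear_part\<close>, whose
  rows are the gradients of \<open>Q\<close> and of \<open>- P\<close> at the origin. This replaces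
  matrices by values of first derivatives, which can be followed through a blowup.\<close>

definition lin_simple :: "form \<Rightarrow> bool" where
  "lin_simple = (\<lambda>(P, Q). \<exists>l1 l2. nonresonant l1 l2 \<and>
     l1 + l2 = at_origin (D1 Q) - at_origin (D2 P) \<and>
     l1 * l2 = at_origin (D2 Q) * at_origin (D1 P) - at_origin (D1 Q) * at_origin (D2 P))"

lemma at_origin_hom_part_1: "at_origin (D1 (hom_part 1 P)) = at_origin (D1 P)"
  "at_origin (D2 (hom_part 1 P)) = at_origin (D2 P)"
proof -
  have "at_origin (hom_part 0 P) = at_origin P" for P
    by (simp add: at_origin_def coeff_hom_part)
  then show "at_origin (D1 (hom_part 1 P)) = at_origin (D1 P)"
    "at_origin (D2 (hom_part 1 P)) = at_origin (D2 P)"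
    using hom_part_D1[of 0 P] hom_part_D2[of 0 P] by (metis One_nat_def)+
qed

lemma hom_part_1: "hom_part 1 P = const2 (at_origin (D1 P)) * var1 + const2 (at_origin (D2 P)) * var2"
proof -
  have "at_origin (D1 P) = coeff (coeff P 0) 1" "at_origin (D2 P) = coeff (coeff P 1) 0"
    by (simp_all add: at_origin_def D1_def D2_def coeff_map_poly coeff_pderiv)
  then show ?thesis
    by (intro bipoly_eqI) (auto simp: coeff_hom_part coeff_pCons split: nat.split)
qed

lemma mult_form_eq_0_iff:
  assumes "(P, Q) \<noteq> (0, 0)"
  shows "mult_form (P, Q) = 0 \<longleftrightarrow> at_origin P \<noteq> 0 \<or> at_origin Q \<noteq> 0"
proof
  show "mult_form (P, Q) = 0 \<Longrightarrow> at_origin P \<noteq> 0 \<or> at_origin Q \<noteq> 0"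
    using mult_form_nonzero[OF assms] by (auto simp: at_origin_hom_part_0)
  show "at_origin P \<noteq> 0 \<or> at_origin Q \<noteq> 0 \<Longrightarrow> mult_form (P, Q) = 0"
    by (rule mult_form_eqI) (auto simp: at_origin_hom_part_0)
qed

text \<open>Nonresonance excludes that both eigenvalues vanish, hence forces a nonzero linear part;
  vanishing of \<open>P\<close> and \<open>Q\<close> at the origin then already gives multiplicity
  one.\<close>

lemma simple_sing_iff:
  "simple_sing (P, Q) \<longleftrightarrow> at_origin P = 0 \<and> at_origin Q = 0 \<and> lin_simple (P, Q)"
proof -
  have 1: "linear_part (P, Q) = mat_of_rows_list 2 [[at_origin (D1 Q), at_origin (D2 Q)], [- at_origin (D1 P), - at_origin (D2 P)]]"
    if "mult_form (P, Q) = 1"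
    by (simp add: linear_part_def first_jet_def that at_origin_subst2 at_origin_hom_part_1[simplified] Let_def)
  have 2: "(\<exists>l1 l2. char_poly (linear_part (P, Q)) = [:- l1, 1:] * [:- l2, 1:] \<and>
        (l1 * l2 \<noteq> 0 \<and> \<not> (\<exists>r::rat. r > 0 \<and> l1 / l2 = of_rat r) \<or>
         l1 * l2 = 0 \<and> l1 ^ 2 + l2 ^ 2 \<noteq> 0)) \<longleftrightarrow> lin_simple (P, Q)"
    if "mult_form (P, Q) = 1"
    unfolding nonresonant_def[symmetric] 1[OF that] char_poly_2 lin_simple_def case_prod_conv
    by (intro ex_cong1) (auto simp: algebra_simps)
  have 3: "mult_form (P, Q) = 1 \<longleftrightarrow> at_origin P = 0 \<and> at_origin Q = 0" if "lin_simple (P, Q)"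
  proof
    assume m: "mult_form (P, Q) = 1"
    then show "at_origin P = 0 \<and> at_origin Q = 0"
      using mult_form_below[of 0 P Q] by (simp add: at_origin_hom_part_0)
  next
    assume z: "at_origin P = 0 \<and> at_origin Q = 0"
    have "hom_part 1 P \<noteq> 0 \<or> hom_part 1 Q \<noteq> 0"
    proof (rule ccontr)
      assume "\<not> ?thesis"
      then have "at_origin (D1 P) = 0" "at_origin (D2 P) = 0" "at_origin (D1 Q) = 0" "at_origin (D2 Q) = 0"
        using at_origin_hom_part_1[of P] at_origin_hom_part_1[of Q] by auto
      with that obtain l1 l2 where "nonresonant l1 l2" "l1 + l2 = 0" "l1 * l2 = 0"
        by (auto simp: lin_simple_def)
      then show False
        by (auto simp: nonresonant_def)
    qed
    then show "mult_form (P, Q) = 1"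
      using z by (intro mult_form_eqI) (auto simp: at_origin_hom_part_0)
  qed
  show ?thesis
    unfolding simple_sing_def using 2 3
    by (metis mult_form_below mult_form_below(2) at_origin_hom_part_0 zero_less_one)
qed

definition reduced_form :: "form \<Rightarrow> bool" where
  "reduced_form \<omega> \<longleftrightarrow> at_origin (fst \<omega>) \<noteq> 0 \<or> at_origin (snd \<omega>) \<noteq> 0 \<or> lin_simple \<omega>"

lemma ordinary_sing_iff:
  assumes "\<omega> \<noteq> (0, 0)"
  shows "ordinary_sing \<omega> \<longleftrightarrow> \<not> reduced_form \<omega>"
proof -
  obtain P Q where \<omega>: "\<omega> = (P, Q)" by force
  then show ?thesis
    using mult_form_eq_0_iff[of P Q] assms
    by (auto simp: ordinary_sing_def singular_def reduced_form_def simple_sing_iff)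
qed

text \<open>The excluded equations say that the linear part is a scalar matrix. Its trace and
  determinant have discriminant zero, so the two eigenvalues coincide, and a pair of equal numbers
  is never nonresonant.\<close>

lemma lin_simple_not_radial:
  assumes "lin_simple (P, Q)"
  shows "\<not> (at_origin (D1 P) = 0 \<and> at_origin (D2 P) + at_origin (D1 Q) = 0 \<and> at_origin (D2 Q) = 0)"
proof
  assume *: "at_origin (D1 P) = 0 \<and> at_origin (D2 P) + at_origin (D1 Q) = 0 \<and> at_origin (D2 Q) = 0"
  obtain l1 l2 where l: "nonresonant l1 l2" "l1 + l2 = at_origin (D1 Q) - at_origin (D2 P)"
     "l1 * l2 = at_origin (D2 Q) * at_origin (D1 P) - at_origin (D1 Q) * at_origin (D2 P)"
    using assms by (auto simp: lin_simple_def)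
  define g where "g = at_origin (D1 Q)"
  have "at_origin (D2 P) = - g"
    using * by (simp add: g_def eq_neg_iff_add_eq_0)
  then have "l1 + l2 = 2 * g" "l1 * l2 = g * g"
    using l * by (simp_all add: g_def)
  moreover have "(l1 - l2)\<^sup>2 = (l1 + l2)\<^sup>2 - 4 * (l1 * l2)"
    by (simp add: power2_eq_square algebra_simps)
  ultimately have "(l1 - l2)\<^sup>2 = 0"
    by (simp add: power2_eq_square)
  then show False
    using l(1) not_nonresonant_refl by auto
qed

lemma reduced_form_not_terminal_dicritical:
  assumes "reduced_form \<omega>" "\<omega> \<noteq> (0, 0)"
  shows "\<not> terminal_dicritical \<omega>"
proof
  assume t: "terminal_dicritical \<omega>"
  obtain P Q where \<omega>: "\<omega> = (P, Q)" by force
  have "singular \<omega>"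
    using t by (simp add: terminal_dicritical_def)
  then have 0: "at_origin P = 0" "at_origin Q = 0" and ls: "lin_simple (P, Q)"
    using assms mult_form_eq_0_iff[of P Q] by (auto simp: \<omega> singular_def reduced_form_def)
  then have m: "mult_form (P, Q) = 1"
    using simple_sing_iff[of P Q] by (simp add: simple_sing_def)
  have "var1 * hom_part 1 P + var2 * hom_part 1 Q = 0"
    using t by (simp add: \<omega> terminal_dicritical_def first_jet_def m)
  then have *: "coeff (coeff (var1 * hom_part 1 P + var2 * hom_part 1 Q) j) i = 0" for i j
    by simp
  have "at_origin (D1 P) = 0 \<and> at_origin (D2 P) + at_origin (D1 Q) = 0 \<and> at_origin (D2 Q) = 0"
    using *[of 0 2] *[of 1 1] *[of 2 0]
    unfolding hom_part_1 by (simp add: coeff_pCons numeral_2_eq_2)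
  then show False
    using lin_simple_not_radial[OF ls] by simp
qed

section \<open>Blowing up regular and simple points\<close>

lemma strict_transform_eqI:
  assumes "form_blowup q \<omega> = (exc_eq q ^ k * p, exc_eq q ^ k * r)"
    and "\<not> (exc_eq q dvd p \<and> exc_eq q dvd r)"
  shows "strict_transform q \<omega> = (p, r)"
  unfolding strict_transform_eq assms(1) by (rule divide_max_power_eqI) (use assms(2) in auto)

lemma blowup_order_0:
  "\<exists>T. blowup q P = const2 (at_origin P) + exc_eq q * T"
  using blowup_order[of 0 P q] by (simp add: dehom_simps hom_part_0_eq)

lemma blowup_order_1:
  assumes "at_origin P = 0"
  shows "\<exists>T. blowup q P = exc_eq q * (const2 (at_origin (D1 P)) * fst (exc_dir q) +
    const2 (at_origin (D2 P)) * snd (exc_dir q) + exc_eq q * T)"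
proof -
  have "dehom q var1 = fst (exc_dir q)" "dehom q var2 = snd (exc_dir q)"
    by (simp_all add: dehom_def)
  then have "dehom q (hom_part 1 P) = const2 (at_origin (D1 P)) * fst (exc_dir q) +
    const2 (at_origin (D2 P)) * snd (exc_dir q)"
    unfolding hom_part_1 dehom_simps by simp
  moreover have "\<exists>T. blowup q P = exc_eq q ^ 1 * (dehom q (hom_part 1 P) + exc_eq q * T)"
    using assms by (intro blowup_order) (auto simp: at_origin_hom_part_0)
  ultimately show ?thesis
    by simp
qed

text \<open>Without these rules the simplifier leaves sums and products of \<open>var1\<close>, \<open>var2\<close> and constants in
  symbolic form instead of merging them into coefficient lists.\<close>

lemmas poly_fold_simps = mult_pCons_left mult_pCons_right add_pCons diff_pCons

lemma var1_dvdD: "var1 dvd F \<Longrightarrow> subst2 const2 F 0 var2 = 0"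
  by (auto elim!: dvdE simp: const2_subst2_simps simp del: poly_fold_simps)

lemma var2_dvdD: "var2 dvd F \<Longrightarrow> subst2 const2 F var1 0 = 0"
  by (auto elim!: dvdE simp: const2_subst2_simps simp del: poly_fold_simps)

lemmas D_simps = D1_mult D2_mult D1_add D2_add

text \<open>Nothing can be cancelled after the pull-back. The only singular point on the divisor is
  the direction of the leaf through the origin, and there the eigenvalues are opposite nonzero
  numbers.\<close>

lemma reduced_form_strict_transform_nonsingular:
  assumes ns: "at_origin P \<noteq> 0 \<or> at_origin Q \<noteq> 0"
  shows "reduced_form (strict_transform q (P, Q))"
proof (cases q)
  case (Slope c)
  obtain R S where RS: "blowup q P = const2 (at_origin P) + var1 * R" "blowup q Q = const2 (at_origin Q) + var1 * S"
    using blowup_order_0[of q P] blowup_order_0[of q Q] by (auto simp: Slope simp del: poly_fold_simps)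
  define F G where "F = blowup q P + (var2 + const2 c) * blowup q Q" and "G = var1 * blowup q Q"
  have "\<not> var1 dvd F"
  proof
    assume "var1 dvd F"
    then have "const2 (at_origin P) + (var2 + const2 c) * const2 (at_origin Q) = 0"
      using var1_dvdD[of F] by (simp add: F_def RS const2_subst2_simps del: poly_fold_simps)
    then show False
      using ns by auto
  qed
  then have st: "strict_transform q (P, Q) = (F, G)"
    by (intro strict_transform_eqI[where k = 0]) (auto simp: Slope form_blowup_Slope F_def G_def)
  have F0: "at_origin F = at_origin P + c * at_origin Q"
    by (simp add: F_def del: poly_fold_simps)
  show ?thesis
  proof (cases "at_origin F = 0")
    case True
    then have "at_origin Q \<noteq> 0"
      using ns F0 by auto
    moreover have "at_origin (D2 F) = at_origin Q" "at_origin (D1 G) = at_origin Q" "at_origin (D2 G) = 0"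
      by (simp_all add: F_def G_def RS D_simps del: poly_fold_simps)
    ultimately have "lin_simple (F, G)"
      using nonresonant_uminus[of "at_origin Q"]
      unfolding lin_simple_def case_prod_conv
      by (intro exI[of _ "at_origin Q"] exI[of _ "- at_origin Q"]) simp
    then show ?thesis
      by (simp add: st reduced_form_def)
  qed (simp add: st reduced_form_def)
next
  case Vertical
  obtain R S where RS: "blowup q P = const2 (at_origin P) + var2 * R" "blowup q Q = const2 (at_origin Q) + var2 * S"
    using blowup_order_0[of q P] blowup_order_0[of q Q] by (auto simp: Vertical simp del: poly_fold_simps)
  define F G where "F = var2 * blowup q P" and "G = var1 * blowup q P + blowup q Q"
  have "\<not> var2 dvd G"
  proof
    assume "var2 dvd G"
    then have "var1 * const2 (at_origin P) + const2 (at_origin Q) = 0"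
      using var2_dvdD[of G] by (simp add: G_def RS const2_subst2_simps del: poly_fold_simps)
    then show False
      using ns by simp
  qed
  then have st: "strict_transform q (P, Q) = (F, G)"
    by (intro strict_transform_eqI[where k = 0]) (auto simp: Vertical form_blowup_Vertical F_def G_def)
  have G0: "at_origin G = at_origin Q"
    by (simp add: G_def del: poly_fold_simps)
  show ?thesis
  proof (cases "at_origin G = 0")
    case True
    then have "at_origin P \<noteq> 0"
      using ns G0 by auto
    moreover have "at_origin (D2 F) = at_origin P" "at_origin (D1 G) = at_origin P" "at_origin (D1 F) = 0"
      by (simp_all add: F_def G_def RS D_simps del: poly_fold_simps)
    ultimately have "lin_simple (F, G)"
      using nonresonant_uminus[of "at_origin P"]
      unfolding lin_simple_def case_prod_conv
      by (intro exI[of _ "at_origin P"] exI[of _ "- at_origin P"]) simp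
    then show ?thesis
      by (simp add: st reduced_form_def)
  qed (simp add: st reduced_form_def)
qed

text \<open>If the direction of an eigenvector with eigenvalue $l_1$ is blown up, then the eigenvalues $l_1$, $l_2$
  become $l_1$, $l_2 - l_1$.\<close>

lemma lin_simple_eigenvalue:
  assumes "lin_simple (P, Q)"
    and root: "l * (at_origin (D1 Q) - at_origin (D2 P) - l) =
      at_origin (D2 Q) * at_origin (D1 P) - at_origin (D1 Q) * at_origin (D2 P)"
    and "at_origin (D1 Q') - at_origin (D2 P') = at_origin (D1 Q) - at_origin (D2 P) - l"
    and "at_origin (D2 Q') * at_origin (D1 P') - at_origin (D1 Q') * at_origin (D2 P') =
      l * (at_origin (D1 Q) - at_origin (D2 P) - 2 * l)"
  shows "lin_simple (P', Q')"
proof -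
  define t where "t = at_origin (D1 Q) - at_origin (D2 P)"
  obtain l1 l2 where l: "nonresonant l1 l2" "l1 + l2 = t" "l1 * l2 = l * (t - l)"
    using assms by (auto simp: lin_simple_def t_def)
  have "(l - l1) * (l - l2) = l * l - l * (l1 + l2) + l1 * l2"
    by (simp add: algebra_simps)
  also have "\<dots> = 0"
    unfolding l by (simp add: algebra_simps)
  finally have "l = l1 \<or> l = l2"
    by simp
  then have "nonresonant l (t - l)"
    using l nonresonant_sym[OF l(1)] by (auto simp flip: l(2))
  then have "nonresonant l (t - l - l)"
    by (rule nonresonant_diff)
  then show ?thesis
    unfolding lin_simple_def case_prod_conv assms(3,4) t_def
    by (intro exI conjI) (auto simp: algebra_simps)
qed

text \<open>Because the linear part is not scalar, exactly one power of the exceptional equation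
  cancels, and the restriction to the divisor vanishes only in the directions of eigenvectors. All
  other directions give regular points.\<close>

lemma reduced_form_strict_transform_simple:
  assumes 0: "at_origin P = 0" "at_origin Q = 0" and ls: "lin_simple (P, Q)"
  shows "reduced_form (strict_transform q (P, Q))"
proof -
  define p1 p2 q1 q2 where p1: "p1 = at_origin (D1 P)" and p2: "p2 = at_origin (D2 P)"
    and q1: "q1 = at_origin (D1 Q)" and q2: "q2 = at_origin (D2 Q)"
  note p = p1 p2 q1 q2
  have nr: "\<not> (p1 = 0 \<and> p2 + q1 = 0 \<and> q2 = 0)"
    using lin_simple_not_radial[OF ls] by (simp add: p)
  show ?thesis
  proof (cases q)
    case (Slope c)
    define w where "w = var2 + const2 c"
    have w: "at_origin w = c" "D1 w = 0" "D2 w = 1" "subst2 const2 w 0 var2 = w"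
      by (simp_all add: w_def D_simps const2_subst2_simps del: poly_fold_simps)
    obtain R S where RS: "blowup q P = var1 * (const2 p1 + const2 p2 * w + var1 * R)"
        "blowup q Q = var1 * (const2 q1 + const2 q2 * w + var1 * S)"
      using blowup_order_1[OF 0(1), of q] blowup_order_1[OF 0(2), of q]
      by (auto simp: Slope p w_def simp del: poly_fold_simps)
    define F G where "F = const2 p1 + const2 p2 * w + var1 * R + w * (const2 q1 + const2 q2 * w + var1 * S)"
      and "G = var1 * (const2 q1 + const2 q2 * w + var1 * S)"
    have "\<not> var1 dvd F"
    proof
      assume "var1 dvd F"
      then have "const2 p1 + const2 p2 * w + w * (const2 q1 + const2 q2 * w) = 0"
        using var1_dvdD[of F] by (simp add: F_def w const2_subst2_simps del: poly_fold_simps)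
      then have "subst2 const2 (const2 p1 + const2 p2 * w + w * (const2 q1 + const2 q2 * w)) 0 (var2 - const2 c) = 0"
        by simp
      then have "const2 p1 + const2 p2 * var2 + var2 * (const2 q1 + const2 q2 * var2) = 0"
        by (simp add: w_def const2_subst2_simps del: poly_fold_simps)
      then show False
        using nr by (simp add: add.commute)
    qed
    moreover have "form_blowup q (P, Q) = (var1 ^ 1 * F, var1 ^ 1 * G)"
      using RS by (simp add: Slope form_blowup_Slope F_def G_def algebra_simps flip: w_def del: poly_fold_simps)
    ultimately have st: "strict_transform q (P, Q) = (F, G)"
      by (intro strict_transform_eqI[where k = 1]) (auto simp: Slope)
    have F0: "at_origin F = p1 + p2 * c + c * (q1 + q2 * c)"
      by (simp add: F_def w del: poly_fold_simps)
    show ?thesis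
    proof (cases "at_origin F = 0")
      case True
      have D: "at_origin (D2 F) = p2 + q1 + 2 * (q2 * c)" "at_origin (D1 G) = q1 + q2 * c" "at_origin (D2 G) = 0"
        by (simp_all add: F_def G_def D_simps w del: poly_fold_simps)
      have p1': "p1 = - (p2 * c + c * (q1 + q2 * c))"
        using True F0 by (simp add: eq_neg_iff_add_eq_0 algebra_simps)
      \<comment> \<open>Vanishing of \<open>F\<close> at the origin makes \<open>(1, c)\<close> an
        eigenvector of the linear part, with eigenvalue \<open>q1 + q2 * c\<close>.\<close>
      have "lin_simple (F, G)"
        by (rule lin_simple_eigenvalue[OF ls, of "q1 + q2 * c"])
           (unfold D p[symmetric], simp_all add: p1' algebra_simps)
      then show ?thesis
        by (simp add: st reduced_form_def)
    qed (simp add: st reduced_form_def)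
  next
    case Vertical
    obtain R S where RS: "blowup q P = var2 * (const2 p1 * var1 + const2 p2 + var2 * R)"
        "blowup q Q = var2 * (const2 q1 * var1 + const2 q2 + var2 * S)"
      using blowup_order_1[OF 0(1), of q] blowup_order_1[OF 0(2), of q]
      by (auto simp: Vertical p simp del: poly_fold_simps)
    define F G where "F = var2 * (const2 p1 * var1 + const2 p2 + var2 * R)"
      and "G = var1 * (const2 p1 * var1 + const2 p2 + var2 * R) + (const2 q1 * var1 + const2 q2 + var2 * S)"
    have "\<not> var2 dvd G"
    proof
      assume "var2 dvd G"
      then have "var1 * (const2 p1 * var1 + const2 p2) + (const2 q1 * var1 + const2 q2) = 0"
        using var2_dvdD[of G] by (simp add: G_def const2_subst2_simps del: poly_fold_simps)
      then show False
        using nr by (simp add: add.commute)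
    qed
    moreover have "form_blowup q (P, Q) = (var2 ^ 1 * F, var2 ^ 1 * G)"
      using RS by (simp add: Vertical form_blowup_Vertical F_def G_def algebra_simps del: poly_fold_simps)
    ultimately have st: "strict_transform q (P, Q) = (F, G)"
      by (intro strict_transform_eqI[where k = 1]) (auto simp: Vertical)
    have G0: "at_origin G = q2"
      by (simp add: G_def del: poly_fold_simps)
    show ?thesis
    proof (cases "at_origin G = 0")
      case True
      have D: "at_origin (D2 F) = p2" "at_origin (D1 G) = p2 + q1" "at_origin (D1 F) = 0"
        by (simp_all add: F_def G_def D_simps del: poly_fold_simps)
      \<comment> \<open>With \<open>q2 = 0\<close> the vector \<open>(0, 1)\<close> is an
        eigenvector, with eigenvalue \<open>- p2\<close>.\<close>
      have "lin_simple (F, G)"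
        by (rule lin_simple_eigenvalue[OF ls, of "- p2"])
           (use True G0 in \<open>unfold D p[symmetric], simp_all add: algebra_simps\<close>)
      then show ?thesis
        by (simp add: st reduced_form_def)
    qed (simp add: st reduced_form_def)
  qed
qed

lemma reduced_form_strict_transform:
  assumes "reduced_form \<omega>"
  shows "reduced_form (strict_transform q \<omega>)"
proof (cases "at_origin (fst \<omega>) \<noteq> 0 \<or> at_origin (snd \<omega>) \<noteq> 0")
  case True
  then show ?thesis
    using reduced_form_strict_transform_nonsingular[of "fst \<omega>" "snd \<omega>"] by simp
next
  case False
  then show ?thesis
    using assms reduced_form_strict_transform_simple[of "fst \<omega>" "snd \<omega>"]
    by (simp add: reduced_form_def)
qed

lemma transform_at_nonzero:
  "\<omega> \<noteq> (0, 0) \<Longrightarrow> transform_at \<omega> qs \<noteq> (0, 0)"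
proof (induction qs arbitrary: \<omega>)
  case (Cons q qs)
  have "strict_transform q \<omega> \<noteq> (0, 0)"
    using Cons.prems by (rule strict_transform_spec)
  then show ?case
    using Cons.IH by simp
qed simp

lemma transform_at_append: "transform_at \<omega> (qs @ rs) = transform_at (transform_at \<omega> qs) rs"
  by (induction qs arbitrary: \<omega>) auto

lemma reduced_form_transform_at: "reduced_form \<omega> \<Longrightarrow> reduced_form (transform_at \<omega> qs)"
proof (induction qs arbitrary: \<omega>)
  case (Cons q qs)
  then show ?case
    using reduced_form_strict_transform[of \<omega> q] by simp
qed simp

text \<open>This removes the singular configuration from the problem: from here on any list of
  exceptional points may be followed.\<close>

theorem dicritical_form_iff:
  assumes "\<omega> \<noteq> (0, 0)"
  shows "dicritical_form \<omega> \<longleftrightarrow> (\<exists>qs. terminal_dicritical (transform_at \<omega> qs))"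
proof
  assume "\<exists>qs. terminal_dicritical (transform_at \<omega> qs)"
  then obtain qs where qs: "terminal_dicritical (transform_at \<omega> qs)" ..
  have ord: "ordinary_sing (transform_at \<omega> (take k qs))" for k
  proof -
    have "transform_at \<omega> qs = transform_at (transform_at \<omega> (take k qs)) (drop k qs)"
      by (simp flip: transform_at_append)
    then show ?thesis
      using qs reduced_form_transform_at reduced_form_not_terminal_dicritical
        ordinary_sing_iff transform_at_nonzero assms by metis
  qed
  then have "qs \<in> singular_configuration \<omega>" "[] \<in> singular_configuration \<omega>"
    using ord[of 0] by (auto simp: singular_configuration_def)
  then show "dicritical_form \<omega>"
    using qs by (auto simp: dicritical_form_def)
qed (auto simp: dicritical_form_def)

section \<open>Points where the first integral is defined\<close>

lemma first_int_sym: "first_int \<omega> A B \<Longrightarrow> first_int \<omega> B A"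
proof -
  assume "first_int \<omega> A B"
  then have "- (fst \<omega> * (B * D2 A - A * D2 B)) = - (snd \<omega> * (B * D1 A - A * D1 B))"
    by (simp add: first_int_def)
  then show ?thesis
    by (simp add: first_int_def flip: mult_minus_right)
qed

text \<open>The exponent \<open>m\<close> is free. It is 0 where the first integral is defined and
  the multiplicity of the pencil at a base point.\<close>

lemma first_int_strict_transform:
  assumes "first_int \<omega> A B" and "\<omega> \<noteq> (0, 0)"
    and A: "blowup q A = exc_eq q ^ m * A'" and B: "blowup q B = exc_eq q ^ m * B'"
  shows "first_int (strict_transform q \<omega>) A' B'"
proof -
  let ?e = "exc_eq q"
  obtain k where k: "form_blowup q \<omega> = (?e ^ k * fst (strict_transform q \<omega>), ?e ^ k * snd (strict_transform q \<omega>))"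
    using strict_transform_spec[OF assms(2)] by metis
  have "fst (form_blowup q \<omega>) * (blowup q B * D2 (blowup q A) - blowup q A * D2 (blowup q B)) =
      snd (form_blowup q \<omega>) * (blowup q B * D1 (blowup q A) - blowup q A * D1 (blowup q B))"
    unfolding form_blowup_def
    by (rule pullback_wronskian[OF derivation_D1 derivation_D2 assms(1)]) (simp_all add: blowup_def)
  \<comment> \<open>The factor \<open>?e ^ k\<close> comes from the form; \<open>?e ^ m\<close> is
    squared because the Wronskian is quadratic in the pencil.\<close>
  then have "(?e ^ k * (?e ^ m)\<^sup>2) * (fst (strict_transform q \<omega>) * (B' * D2 A' - A' * D2 B')) =
      (?e ^ k * (?e ^ m)\<^sup>2) * (snd (strict_transform q \<omega>) * (B' * D1 A' - A' * D1 B'))"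
    unfolding A B k fst_conv snd_conv wronskian_scale[OF derivation_D1] wronskian_scale[OF derivation_D2]
    by (simp add: mult_ac)
  then show ?thesis
    by (simp add: first_int_def)
qed

text \<open>Comparing lowest terms in \<open>first_int\<close> shows that the first jet of \<omega>
  and the part of degree \<open>k\<close> of the Wronskian form are proportional, so the radial
  contraction vanishes for both. The Wronskian form may have order larger than \<open>k\<close>;
  then the claim is trivial.\<close>

lemma terminal_dicritical_radial:
  assumes "terminal_dicritical \<omega>" "first_int \<omega> A B" "\<omega> \<noteq> (0, 0)"
    and "\<And>l. l < k \<Longrightarrow> hom_part l (B * D1 A - A * D1 B) = 0"
    and "\<And>l. l < k \<Longrightarrow> hom_part l (B * D2 A - A * D2 B) = 0"
  shows "var1 * hom_part k (B * D1 A - A * D1 B) + var2 * hom_part k (B * D2 A - A * D2 B) = 0"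
proof -
  obtain P Q where \<omega>: "\<omega> = (P, Q)" by force
  define m where "m = mult_form (P, Q)"
  define p q where "p = hom_part m P" and "q = hom_part m Q"
  define v w where "v = hom_part k (B * D1 A - A * D1 B)" and "w = hom_part k (B * D2 A - A * D2 B)"
  have r: "var1 * p + var2 * q = 0"
    using assms(1) by (simp add: terminal_dicritical_def first_jet_def \<omega> p_def q_def m_def)
  have "hom_part (m + k) (P * (B * D2 A - A * D2 B)) = hom_part (m + k) (Q * (B * D1 A - A * D1 B))"
    using assms(2) by (simp add: first_int_def \<omega>)
  then have e: "p * w = q * v"
    unfolding p_def q_def v_def w_def
    using hom_part_mult_below(1)[of m P k "B * D2 A - A * D2 B"] hom_part_mult_below(1)[of m Q k "B * D1 A - A * D1 B"]
      mult_form_below[of _ P Q] assms(4,5) unfolding m_def by simp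
  have "p \<noteq> 0 \<or> q \<noteq> 0"
    using mult_form_nonzero[of P Q] assms(3) by (simp add: p_def q_def m_def \<omega>)
  moreover have "p * (var1 * v + var2 * w) = v * (var1 * p + var2 * q) + var2 * (p * w - q * v)"
    by (simp add: algebra_simps del: poly_fold_simps)
  moreover have "q * (var1 * v + var2 * w) = w * (var1 * p + var2 * q) - var1 * (p * w - q * v)"
    by (simp add: algebra_simps del: poly_fold_simps)
  ultimately have "var1 * v + var2 * w = 0"
    unfolding r e by auto
  then show ?thesis
    by (simp add: v_def w_def)
qed

text \<open>Nonconstancy of \<open>A / B\<close>, in a form that is symmetric and that passes
  through every injective homomorphism fixing the constants.\<close>

definition indep :: "bipoly \<Rightarrow> bipoly \<Rightarrow> bool" where
  "indep A B \<longleftrightarrow> (\<forall>c d. const2 c * A + const2 d * B = 0 \<longrightarrow> c = 0 \<and> d = 0)"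

lemma indep_sym: "indep A B \<Longrightarrow> indep B A"
  unfolding indep_def by (metis add.commute)

lemma indep_blowup:
  assumes "indep A B"
  shows "indep (blowup q A) (blowup q B)"
  unfolding indep_def
proof (intro allI impI)
  fix c d assume "const2 c * blowup q A + const2 d * blowup q B = 0"
  then have "blowup q (const2 c * A + const2 d * B) = 0"
    unfolding blowup_simps .
  then show "c = 0 \<and> d = 0"
    using assms unfolding indep_def blowup_eq_0_iff by blast
qed

text \<open>Subtracting its value at the origin turns the first integral into \<open>C / B\<close>,
  where \<open>C\<close> vanishes to some order \<open>n + 1\<close>. The Wronskian form then starts
  with the constant \<open>at_origin B\<close> times the differential of the lowest part of
  \<open>C\<close>, and by Euler its radial contraction is \<open>n + 1\<close> times that part, up
  to this constant, hence not zero.\<close>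

lemma nonbase_not_terminal_dicritical:
  assumes fi: "first_int \<omega> A B" and nz: "\<omega> \<noteq> (0, 0)" and "indep A B" and B0: "at_origin B \<noteq> 0"
  shows "\<not> terminal_dicritical \<omega>"
proof
  assume t: "terminal_dicritical \<omega>"
  define c where "c = at_origin A / at_origin B"
  define C where "C = A - const2 c * B"
  have C: "C \<noteq> 0"
  proof
    assume "C = 0"
    then have "const2 1 * A + const2 (- c) * B = 0"
      by (simp add: C_def flip: smult_add_left)
    with assms(3) show False
      unfolding indep_def by (metis zero_neq_one)
  qed
  \<comment> \<open>Adding a constant multiple of \<open>B\<close> to \<open>A\<close> does not
    change the Wronskian.\<close>
  have W: "B * D1 A - A * D1 B = B * D1 C - C * D1 B" "B * D2 A - A * D2 B = B * D2 C - C * D2 B"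
    by (simp_all add: C_def derivation.d_diff[OF derivation_D1] derivation.d_diff[OF derivation_D2]
        D1_mult D2_mult algebra_simps del: poly_fold_simps)
  have "at_origin C = 0"
    using B0 by (simp add: C_def c_def del: poly_fold_simps)
  then have "mult_form (C, C) \<noteq> 0"
    using mult_form_nonzero[of C C] C by (metis at_origin_hom_part_0 prod.inject)
  then obtain n where n: "mult_form (C, C) = Suc n"
    by (metis not0_implies_Suc)
  have Cb: "l < Suc n \<Longrightarrow> hom_part l C = 0" for l
    using mult_form_below[of l C C] n by simp
  have Cn: "hom_part (Suc n) C \<noteq> 0"
    using mult_form_nonzero[of C C] C n by simp
  note b = hom_part_0_eq[of B]
  have W1: "l < n \<Longrightarrow> hom_part l (B * D1 A - A * D1 B) = 0"
    "l < n \<Longrightarrow> hom_part l (B * D2 A - A * D2 B) = 0" for l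
    unfolding W hom_part_diff
    using hom_part_mult_below(2)[of 0 B n "D1 C"] hom_part_mult_below(2)[of 0 B n "D2 C"]
      hom_part_mult_below(2)[of "Suc n" C 0 "D1 B"] hom_part_mult_below(2)[of "Suc n" C 0 "D2 B"] Cb
    by (simp_all add: hom_part_D1 hom_part_D2)
  have W2: "hom_part n (B * D1 A - A * D1 B) = const2 (at_origin B) * D1 (hom_part (Suc n) C)"
    "hom_part n (B * D2 A - A * D2 B) = const2 (at_origin B) * D2 (hom_part (Suc n) C)"
    unfolding W hom_part_diff
    using hom_part_mult_below(1)[of 0 B n "D1 C"] hom_part_mult_below(1)[of 0 B n "D2 C"]
      hom_part_mult_below(2)[of "Suc n" C 0 "D1 B"] hom_part_mult_below(2)[of "Suc n" C 0 "D2 B"] Cb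
    by (simp_all add: hom_part_D1 hom_part_D2 b)
  have "const2 (at_origin B) * (var1 * D1 (hom_part (Suc n) C) + var2 * D2 (hom_part (Suc n) C)) = 0"
    using terminal_dicritical_radial[OF t fi nz W1, of n] unfolding W2
    by (simp add: algebra_simps del: poly_fold_simps)
  then have "const2 (at_origin B) * (of_nat (Suc n) * hom_part (Suc n) C) = 0"
    unfolding euler_hom_part .
  then have "const2 (at_origin B) = 0 \<or> of_nat (Suc n) = (0::bipoly)"
    using Cn by (metis mult_eq_0_iff)
  then show False
    using B0 by (simp del: of_nat_Suc)
qed

text \<open>A blowup does not change the values of \<open>A\<close> and \<open>B\<close> at the
  centre, so every infinitely near point is again not a base point and no factor has to be
  cancelled.\<close>

lemma nonbase_transform_at_not_terminal_dicritical:
  assumes "first_int \<omega> A B" and "\<omega> \<noteq> (0, 0)" and "indep A B"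
    and "at_origin A \<noteq> 0 \<or> at_origin B \<noteq> 0"
  shows "\<not> terminal_dicritical (transform_at \<omega> qs)"
  using assms
proof (induction qs arbitrary: \<omega> A B)
  case Nil
  then show ?case
    using nonbase_not_terminal_dicritical first_int_sym indep_sym transform_at.simps(1) by metis
next
  case (Cons q qs)
  have "strict_transform q \<omega> \<noteq> (0, 0)"
    using Cons.prems(2) by (rule strict_transform_spec)
  moreover have "first_int (strict_transform q \<omega>) (blowup q A) (blowup q B)"
    using first_int_strict_transform[OF Cons.prems(1,2), of q 0] by simp
  ultimately show ?case
    using Cons indep_blowup by simp
qed

theorem nonbase_not_dicritical:
  assumes "first_int \<omega> A B" and "\<omega> \<noteq> (0, 0)" and "indep A B"
    and "at_origin A \<noteq> 0 \<or> at_origin B \<noteq> 0"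
  shows "\<not> dicritical_form \<omega>"
  using assms nonbase_transform_at_not_terminal_dicritical dicritical_form_iff by metis

section \<open>Base points of the first integral\<close>

lemma lead_coeff_pderiv_char_0:
  fixes p :: "'a::{idom,ring_char_0} poly"
  shows "lead_coeff (pderiv p) = of_nat (degree p) * lead_coeff p"
proof (cases "degree p")
  case 0
  then have "pderiv p = 0"
    by (simp add: pderiv_eq_0_iff)
  with 0 show ?thesis by simp
next
  case (Suc n)
  then show ?thesis
    by (simp add: degree_pderiv coeff_pderiv)
qed

text \<open>The leading coefficients of \<open>Q * pderiv P\<close> and \<open>P * pderiv Q\<close>
  differ only by the factors \<open>degree P\<close> and \<open>degree Q\<close>. The lemma is
  applied after subtracting from \<open>P\<close> a multiple of \<open>Q\<close> that kills the
  coefficient of degree \<open>degree Q\<close>; the difference must then be zero.\<close>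

lemma wronskian_zero_imp_degree_eq:
  fixes P Q :: "'a::{idom,ring_char_0} poly"
  assumes "Q * pderiv P = P * pderiv Q" "P \<noteq> 0" "Q \<noteq> 0"
  shows "degree P = degree Q"
proof (cases "pderiv P = 0 \<or> pderiv Q = 0")
  case True
  then have "pderiv P = 0 \<and> pderiv Q = 0"
    using assms by auto
  then show ?thesis
    by (simp add: pderiv_eq_0_iff)
next
  case False
  have "lead_coeff (Q * pderiv P) = lead_coeff (P * pderiv Q)"
    using assms by simp
  then have "of_nat (degree P) * (lead_coeff P * lead_coeff Q) = of_nat (degree Q) * (lead_coeff P * lead_coeff Q)"
    by (simp only: lead_coeff_mult lead_coeff_pderiv_char_0 mult_ac)
  then show ?thesis
    using assms by simp
qed

text \<open>In a homogeneous polynomial of degree \<open>m\<close> the coefficient of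
  \<open>y^j\<close> is a number times \<open>x^(m - j)\<close>. Hence the multiple that cancels the
  leading coefficient in \<open>y\<close> is a number \<open>k\<close>, and the derivative with
  respect to \<open>y\<close> alone decides.\<close>

lemma hom_part_wronskian_zero:
  assumes W: "hom_part m B * D2 (hom_part m A) = hom_part m A * D2 (hom_part m B)"
    and b: "hom_part m B \<noteq> 0"
  shows "\<exists>k. hom_part m A = const2 k * hom_part m B"
proof -
  define a b where "a = hom_part m A" and "b = hom_part m B"
  define j where "j = degree b"
  have jm: "j \<le> m"
    unfolding j_def b_def by (rule degree_le) (auto intro!: poly_eqI simp: coeff_hom_part)
  define k where "k = coeff (coeff A j) (m - j) / coeff (coeff B j) (m - j)"
  define c where "c = hom_part m (A - const2 k * B)"
  have c: "c = a - const2 k * b"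
    by (simp add: c_def a_def b_def hom_part_diff hom_part_const2_mult del: poly_fold_simps)
  have "coeff b j \<noteq> 0"
    using b unfolding j_def b_def by (rule leading_coeff_neq_0)
  have "coeff (coeff b j) i = 0" if "i \<noteq> m - j" for i
    using that jm by (simp add: b_def coeff_hom_part)
  with \<open>coeff b j \<noteq> 0\<close> have "coeff (coeff b j) (m - j) \<noteq> 0"
    by (metis poly_eqI coeff_0)
  then have "coeff (coeff B j) (m - j) \<noteq> 0"
    by (simp add: b_def coeff_hom_part split: if_splits)
  then have "coeff (coeff c j) i = 0" for i
    by (cases "i = m - j") (auto simp: c_def coeff_hom_part k_def)
  then have cj: "coeff c j = 0"
    by (intro poly_eqI) simp
  have "b * D2 c = c * D2 b"
    using W unfolding c a_def[symmetric] b_def[symmetric]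
    by (simp add: derivation.d_diff[OF derivation_D2] D2_mult algebra_simps del: poly_fold_simps)
  then have "c = 0"
    using wronskian_zero_imp_degree_eq[of b c] b cj unfolding j_def b_def[symmetric] D2_def
    by (metis leading_coeff_0_iff)
  then show ?thesis
    using c by (auto simp: a_def b_def simp del: poly_fold_simps)
qed

text \<open>The lowest term of the Wronskian form is \<open>b da - a db\<close>, of degree
  \<open>2 * m - 1\<close>. It is nonzero because \<open>a\<close> and \<open>b\<close> are not
  proportional, and its radial contraction vanishes by Euler's identity. Being proportional to it,
  the first jet of \<omega> has the same property.\<close>

lemma indep_initial_terminal_dicritical:
  assumes fi: "first_int \<omega> A B" and nz: "\<omega> \<noteq> (0, 0)" and m: "m = mult_form (A, B)"
    and b: "hom_part m B \<noteq> 0" and dep: "\<nexists>k. hom_part m A = const2 k * hom_part m B"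
  shows "terminal_dicritical \<omega>"
proof -
  obtain P Q where \<omega>: "\<omega> = (P, Q)" by force
  define a b where "a = hom_part m A" and "b = hom_part m B"
  have "m \<noteq> 0"
  proof
    assume "m = 0"
    then have "hom_part m A = const2 (at_origin A / at_origin B) * hom_part m B"
      using b by (simp add: hom_part_0_eq field_simps)
    then show False
      using dep by blast
  qed
  then obtain n where n: "m = Suc n"
    by (metis not0_implies_Suc)
  have below: "l < m \<Longrightarrow> hom_part l A = 0" "l < m \<Longrightarrow> hom_part l B = 0" for l
    using mult_form_below[of l A B] m by auto
  define w1 w2 where "w1 = b * D1 a - a * D1 b" and "w2 = b * D2 a - a * D2 b"
  have w1: "hom_part (m + n) (B * D1 A - A * D1 B) = w1"
    unfolding hom_part_diff w1_def
    using hom_part_mult_below(1)[of m B n "D1 A"] hom_part_mult_below(1)[of m A n "D1 B"] below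
    by (simp add: hom_part_D1 n a_def b_def)
  have w2: "hom_part (m + n) (B * D2 A - A * D2 B) = w2"
    unfolding hom_part_diff w2_def
    using hom_part_mult_below(1)[of m B n "D2 A"] hom_part_mult_below(1)[of m A n "D2 B"] below
    by (simp add: hom_part_D2 n a_def b_def)
  have w_below: "l < m + n \<Longrightarrow> hom_part l (B * D1 A - A * D1 B) = 0"
    "l < m + n \<Longrightarrow> hom_part l (B * D2 A - A * D2 B) = 0" for l
    unfolding hom_part_diff
    using hom_part_mult_below(2)[of m B n "D1 A"] hom_part_mult_below(2)[of m A n "D1 B"]
      hom_part_mult_below(2)[of m B n "D2 A"] hom_part_mult_below(2)[of m A n "D2 B"] below
    by (simp_all add: hom_part_D1 hom_part_D2 n)
  have "var1 * w1 + var2 * w2 = b * (var1 * D1 a + var2 * D2 a) - a * (var1 * D1 b + var2 * D2 b)"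
    by (simp add: w1_def w2_def algebra_simps del: poly_fold_simps)
  also have "\<dots> = 0"
    unfolding a_def b_def euler_hom_part by simp
  finally have radial: "var1 * w1 + var2 * w2 = 0" .
  have "w2 \<noteq> 0"
    using hom_part_wronskian_zero[of m B A] b dep by (auto simp: w2_def a_def b_def simp del: poly_fold_simps)
  define r where "r = mult_form (P, Q)"
  define p q where "p = hom_part r P" and "q = hom_part r Q"
  have "hom_part (r + (m + n)) (P * (B * D2 A - A * D2 B)) = hom_part (r + (m + n)) (Q * (B * D1 A - A * D1 B))"
    using fi by (simp add: first_int_def \<omega>)
  then have e: "p * w2 = q * w1"
    using hom_part_mult_below(1)[of r P "m + n" "B * D2 A - A * D2 B"]
      hom_part_mult_below(1)[of r Q "m + n" "B * D1 A - A * D1 B"]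
      mult_form_below[of _ P Q] w_below unfolding r_def w1 w2 p_def q_def by simp
  have "(var1 * p + var2 * q) * w2 = var1 * (p * w2 - q * w1) + q * (var1 * w1 + var2 * w2)"
    by (simp add: algebra_simps del: poly_fold_simps)
  then have dic: "var1 * p + var2 * q = 0"
    using \<open>w2 \<noteq> 0\<close> unfolding e radial by (simp del: poly_fold_simps)
  have "r \<noteq> 0"
  proof
    assume "r = 0"
    then have "p = const2 (at_origin P)" "q = const2 (at_origin Q)"
      by (simp_all add: p_def q_def hom_part_0_eq)
    then have "p = 0 \<and> q = 0"
      using dic by simp
    then show False
      using mult_form_nonzero[of P Q] nz by (auto simp: p_def q_def r_def \<omega>)
  qed
  then show ?thesis
    using dic by (simp add: terminal_dicritical_def singular_def first_jet_def \<omega> p_def q_def r_def)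
qed

text \<open>The total transform of the pencil without its fixed part along the new divisor: both
  members are divided by the same power, so \<open>A / B\<close> is not changed.\<close>

definition blown :: "exc_point \<Rightarrow> bipoly \<times> bipoly \<Rightarrow> bipoly \<times> bipoly" where
  "blown q = (\<lambda>(A, B). (blowup q A div exc_eq q ^ mult_form (A, B), blowup q B div exc_eq q ^ mult_form (A, B)))"

lemma blown_spec:
  assumes "blown q (A, B) = (A', B')" and "m = mult_form (A, B)"
  shows "blowup q A = exc_eq q ^ m * A'" "blowup q B = exc_eq q ^ m * B'"
    "at_origin A' = at_origin (dehom q (hom_part m A))" "at_origin B' = at_origin (dehom q (hom_part m B))"
proof -
  obtain R where R: "blowup q A = exc_eq q ^ m * (dehom q (hom_part m A) + exc_eq q * R)"
    using blowup_order[of m A q] mult_form_below[of _ A B] assms(2) by blast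
  obtain S where S: "blowup q B = exc_eq q ^ m * (dehom q (hom_part m B) + exc_eq q * S)"
    using blowup_order[of m B q] mult_form_below[of _ A B] assms(2) by blast
  have "A' = dehom q (hom_part m A) + exc_eq q * R" "B' = dehom q (hom_part m B) + exc_eq q * S"
    using assms R S by (auto simp: blown_def)
  then show "blowup q A = exc_eq q ^ m * A'" "blowup q B = exc_eq q ^ m * B'"
    "at_origin A' = at_origin (dehom q (hom_part m A))" "at_origin B' = at_origin (dehom q (hom_part m B))"
    using R S by simp_all
qed

definition base_pt :: "bipoly \<times> bipoly \<Rightarrow> bool" where
  "base_pt = (\<lambda>(A, B). at_origin A = 0 \<and> at_origin B = 0)"

text \<open>The constants \<open>k\<close> such that \<open>A / B\<close> equals \<open>k\<close> on the exceptional divisor created by blowing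
  up a base point of the \<open>n\<close>-th infinitesimal neighbourhood.\<close>

fun exc_values :: "nat \<Rightarrow> bipoly \<times> bipoly \<Rightarrow> complex set" where
  "exc_values 0 AB = {k. hom_part (mult_form AB) (fst AB) = const2 k * hom_part (mult_form AB) (snd AB) \<and>
     hom_part (mult_form AB) (snd AB) \<noteq> 0}"
| "exc_values (Suc n) AB = (\<Union>q\<in>{q. base_pt (blown q AB)}. exc_values n (blown q AB))"

lemma at_origin_dehom_Slope:
  "at_origin (dehom (Slope c) (hom_part m A)) =
     poly (\<Sum>i\<le>m. monom (coeff (coeff A (m - i)) i) (m - i)) c"
proof -
  have "at_origin (dehom (Slope c) (hom_part m A)) =
      subst2 (\<lambda>c. at_origin (const2 c)) (hom_part m A) (at_origin 1) (at_origin (var2 + const2 c))"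
    unfolding dehom_def exc_dir.simps fst_conv snd_conv
    by (rule subst2_comp[OF complex_hom_const2]) (unfold_locales, auto)
  also have "\<dots> = subst2 (\<lambda>c. c) (hom_part m A) 1 c"
    by (simp del: poly_fold_simps)
  also have "\<dots> = poly (\<Sum>i\<le>m. monom (coeff (coeff A (m - i)) i) (m - i)) c"
    unfolding complex_hom.subst2_hom_part[OF complex_hom_ident] by (simp add: poly_sum poly_monom)
  finally show ?thesis .
qed

lemma finite_zeros_dehom_Slope:
  assumes "hom_part m A \<noteq> 0"
  shows "finite {c. at_origin (dehom (Slope c) (hom_part m A)) = 0}"
proof -
  let ?h = "\<Sum>i\<le>m. monom (coeff (coeff A (m - i)) i) (m - i)"
  have c: "coeff ?h j = coeff (coeff A j) (m - j)" if "j \<le> m" for j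
  proof -
    have "coeff ?h j = (\<Sum>i\<le>m. if i = m - j then coeff (coeff A j) (m - j) else 0)"
      unfolding coeff_sum by (rule sum.cong) (use that in \<open>auto simp: coeff_monom\<close>)
    then show ?thesis
      by (simp add: sum.delta)
  qed
  have "?h \<noteq> 0"
  proof
    assume "?h = 0"
    then have *: "coeff (coeff A j) (m - j) = 0" if "j \<le> m" for j
      using c[OF that] by simp
    have "hom_part m A = 0"
    proof (rule bipoly_eqI)
      show "coeff (coeff (hom_part m A) j) i = coeff (coeff 0 j) i" for i j
        using *[of j] by (auto simp: coeff_hom_part)
    qed
    with assms show False ..
  qed
  then show ?thesis
    unfolding at_origin_dehom_Slope by (rule poly_roots_finite)
qed

text \<open>The slopes of base points on the divisor are zeros of a nonzero polynomial in one
  variable, and \<open>Vertical\<close> adds at most one more point.\<close>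

lemma finite_base_pts:
  assumes "AB \<noteq> (0, 0)"
  shows "finite {q. base_pt (blown q AB)}"
proof -
  obtain A B where AB: "AB = (A, B)" by force
  define m where "m = mult_form (A, B)"
  define Z where "Z = {c. at_origin (dehom (Slope c) (hom_part m A)) = 0 \<and> at_origin (dehom (Slope c) (hom_part m B)) = 0}"
  have "hom_part m A \<noteq> 0 \<or> hom_part m B \<noteq> 0"
    using mult_form_nonzero assms unfolding AB m_def by blast
  then have "finite Z"
    using finite_zeros_dehom_Slope[of m A] finite_zeros_dehom_Slope[of m B]
    by (auto simp: Z_def elim: rev_finite_subset)
  moreover have "{q. base_pt (blown q AB)} \<subseteq> insert Vertical (Slope ` Z)"
  proof
    fix q assume "q \<in> {q. base_pt (blown q AB)}"
    then have "at_origin (dehom q (hom_part m A)) = 0 \<and> at_origin (dehom q (hom_part m B)) = 0"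
      using blown_spec(3,4)[of q A B "fst (blown q AB)" "snd (blown q AB)" m]
      by (simp add: AB m_def base_pt_def split: prod.splits)
    then show "q \<in> insert Vertical (Slope ` Z)"
      by (cases q) (auto simp: Z_def)
  qed
  ultimately show ?thesis
    by (metis finite_subset finite_insert finite_imageI)
qed

lemma blown_nonzero:
  assumes "AB \<noteq> (0, 0)"
  shows "blown q AB \<noteq> (0, 0)"
proof
  obtain A B where AB: "AB = (A, B)" by force
  assume "blown q AB = (0, 0)"
  then have "blowup q A = 0" "blowup q B = 0"
    using blown_spec(1,2)[of q A B 0 0] unfolding AB by simp_all
  with assms AB show False by simp
qed

text \<open>Each divisor contributes at most one value, and each base point has finitely many base
  points on its divisor.\<close>

lemma countable_exc_values: "AB \<noteq> (0, 0) \<Longrightarrow> countable (exc_values n AB)"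
proof (induction n arbitrary: AB)
  case 0
  have "exc_values 0 AB \<subseteq> {k}" if "k \<in> exc_values 0 AB" for k
  proof
    fix l assume "l \<in> exc_values 0 AB"
    with that have "const2 l * hom_part (mult_form AB) (snd AB) = const2 k * hom_part (mult_form AB) (snd AB)"
      "hom_part (mult_form AB) (snd AB) \<noteq> 0"
      by (auto simp del: poly_fold_simps)
    then show "l \<in> {k}"
      by (metis mult_cancel_right pCons_eq_iff singletonI)
  qed
  then show ?case
    by (metis countable_empty countable_insert countable_subset ex_in_conv)
next
  case (Suc n)
  show ?case
    unfolding exc_values.simps
    by (intro countable_UN countable_finite finite_base_pts Suc blown_nonzero)
qed

lemma exists_not_exc_value:
  assumes "AB \<noteq> (0, 0)"
  shows "\<exists>c. \<forall>n. c \<notin> exc_values n AB"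
proof -
  have "countable (\<Union>n. exc_values n AB)"
    using countable_exc_values[OF assms] by blast
  \<comment> \<open>Passing to real parts reduces the claim to the uncountability of the
    reals.\<close>
  then have "countable (Re ` (\<Union>n. exc_values n AB))"
    by blast
  then have "Re ` (\<Union>n. exc_values n AB) \<noteq> UNIV"
    using uncountable_UNIV_real by metis
  then obtain r where "r \<notin> Re ` (\<Union>n. exc_values n AB)"
    by blast
  then show ?thesis
    by (intro exI[of _ "complex_of_real r"]) force
qed

section \<open>Arcs and their lifts to a blowup\<close>

abbreviation along :: "bipoly \<Rightarrow> complex fps \<Rightarrow> complex fps \<Rightarrow> complex fps" where
  "along \<equiv> subst2 fps_const"

lemma along_nth_0:
  assumes "fps_nth x 0 = 0" "fps_nth y 0 = 0"
  shows "fps_nth (along P x y) 0 = at_origin P"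
proof -
  have "fps_nth (along P x y) 0 = subst2 (\<lambda>c. fps_nth (fps_const c) 0) P (fps_nth x 0) (fps_nth y 0)"
    by (rule subst2_comp[OF complex_hom_fps_const, of "\<lambda>f. fps_nth f 0"]) (unfold_locales, auto)
  then show ?thesis
    by (simp add: assms at_origin_subst2)
qed

text \<open>Of two power series one divides the other, and the quotient is the new coordinate. If
  \<open>x\<close> divides \<open>y\<close>, the constant term of the quotient is the slope at which
  the lifted arc meets the divisor; otherwise \<open>y\<close> divides \<open>x\<close> with a
  quotient without constant term, and the arc passes through \<open>Vertical\<close>.\<close>

lemma arc_lift:
  assumes "fps_nth x 0 = 0" "fps_nth y 0 = 0" "x \<noteq> 0 \<or> y \<noteq> 0"
  obtains q x' y' where "fps_nth x' 0 = 0" "fps_nth y' 0 = 0" "x' \<noteq> 0 \<or> y' \<noteq> 0"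
    "\<And>P. along (blowup q P) x' y' = along P x y"
    "along (exc_eq q) x' y' \<noteq> 0" "fps_nth (along (exc_eq q) x' y') 0 = 0"
proof (cases "x dvd y \<and> x \<noteq> 0")
  case True
  then obtain z where z: "y = x * z"
    by auto
  show ?thesis
  proof (rule that[of x "z - fps_const (fps_nth z 0)" "Slope (fps_nth z 0)"])
    show "along (blowup (Slope (fps_nth z 0)) P) x (z - fps_const (fps_nth z 0)) = along P x y" for P
      unfolding blowup_def
      by (simp add: subst2_subst2[OF complex_hom_fps_const] fps_subst2_simps z del: poly_fold_simps)
  qed (use True assms in auto)
next
  case False
  then have "y \<noteq> 0"
    using assms by auto
  have "\<exists>z. x = y * z \<and> fps_nth z 0 = 0"
  proof (cases "x = 0")
    case False
    then have "subdegree y < subdegree x"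
      using \<open>\<not> (x dvd y \<and> x \<noteq> 0)\<close> \<open>y \<noteq> 0\<close> by (simp add: fps_dvd_iff)
    then obtain z where z: "x = y * z"
      using \<open>y \<noteq> 0\<close> False by (metis fps_dvd_iff dvdE less_imp_le)
    moreover have "subdegree z \<noteq> 0"
      using z False \<open>subdegree y < subdegree x\<close> \<open>y \<noteq> 0\<close> by auto
    ultimately show ?thesis
      by (auto simp: subdegree_eq_0_iff)
  qed auto
  then obtain z where z: "x = y * z" "fps_nth z 0 = 0"
    by blast
  show ?thesis
  proof (rule that[of z y Vertical])
    show "along (blowup Vertical P) z y = along P x y" for P
      unfolding blowup_def
      by (simp add: subst2_subst2[OF complex_hom_fps_const] fps_subst2_simps z del: poly_fold_simps)
  qed (use \<open>y \<noteq> 0\<close> z assms in auto)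
qed

text \<open>On an arc along which \<open>A / B\<close> is constantly \<open>c\<close>, the strict transform of the arc stays in base points
  as long as the first integral is constant on the exceptional divisors, because that constant differs from
  \<open>c\<close>. Each blowup lowers the order of \<open>B\<close> along the arc, so the process stops.\<close>

lemma base_point_reaches_terminal_dicritical:
  assumes "first_int \<omega> A B" "\<omega> \<noteq> (0, 0)" "(A, B) \<noteq> (0, 0)" "base_pt (A, B)"
    and "\<And>n. c \<notin> exc_values n (A, B)"
    and "fps_nth x 0 = 0" "fps_nth y 0 = 0" "x \<noteq> 0 \<or> y \<noteq> 0"
    and "along A x y = fps_const c * along B x y" "along B x y \<noteq> 0"
  shows "\<exists>qs. terminal_dicritical (transform_at \<omega> qs)"
  using assms
proof (induction "subdegree (along B x y)" arbitrary: \<omega> A B x y rule: less_induct)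
  case less
  define m where "m = mult_form (A, B)"
  show ?case
  proof (cases "hom_part m B \<noteq> 0 \<and> (\<nexists>k. hom_part m A = const2 k * hom_part m B)")
    case True
    then have "terminal_dicritical \<omega>"
      using indep_initial_terminal_dicritical less.prems m_def by blast
    then show ?thesis
      by (intro exI[of _ "[]"]) simp
  next
    case False
    obtain q x' y' where xy: "fps_nth x' 0 = 0" "fps_nth y' 0 = 0" "x' \<noteq> 0 \<or> y' \<noteq> 0"
      and lift: "\<And>P. along (blowup q P) x' y' = along P x y"
      and e: "along (exc_eq q) x' y' \<noteq> 0" "fps_nth (along (exc_eq q) x' y') 0 = 0"
      using arc_lift[OF less.prems(6-8)] by metis
    define E where "E = along (exc_eq q) x' y'"
    obtain A' B' where AB': "blown q (A, B) = (A', B')" by force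
    note spec = blown_spec[OF AB' m_def]
    have ev: "along A x y = E ^ m * along A' x' y'" "along B x y = E ^ m * along B' x' y'"
      unfolding lift[symmetric] spec(1,2) by (simp_all add: fps_subst2_simps E_def)
    have E: "E \<noteq> 0" "subdegree E \<noteq> 0"
      using e by (auto simp: E_def subdegree_eq_0_iff)
    have "E ^ m * along A' x' y' = E ^ m * (fps_const c * along B' x' y')"
      using less.prems(9) unfolding ev by (simp add: mult_ac)
    then have A'c: "along A' x' y' = fps_const c * along B' x' y'"
      using E by simp
    have B'nz: "along B' x' y' \<noteq> 0"
      using less.prems(10) ev by auto
    have "m \<noteq> 0"
    proof
      assume "m = 0"
      then show False
        using mult_form_nonzero[OF less.prems(3)] less.prems(4)
        by (auto simp: base_pt_def at_origin_hom_part_0 m_def)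
    qed
    \<comment> \<open>The two orders differ by \<open>m * subdegree E\<close>, and \<open>m\<close>
      is positive at a base point.\<close>
    then have "subdegree (along B' x' y') < subdegree (along B x y)"
      using E B'nz by (simp add: ev)
    moreover have "first_int (strict_transform q \<omega>) A' B'"
      by (rule first_int_strict_transform[OF less.prems(1,2) spec(1,2)])
    moreover have "strict_transform q \<omega> \<noteq> (0, 0)"
      using less.prems(2) by (rule strict_transform_spec)
    moreover have "(A', B') \<noteq> (0, 0)"
      using blown_nonzero[OF less.prems(3), of q] AB' by simp
    moreover have base': "base_pt (A', B')"
    proof -
      have 1: "at_origin A' = c * at_origin B'"
        using arg_cong[OF A'c, of "\<lambda>f. fps_nth f 0"] along_nth_0[OF xy(1,2)] by simp
      \<comment> \<open>Either the lowest part of \<open>B\<close> vanishes, and then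
        \<open>B'\<close> is zero on the whole divisor; or \<open>A / B\<close> equals a number
        \<open>k\<close> on the divisor, and \<open>k\<close> and \<open>c\<close> are both ratios
        of \<open>A'\<close> to \<open>B'\<close> at the point, which is possible for
        \<open>k \<noteq> c\<close> only if both vanish.\<close>
      have "at_origin B' = 0"
      proof (cases "hom_part m B = 0")
        case True
        then show ?thesis
          using spec(4) by (simp add: dehom_simps)
      next
        case b: False
        then obtain k where k: "hom_part m A = const2 k * hom_part m B"
          using False by blast
        then have "k \<in> exc_values 0 (A, B)"
          using b by (simp add: m_def)
        then have "k \<noteq> c"
          using less.prems(5) by blast
        moreover have "at_origin A' = k * at_origin B'"
          unfolding spec(3,4) k by (simp add: dehom_simps del: poly_fold_simps)
        ultimately show ?thesis
          using 1 by simp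
      qed
      then show ?thesis
        using 1 by (simp add: base_pt_def)
    qed
    moreover have "c \<notin> exc_values n (A', B')" for n
      using less.prems(5)[of "Suc n"] AB' base'
      by (metis UN_I exc_values.simps(2) mem_Collect_eq)
    ultimately obtain qs where "terminal_dicritical (transform_at (strict_transform q \<omega>) qs)"
      using less.hyps[of B' x' y' "strict_transform q \<omega>" A'] xy A'c B'nz by blast
    then show ?thesis
      by (intro exI[of _ "q # qs"]) simp
  qed
qed

section \<open>Arcs on plane curves\<close>

lemma poly_taylor_2:
  fixes p :: "'a::idom poly"
  shows "\<exists>u. poly p (s + h) = poly p s + h * poly (pderiv p) s + h\<^sup>2 * u"
proof (induction p)
  case (pCons a p)
  from pCons(2) obtain u where "poly p (s + h) = poly p s + h * poly (pderiv p) s + h\<^sup>2 * u" ..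
  then show ?case
    by (intro exI[of _ "poly (pderiv p) s + s * u + h * u"])
       (simp add: pderiv_pCons algebra_simps power2_eq_square)
qed simp

lemma poly_fps_nth_0: "fps_nth s 0 = 0 \<Longrightarrow> fps_nth (poly p s) 0 = fps_nth (coeff p 0) 0"
  by (cases p) simp

lemma fps_X_power_dvd_iff_nth:
  fixes f :: "'a::comm_ring_1 fps"
  shows "fps_X ^ n dvd f \<longleftrightarrow> (\<forall>k<n. fps_nth f k = 0)"
proof
  assume "\<forall>k<n. fps_nth f k = 0"
  then have "f = fps_X ^ n * fps_shift n f"
    by (intro fps_ext) (simp add: fps_X_power_mult_nth)
  then show "fps_X ^ n dvd f"
    by (metis dvd_triv_left)
qed (auto simp: fps_X_power_mult_nth elim!: dvdE)

text \<open>Newton's iteration with the derivative frozen at its constant term \<open>a\<close>. The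
  error still gains a power of the variable in each step, and only a number has to be
  inverted.\<close>

lemma fps_poly_simple_root:
  fixes G :: "complex fps poly"
  assumes G0: "fps_nth (coeff G 0) 0 = 0" and G1: "fps_nth (coeff G 1) 0 \<noteq> 0"
  shows "\<exists>s. fps_nth s 0 = 0 \<and> poly G s = 0"
proof -
  define a where "a = fps_nth (coeff G 1) 0"
  define S where "S = rec_nat 0 (\<lambda>_ s. s - fps_const (1 / a) * poly G s)"
  have S_Suc: "S (Suc n) = S n - fps_const (1 / a) * poly G (S n)" for n
    by (simp add: S_def)
  have step: "fps_nth (S n) 0 = 0 \<and> fps_X ^ Suc n dvd poly G (S n)" for n
  proof (induction n)
    case 0
    have "S 0 = 0"
      by (simp add: S_def)
    then show ?case
      using G0 by (simp add: fps_X_power_dvd_iff_nth[of 1, simplified] poly_0_coeff_0)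
  next
    case (Suc n)
    define g where "g = poly G (S n)"
    define h where "h = - (fps_const (1 / a) * g)"
    obtain v where v: "g = fps_X ^ Suc n * v"
      using Suc by (auto simp: g_def)
    have "fps_nth (poly (pderiv G) (S n)) 0 = a"
      using Suc by (simp add: poly_fps_nth_0 coeff_pderiv a_def)
    then have "fps_X dvd poly (pderiv G) (S n) - fps_const a"
      by (simp add: fps_X_power_dvd_iff_nth[of 1, simplified])
    then obtain t where t: "poly (pderiv G) (S n) = fps_const a + fps_X * t"
      by (metis add.commute diff_add_cancel dvdE)
    obtain u where "poly G (S n + h) = g + h * poly (pderiv G) (S n) + h\<^sup>2 * u"
      using poly_taylor_2[of G "S n" h] g_def by blast
    moreover have "S (Suc n) = S n + h"
      by (simp add: S_Suc h_def g_def)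
    moreover have "fps_const (1 / a) * fps_const a = 1"
      using G1 by (simp add: a_def)
    then have "h * fps_const a = - g"
      unfolding h_def by (metis minus_mult_left mult.assoc mult.commute mult.right_neutral)
    ultimately have "poly G (S (Suc n)) = h * fps_X * t + h\<^sup>2 * u"
      by (simp add: t algebra_simps)
    also have "\<dots> = fps_X ^ Suc (Suc n) *
        (- (fps_const (1 / a) * v * t) + fps_const (1 / a) * v * fps_X ^ n * fps_const (1 / a) * v * u)"
      by (simp add: h_def v algebra_simps power2_eq_square)
    finally have "fps_X ^ Suc (Suc n) dvd poly G (S (Suc n))"
      by simp
    moreover have "fps_nth (S (Suc n)) 0 = 0"
      using Suc unfolding S_Suc by (simp add: g_def[symmetric] v)
    ultimately show ?case by simp
  qed
  \<comment> \<open>After step \<open>n\<close> the corrections are divisible by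
    \<open>fps_X ^ Suc n\<close>, so the coefficients up to \<open>n\<close> are final and the
    diagonal sequence below is the limit.\<close>
  have stable: "fps_nth (S (n + k)) i = fps_nth (S n) i" if "i \<le> n" for n k i
  proof (induction k)
    case (Suc k)
    have "fps_nth (poly G (S (n + k))) i = 0"
      using step[of "n + k"] that by (simp add: fps_X_power_dvd_iff_nth del: power_Suc)
    then show ?case
      using Suc by (simp add: S_Suc)
  qed simp
  define L where "L = Abs_fps (\<lambda>n. fps_nth (S n) n)"
  have "poly G L = 0"
  proof (rule fps_ext)
    fix n
    have "fps_nth L i = fps_nth (S n) i" if "i \<le> n" for i
      using stable[of i i "n - i"] that by (simp add: L_def)
    then have d: "fps_X ^ Suc n dvd L - S n"
      unfolding fps_X_power_dvd_iff_nth by simp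
    obtain u where "poly G (S n + (L - S n)) =
        poly G (S n) + (L - S n) * poly (pderiv G) (S n) + (L - S n)\<^sup>2 * u"
      using poly_taylor_2[of G "S n" "L - S n"] by blast
    then have "poly G L = poly G (S n) + (L - S n) * (poly (pderiv G) (S n) + (L - S n) * u)"
      by (simp add: algebra_simps power2_eq_square)
    then have "fps_X ^ Suc n dvd poly G L"
      using d step[of n] by (metis dvd_add dvd_mult2)
    then show "fps_nth (poly G L) n = fps_nth 0 n"
      by (simp add: fps_X_power_dvd_iff_nth del: power_Suc)
  qed
  moreover have "fps_nth L 0 = 0"
    by (simp add: L_def S_def)
  ultimately show ?thesis by blast
qed

section \<open>Newton polygons and Puiseux series\<close>

lemma higher_pderiv_pcompose_shift:
  "(pderiv ^^ k) (pcompose p [:s, 1:]) = pcompose ((pderiv ^^ k) p) [:s, 1 :: 'a :: idom:]"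
  by (induction k) (simp_all add: pderiv_pcompose pderiv_pCons)

text \<open>By this Taylor formula a root of a derivative of order \<open>k\<close> becomes a
  vanishing coefficient of degree \<open>k\<close> after translation.\<close>

lemma poly_higher_pderiv:
  "poly ((pderiv ^^ k) p) s = fact k * coeff (pcompose p [:s, 1:]) k"
  for p :: "'a :: {idom, semiring_char_0} poly"
proof -
  have "poly ((pderiv ^^ k) p) s = coeff ((pderiv ^^ k) (pcompose p [:s, 1:])) 0"
    by (simp add: higher_pderiv_pcompose_shift)
  also have "\<dots> = fact k * coeff (pcompose p [:s, 1:]) k"
    by (simp add: coeff_higher_pderiv pochhammer_fact)
  finally show ?thesis .
qed

lemma comm_ring_hom_fps_nth_0: "comm_ring_hom (\<lambda>f :: complex fps. fps_nth f 0)"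
  by unfold_locales auto

lemma comm_ring_hom_fps_compose:
  "fps_nth b 0 = 0 \<Longrightarrow> comm_ring_hom (\<lambda>f :: complex fps. f oo b)"
  by unfold_locales (auto simp: fps_compose_add_distrib fps_compose_mult_distrib)

abbreviation reduction :: "complex fps poly \<Rightarrow> complex poly" where
  "reduction \<equiv> map_poly (\<lambda>f. fps_nth f 0)"

lemma reduction_pcompose_shift:
  "reduction (pcompose G [:s, 1:]) = pcompose (reduction G) [:fps_nth s 0, 1:]"
proof -
  interpret comm_ring_hom "\<lambda>f :: complex fps. fps_nth f 0"
    by (rule comm_ring_hom_fps_nth_0)
  show ?thesis
    by (simp add: map_poly_pcompose map_poly_pCons)
qed

text \<open>The parameter is replaced by its \<open>e\<close>-th power, which has the effect of
  adjoining an \<open>e\<close>-th root of it.\<close>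

definition ramify :: "nat \<Rightarrow> complex fps poly \<Rightarrow> complex fps poly" where
  "ramify e = map_poly (\<lambda>c. c oo fps_X ^ e)"

lemma coeff_ramify: "coeff (ramify e G) i = coeff G i oo fps_X ^ e"
  by (simp add: ramify_def coeff_map_poly)

lemma ramify_ramify:
  assumes "e \<noteq> 0" "e' \<noteq> 0"
  shows "ramify e' (ramify e G) = ramify (e * e') G"
proof (rule poly_eqI)
  fix i
  have "fps_X ^ e oo fps_X ^ e' = (fps_X ^ (e * e') :: complex fps)"
    using assms by (simp add: fps_X_power_compose power_mult mult.commute[of e])
  then have "coeff G i oo fps_X ^ (e * e') = coeff G i oo (fps_X ^ e oo fps_X ^ e')"
    by simp
  also have "\<dots> = coeff G i oo fps_X ^ e oo fps_X ^ e'"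
    using assms by (intro fps_compose_assoc) auto
  finally show "coeff (ramify e' (ramify e G)) i = coeff (ramify (e * e') G) i"
    by (simp add: coeff_ramify)
qed

lemma ramify_pcompose:
  assumes "e \<noteq> 0"
  shows "ramify e (pcompose G [:s, t:]) = pcompose (ramify e G) [:s oo fps_X ^ e, t oo fps_X ^ e:]"
proof -
  interpret comm_ring_hom "\<lambda>f :: complex fps. f oo fps_X ^ e"
    by (rule comm_ring_hom_fps_compose) (use assms in auto)
  show ?thesis
    by (simp add: ramify_def map_poly_pcompose map_poly_pCons_hom)
qed

lemma ramify_smult:
  assumes "e \<noteq> 0"
  shows "ramify e (Polynomial.smult c G) = Polynomial.smult (c oo fps_X ^ e) (ramify e G)"
  using assms by (intro poly_eqI) (simp add: coeff_ramify fps_compose_mult_distrib)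

text \<open>The index \<open>i\<close> minimizes \<open>subdegree (c i) / (r - i)\<close>, the
  steepness of the first edge of the Newton polygon seen from the vertex at \<open>r\<close>. The
  fraction \<open>p / q\<close> need not be in lowest terms: \<open>q\<close> only serves as a
  ramification index, and the minimality is stated with cleared denominators.\<close>

lemma newton_polygon_slope:
  fixes c :: "nat \<Rightarrow> complex fps"
  assumes "\<exists>i<r. c i \<noteq> 0" and "\<And>i. i < r \<Longrightarrow> fps_nth (c i) 0 = 0"
  obtains i p q where "i < r" "c i \<noteq> 0" "p = subdegree (c i)" "q = r - i" "p > 0" "q > 0"
    "\<And>j. j < r \<Longrightarrow> c j \<noteq> 0 \<Longrightarrow> p * (r - j) \<le> subdegree (c j) * q"
proof -
  define A where "A = {i. i < r \<and> c i \<noteq> 0}"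
  define f where "f i = real (subdegree (c i)) / real (r - i)" for i
  have "finite A" "A \<noteq> {}"
    using assms(1) by (auto simp: A_def)
  then obtain i where i: "i \<in> A" "\<And>j. j \<in> A \<Longrightarrow> f i \<le> f j"
    using arg_min_if_finite[of A f] by (metis leI)
  have "subdegree (c i) \<noteq> 0"
    using i(1) assms(2)[of i] by (auto simp: A_def subdegree_eq_0_iff)
  moreover have "subdegree (c i) * (r - j) \<le> subdegree (c j) * (r - i)" if "j < r" "c j \<noteq> 0" for j
  proof -
    have "f i \<le> f j"
      using i that by (simp add: A_def)
    then have "real (subdegree (c i)) * real (r - j) \<le> real (subdegree (c j)) * real (r - i)"
      using i(1) that by (simp add: f_def A_def divide_simps split: if_splits)
    then show ?thesis
      by (metis of_nat_le_iff of_nat_mult)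
  qed
  ultimately show ?thesis
    using i(1) that[of i] by (auto simp: A_def)
qed

text \<open>Newton and Puiseux. Translating by a root of the derivative of order $r - 1$ removes the coefficient of
  degree $r - 1$. After the substitution given by the first slope of the Newton polygon the reduced
  polynomial is then not a multiple of an $r$-th power of a linear polynomial, so that it has a root of
  multiplicity less than $r$.\<close>

theorem fps_poly_root_exists:
  fixes G :: "complex fps poly"
  assumes "\<And>i. i < r \<Longrightarrow> coeff (reduction G) i = 0" "coeff (reduction G) r \<noteq> 0" "r \<noteq> 0"
  shows "\<exists>e y. e \<noteq> 0 \<and> fps_nth y 0 = 0 \<and> poly (ramify e G) y = 0"
  using assms
proof (induction r arbitrary: G rule: less_induct)
  case (less r)
  have red: "coeff (reduction G) i = fps_nth (coeff G i) 0" for i and G :: "complex fps poly"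
    by (simp add: coeff_map_poly)
  define H where "H = (pderiv ^^ (r - 1)) G"
  have fps_of_nat: "fps_nth (of_nat n * f) 0 = of_nat n * fps_nth f 0" for n and f :: "complex fps"
    by (simp flip: fps_of_nat)
  have H: "coeff H i = of_nat (pochhammer (Suc i) (r - 1)) * coeff G (i + (r - 1))" for i
    unfolding H_def coeff_higher_pderiv by (simp only: pochhammer_of_nat)
  \<comment> \<open>Modulo the parameter \<open>G\<close> starts in degree \<open>r\<close>, hence
    its derivative of order \<open>r - 1\<close> starts in degree one and has a simple root.\<close>
  have "fps_nth (coeff H 0) 0 = 0"
    unfolding H fps_of_nat using less.prems(1)[of "r - 1"] less.prems(3) by (simp add: red)
  moreover have "fps_nth (coeff H 1) 0 \<noteq> 0"
    unfolding H fps_of_nat using less.prems(2,3) by (simp add: red pochhammer_pos)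
  ultimately obtain s where s: "fps_nth s 0 = 0" "poly H s = 0"
    using fps_poly_simple_root by blast
  define G1 where "G1 = pcompose G [:s, 1:]"
  have G1_red: "reduction G1 = reduction G"
    by (simp add: G1_def reduction_pcompose_shift s)
  have "fact (r - 1) * coeff G1 (r - 1) = 0"
    using s(2) by (simp add: H_def G1_def poly_higher_pderiv)
  then have G1_r: "coeff G1 (r - 1) = 0"
    by simp
  show ?case
  proof (cases "\<exists>i<r. coeff G1 i \<noteq> 0")
    case False
    \<comment> \<open>If all coefficients below \<open>r\<close> vanish, the translation
      \<open>s\<close> is itself a root and no ramification is required.\<close>
    then have "coeff G1 0 = 0"
      using less.prems(3) by auto
    then have "poly G s = 0"
      by (simp add: G1_def)
    moreover have "ramify 1 G = G"
      by (rule poly_eqI) (simp add: coeff_ramify)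
    ultimately show ?thesis
      using s(1) by (metis one_neq_zero)
  next
    case True
    obtain i0 p q where i0: "i0 < r" "coeff G1 i0 \<noteq> 0" and p: "p = subdegree (coeff G1 i0)"
      and q: "q = r - i0" and pq: "p > 0" "q > 0"
      and slope: "\<And>j. j < r \<Longrightarrow> coeff G1 j \<noteq> 0 \<Longrightarrow> p * (r - j) \<le> subdegree (coeff G1 j) * q"
      using newton_polygon_slope[of r "coeff G1"] True less.prems(1)
      by (metis G1_red red)
    define d where "d i = coeff G1 i oo fps_X ^ q" for i
    have sd: "subdegree (d i) = subdegree (coeff G1 i) * q" for i
      using pq by (simp add: d_def)
    \<comment> \<open>These are the coefficients in \<open>T\<close> of \<open>G1\<close> with
      parameter \<open>X^q\<close> and variable \<open>X^p T\<close>, divided by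
      \<open>X^(p * r)\<close>. For \<open>i < r\<close> the division is exact by
      \<open>slope\<close>; for \<open>i > r\<close> a positive power of \<open>X\<close> is left
      over, so the reduction \<open>g\<close> has degree \<open>r\<close>.\<close>
    define b where "b i = (if i < r then fps_shift (p * (r - i)) (d i) else fps_X ^ (p * (i - r)) * d i)" for i
    have b: "fps_X ^ (p * r) * b i = d i * fps_X ^ (p * i)" for i
    proof (cases "i < r")
      case True
      have "b i * fps_X ^ (p * (r - i)) = d i"
      proof (cases "coeff G1 i = 0")
        case False
        then show ?thesis
          using slope[OF True False] sd[of i] True by (simp add: b_def fps_shift_times_fps_X_power)
      qed (use True in \<open>simp add: b_def d_def\<close>)
      moreover have "p * r = p * (r - i) + p * i"
        using True by (simp flip: distrib_left)
      ultimately show ?thesis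
        by (metis (no_types, lifting) mult.assoc mult.commute power_add)
    next
      case False
      then have "p * i = p * r + p * (i - r)"
        by (simp flip: distrib_left)
      then show ?thesis
        using False by (simp add: b_def power_add mult_ac)
    qed
    define G2 where "G2 = (\<Sum>i\<le>degree G1. monom (b i) i)"
    have b_high: "b i = 0" if "i > degree G1" for i
      using that by (simp add: b_def d_def coeff_eq_0)
    have G2: "coeff G2 i = b i" for i
    proof -
      have "coeff G2 i = (\<Sum>j\<le>degree G1. if j = i then b i else 0)"
        unfolding G2_def coeff_sum by (rule sum.cong) (auto simp: coeff_monom)
      then show ?thesis
        using b_high[of i] by (auto simp: sum.delta)
    qed
    have G2_G1: "Polynomial.smult (fps_X ^ (p * r)) G2 = pcompose (ramify q G1) [:0, fps_X ^ p:]"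
    proof (rule poly_eqI)
      show "coeff (Polynomial.smult (fps_X ^ (p * r)) G2) i = coeff (pcompose (ramify q G1) [:0, fps_X ^ p:]) i" for i
        using b[of i] by (simp add: G2 coeff_pcompose_linear coeff_ramify power_mult flip: d_def)
    qed
    define g where "g = reduction G2"
    have g: "coeff g i = fps_nth (b i) 0" for i
      by (simp add: g_def red G2)
    have d0: "fps_nth (d i) 0 = fps_nth (coeff G1 i) 0" for i
      by (simp add: d_def)
    have g_r: "coeff g r \<noteq> 0"
      using less.prems(2) by (simp add: g b_def d0 red flip: G1_red)
    have g_high: "coeff g i = 0" if "i > r" for i
      using that pq by (simp add: g b_def fps_X_power_mult_nth)
    have g_r1: "coeff g (r - 1) = 0"
      using G1_r less.prems(3) by (simp add: g b_def d_def)
    \<comment> \<open>The index \<open>i0\<close> lies on the chosen edge, so its coefficient has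
      exactly the order that is divided out and survives in \<open>g\<close>.\<close>
    have "d i0 \<noteq> 0"
      using i0(2) sd[of i0] p pq by auto
    moreover have "subdegree (d i0) = p * (r - i0)"
      by (simp add: sd p q)
    ultimately have g_i0: "coeff g i0 \<noteq> 0"
      using i0(1) nth_subdegree_nonzero[of "d i0"] by (simp add: g b_def)
    have deg_g: "degree g = r"
      by (rule antisym[OF degree_le le_degree]) (use g_high g_r in auto)
    have "\<exists>z. poly g z = 0"
    proof (rule fundamental_theorem_of_algebra_alt)
      show "\<not> (\<exists>a l. a \<noteq> 0 \<and> l = 0 \<and> g = pCons a l)"
        using deg_g less.prems(3) by auto
    qed
    then obtain z where z: "poly g z = 0" ..
    define g3 where "g3 = pcompose g [:z, 1:]"
    have deg_g3: "degree g3 = r"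
      by (simp add: g3_def degree_pcompose deg_g)
    have "g3 \<noteq> 0"
      using deg_g3 less.prems(3) by auto
    then have g3_r: "coeff g3 r \<noteq> 0"
      using deg_g3 leading_coeff_neq_0 by metis
    define k where "k = (LEAST k. coeff g3 k \<noteq> 0)"
    have k: "coeff g3 k \<noteq> 0"
      unfolding k_def using g3_r by (rule LeastI)
    have k_least: "coeff g3 i = 0" if "i < k" for i
      using not_less_Least[of i "\<lambda>k. coeff g3 k \<noteq> 0"] that by (auto simp: k_def)
    have "coeff g3 0 = 0"
      using z by (simp add: g3_def)
    then have "k \<noteq> 0"
      using k by (metis (full_types))
    have "k \<le> r"
      unfolding k_def using g3_r by (rule Least_le)
    \<comment> \<open>A root \<open>z\<close> of multiplicity \<open>r\<close> would make
      \<open>g\<close> a multiple of \<open>(T - z)^r\<close>. Since the coefficient of degree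
      \<open>r - 1\<close> is zero this forces \<open>z = 0\<close>, which contradicts the nonzero
      coefficient at \<open>i0\<close>. The derivative \<open>h\<close> of order
      \<open>r - 1\<close> is linear without constant term and shows \<open>z = 0\<close>.\<close>
    moreover have "k \<noteq> r"
    proof
      assume "k = r"
      define h where "h = (pderiv ^^ (r - 1)) g"
      have h: "coeff h i = of_nat (pochhammer (Suc i) (r - 1)) * coeff g (i + (r - 1))" for i
        unfolding h_def coeff_higher_pderiv by (simp only: pochhammer_of_nat)
      have "degree h \<le> 1"
        by (rule degree_le) (auto simp: h g_high)
      moreover have "coeff h 0 = 0"
        using g_r1 by (simp add: h)
      ultimately have "poly h z = coeff h 1 * z"
        by (simp add: poly_altdef le_Suc_eq split: if_splits) (auto simp: poly_altdef coeff_eq_0)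
      moreover have "coeff h 1 \<noteq> 0"
        using g_r less.prems(3) by (simp add: h pochhammer_pos)
      moreover have "poly h z = 0"
        using k_least[of "r - 1"] \<open>k = r\<close> less.prems(3) by (simp add: h_def poly_higher_pderiv g3_def)
      ultimately have "z = 0"
        by simp
      then have "g3 = g"
        by (simp add: g3_def)
      then show False
        using g_i0 k_least[of i0] i0(1) \<open>k = r\<close> by simp
    qed
    ultimately have "k < r" by simp
    define G3 where "G3 = pcompose G2 [:fps_const z, 1:]"
    have "reduction G3 = g3"
      by (simp add: G3_def reduction_pcompose_shift g3_def g_def)
    then obtain e w where ew: "e \<noteq> 0" "fps_nth w 0 = 0" "poly (ramify e G3) w = 0"
      using less.IH[OF \<open>k < r\<close>, of G3] k k_least \<open>k \<noteq> 0\<close> by auto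
    \<comment> \<open>The substitutions are now undone in reverse order: the translation by
      \<open>z\<close>, the scaling of the variable by \<open>X^p\<close>, and the translation by
      \<open>s\<close>; the ramification indices multiply to \<open>q * e\<close>.\<close>
    have "poly (ramify e G2) (fps_const z + w) = 0"
      using ew(3) by (simp add: G3_def ramify_pcompose[OF ew(1)] poly_pcompose)
    then have "poly (ramify e (Polynomial.smult (fps_X ^ (p * r)) G2)) (fps_const z + w) = 0"
      by (simp add: ramify_smult[OF ew(1)])
    then have "poly (ramify (q * e) G1) (fps_X ^ (e * p) * (fps_const z + w)) = 0"
      using pq ew(1)
      by (simp add: G2_G1 ramify_pcompose ramify_ramify poly_pcompose fps_X_power_compose mult.commute flip: power_mult)
    then have "poly (ramify (q * e) G) ((s oo fps_X ^ (q * e)) + fps_X ^ (e * p) * (fps_const z + w)) = 0"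
      using pq ew(1) by (simp add: G1_def ramify_pcompose poly_pcompose)
    moreover have "fps_nth ((s oo fps_X ^ (q * e)) + fps_X ^ (e * p) * (fps_const z + w)) 0 = 0"
      using s(1) pq ew(1) by (simp add: fps_X_power_mult_nth)
    ultimately show ?thesis
      using pq ew(1) by (metis mult_eq_0_iff less_numeral_extra(3))
  qed
qed

text \<open>Either \<open>F\<close> vanishes on the line \<open>x = 0\<close>, which is then the
  arc, or \<open>F\<close> is a polynomial in \<open>y\<close> over the power series in
  \<open>x\<close> whose reduction has finite order \<open>r\<close>. Vanishing at the origin gives
  \<open>r > 0\<close>, and a Puiseux root provides the arc.\<close>

lemma exists_arc:
  assumes "at_origin F = 0"
  obtains x y where "fps_nth x 0 = 0" "fps_nth y 0 = 0" "x \<noteq> 0 \<or> y \<noteq> 0" "along F x y = 0"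
proof -
  interpret complex_hom fps_const
    by (rule complex_hom_fps_const)
  define v :: "complex fps \<Rightarrow> complex poly \<Rightarrow> complex fps" where "v u p = poly (map_poly fps_const p) u" for u p
  have v0: "fps_nth (v u p) 0 = coeff p 0" if "fps_nth u 0 = 0" for u p
    using that by (simp add: v_def poly_fps_nth_0)
  have v_hom: "comm_ring_hom (v u)" for u
    unfolding v_def by (rule eval_hom)
  have v_0 [simp]: "v u 0 = 0" for u
    by (simp add: v_def)
  have along: "along F x y = poly (map_poly (v x) F) y" for x y
    unfolding subst2_def v_def[abs_def] ..
  show ?thesis
  proof (cases "\<forall>j. coeff (coeff F j) 0 = 0")
    case True
    have "map_poly (v 0) F = 0"
      by (rule poly_eqI) (simp add: coeff_map_poly v_def poly_0_coeff_0 True)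
    then show ?thesis
      by (intro that[of 0 fps_X]) (auto simp: along)
  next
    case False
    define G where "G = map_poly (v fps_X) F"
    have G: "coeff (reduction G) j = coeff (coeff F j) 0" for j
      by (simp add: G_def coeff_map_poly v0)
    define r where "r = (LEAST j. coeff (coeff F j) 0 \<noteq> 0)"
    have r: "coeff (coeff F r) 0 \<noteq> 0"
      unfolding r_def using False by (metis (mono_tags, lifting) LeastI)
    moreover have "coeff (coeff F j) 0 = 0" if "j < r" for j
      using not_less_Least[of j "\<lambda>j. coeff (coeff F j) 0 \<noteq> 0"] that by (auto simp: r_def)
    moreover have "r \<noteq> 0"
      using r assms unfolding at_origin_def by metis
    ultimately obtain e y where ey: "e \<noteq> 0" "fps_nth y 0 = 0" "poly (ramify e G) y = 0"
      using fps_poly_root_exists[of r G] by (auto simp: G)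
    have "v fps_X p oo fps_X ^ e = v (fps_X ^ e) p" for p
    proof -
      interpret c: comm_ring_hom "\<lambda>f :: complex fps. f oo fps_X ^ e"
        by (rule comm_ring_hom_fps_compose) (use ey in auto)
      show ?thesis
        unfolding v_def using ey(1)
        by (induction p) (simp_all add: map_poly_pCons_hom c.hom_add c.hom_mult fps_compose_add_distrib)
    qed
    then have "ramify e G = map_poly (v (fps_X ^ e)) F"
      by (intro poly_eqI) (simp add: coeff_ramify G_def coeff_map_poly)
    then have "along F (fps_X ^ e) y = 0"
      using ey(3) by (simp add: along)
    then show ?thesis
      using ey by (intro that[of "fps_X ^ e" y]) auto
  qed
qed

text \<open>Absence of a common branch of the two curves through the origin, expressed by the power
  series arcs on which it is used.\<close>

definition isolated_base :: "bipoly \<Rightarrow> bipoly \<Rightarrow> bool" where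
  "isolated_base A B \<longleftrightarrow> (\<forall>x y. fps_nth x 0 = 0 \<longrightarrow> fps_nth y 0 = 0 \<longrightarrow> x \<noteq> 0 \<or> y \<noteq> 0 \<longrightarrow>
     along A x y \<noteq> 0 \<or> along B x y \<noteq> 0)"

theorem base_point_dicritical:
  assumes fi: "first_int \<omega> A B" and nz: "\<omega> \<noteq> (0, 0)"
    and iso: "isolated_base A B" and 0: "at_origin A = 0" "at_origin B = 0"
  shows "dicritical_form \<omega>"
proof -
  have AB: "(A, B) \<noteq> (0, 0)"
  proof
    assume "(A, B) = (0, 0)"
    then have "along A fps_X fps_X = 0 \<and> along B fps_X fps_X = 0"
      by simp
    then show False
      using iso by (auto simp: isolated_base_def)
  qed
  obtain c where c: "\<And>n. c \<notin> exc_values n (A, B)"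
    using exists_not_exc_value[OF AB] by blast
  have "at_origin (A - const2 c * B) = 0"
    using 0 by (simp del: poly_fold_simps)
  then obtain x y where xy: "fps_nth x 0 = 0" "fps_nth y 0 = 0" "x \<noteq> 0 \<or> y \<noteq> 0"
    and "along (A - const2 c * B) x y = 0"
    by (rule exists_arc)
  then have e: "along A x y = fps_const c * along B x y"
    by (simp add: fps_subst2_simps del: poly_fold_simps)
  \<comment> \<open>If \<open>B\<close> vanished along the arc, so would \<open>A\<close>, being
    \<open>c\<close> times \<open>B\<close> there.\<close>
  then have "along B x y \<noteq> 0"
    using iso xy unfolding isolated_base_def by (metis mult_zero_right)
  then have "\<exists>qs. terminal_dicritical (transform_at \<omega> qs)"
    using base_point_reaches_terminal_dicritical[OF fi nz AB _ c xy e] 0 by (simp add: base_pt_def)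
  then show ?thesis
    using dicritical_form_iff[OF nz] by blast
qed

section \<open>First integrals in the charts\<close>

lemma fract_deriv_to_fract:
  assumes "derivation const2 D"
  shows "fract_deriv D (to_fract p) = to_fract (D p)"
proof -
  interpret derivation const2 D by fact
  show ?thesis
    using fract_deriv_Fract[of D 1 p] d_mult by (simp add: to_fract_def)
qed

lemma complex_hom_to_fract_comp:
  assumes "complex_hom h"
  shows "complex_hom (\<lambda>c. to_fract (h c))"
proof -
  interpret complex_hom h by fact
  show ?thesis
    by unfold_locales
       (simp_all only: hom_zero hom_one hom_add hom_mult to_fract_0 to_fract_1 to_fract_add to_fract_mult)
qed

lemmas complex_hom_to_fract_const2 = complex_hom_to_fract_comp[OF complex_hom_const2]
lemmas complex_hom_to_fract_fps = complex_hom_to_fract_comp[OF complex_hom_fps_const]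

lemma derivation_fract_deriv:
  assumes "derivation const2 D"
  shows "derivation (\<lambda>c. to_fract (const2 c)) (fract_deriv D)"
proof -
  interpret derivation const2 D by fact
  note deriv_Fract = fract_deriv_Fract[of D, OF d_mult]
  have hom: "complex_hom (\<lambda>c. to_fract (const2 c))"
    by (rule complex_hom_to_fract_const2)
  show ?thesis
  proof (rule derivation.intro[OF hom])
    fix x y :: birat and c
    obtain p q where x: "x = Fract p q" "q \<noteq> 0" by (cases x)
    obtain r s where y: "y = Fract r s" "s \<noteq> 0" by (cases y)
    show "fract_deriv D (x + y) = fract_deriv D x + fract_deriv D y"
      using x y
      by (simp add: deriv_Fract add_fract eq_fract d_add d_mult algebra_simps power2_eq_square)
    show "fract_deriv D (x * y) = x * fract_deriv D y + y * fract_deriv D x"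
      using x y
      by (simp add: deriv_Fract mult_fract add_fract eq_fract d_mult algebra_simps power2_eq_square)
    show "fract_deriv D (to_fract (const2 c)) = 0"
      by (simp add: fract_deriv_to_fract[OF assms])
  qed
qed

text \<open>The relation is pulled back to rational functions, where \<omega> differs from the
  pull-back by a factor \<open>g\<close> and the pencil by the factor \<open>m\<close> that clears
  denominators. The relation absorbs \<open>g * m\<^sup>2\<close>, and \<open>to_fract\<close> is
  injective.\<close>

lemma extension_form_first_int:
  assumes ext: "extension_form \<delta> X c \<omega>" and fi: "first_int (form_of_field X) A B"
    and chart: "chart_change \<delta> c = (u, v)" and "m \<noteq> 0"
    and A': "to_fract A' = m * subst2 (\<lambda>c. to_fract (const2 c)) A u v"
    and B': "to_fract B' = m * subst2 (\<lambda>c. to_fract (const2 c)) B u v"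
  shows "first_int \<omega> A' B'"
proof -
  let ?i = "\<lambda>c. to_fract (const2 c)"
  let ?d1 = "fract_deriv D1" and ?d2 = "fract_deriv D2"
  note d1 = derivation_fract_deriv[OF derivation_D1] and d2 = derivation_fract_deriv[OF derivation_D2]
  define a b where "a = subst2 ?i A u v" and "b = subst2 ?i B u v"
  obtain F G where FG: "rat_pullback (u, v) (form_of_field X) = (F, G)" by force
  obtain g where g: "to_fract (fst \<omega>) = g * F" "to_fract (snd \<omega>) = g * G"
    using ext by (auto simp: extension_form_def chart FG)
  have "F * (b * ?d2 a - a * ?d2 b) = G * (b * ?d1 a - a * ?d1 b)"
    using pullback_wronskian[OF d1 d2 fi a_def b_def] by (simp add: FG)
  then have "(g * m\<^sup>2) * (F * (b * ?d2 a - a * ?d2 b)) = (g * m\<^sup>2) * (G * (b * ?d1 a - a * ?d1 b))"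
    by simp
  then have "g * F * ((m * b) * ?d2 (m * a) - (m * a) * ?d2 (m * b)) =
      g * G * ((m * b) * ?d1 (m * a) - (m * a) * ?d1 (m * b))"
    unfolding wronskian_scale[OF d1] wronskian_scale[OF d2] by (simp only: mult_ac)
  then have "to_fract (fst \<omega> * (B' * D2 A' - A' * D2 B')) = to_fract (snd \<omega> * (B' * D1 A' - A' * D1 B'))"
    unfolding g[symmetric] a_def b_def A'[symmetric] B'[symmetric]
    by (simp add: fract_deriv_to_fract[OF derivation_D1] fract_deriv_to_fract[OF derivation_D2])
  then show ?thesis
    unfolding to_fract_eq_iff first_int_def .
qed

lemma extension_form_nonzero: "extension_form \<delta> X c \<omega> \<Longrightarrow> \<omega> \<noteq> (0, 0)"
  by (auto simp: extension_form_def)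

lemma exists_coprime_multiple:
  fixes F G :: birat
  assumes "F \<noteq> 0 \<or> G \<noteq> 0"
  shows "\<exists>g p q. g \<noteq> 0 \<and> coprime p q \<and> to_fract p = g * F \<and> to_fract q = g * G"
proof -
  obtain p q where F: "F = Fract p q" "q \<noteq> 0" by (cases F)
  obtain r s where G: "G = Fract r s" "s \<noteq> 0" by (cases G)
  have F': "to_fract (q * s) * F = to_fract (p * s)" and G': "to_fract (q * s) * G = to_fract (r * q)"
    using F(2) G(2) by (simp_all add: F(1) G(1) Fract_conv_to_fract field_simps)
  define h where "h = gcd (p * s) (r * q)"
  have "p * s \<noteq> 0 \<or> r * q \<noteq> 0"
    using assms F G by (auto simp: Fract_conv_to_fract)
  then have h: "h \<noteq> 0"
    by (simp add: h_def)
  obtain p' r' where pr: "p * s = p' * h" "r * q = r' * h" "coprime p' r'"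
    using gcd_coprime_exists[of "p * s" "r * q"] h unfolding h_def by metis
  show ?thesis
    using h F(2) G(2) pr(3) F' G' unfolding pr
    by (intro exI[of _ "to_fract (q * s) / to_fract h"] exI[of _ p'] exI[of _ r']) (auto simp: field_simps)
qed

lemma algebraically_integrable_first_int:
  assumes "algebraically_integrable (a, b)"
  obtains A B where "coprime A B" "B \<noteq> 0" "first_int (form_of_field (a, b)) A B"
    "\<And>k. A \<noteq> const2 k * B"
proof -
  obtain f where f: "f \<notin> range (\<lambda>c. to_fract (const2 c))"
    "to_fract a * fract_deriv D1 f + to_fract b * fract_deriv D2 f = 0"
    using assms by (auto simp: algebraically_integrable_def rational_first_integral_def)
  obtain A B where AB: "quot_of_fract f = (A, B)" by force
  have B: "B \<noteq> 0"
    using AB by (metis snd_conv snd_quot_of_fract_nonzero)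
  have cop: "coprime A B"
    using coprime_quot_of_fract[of f] by (simp add: AB)
  have fAB: "f = to_fract A / to_fract B"
    by (metis AB Fract_conv_to_fract Fract_quot_of_fract fst_conv snd_conv)
  have "to_fract (a * (D1 A * B - A * D1 B) + b * (D2 A * B - A * D2 B)) / to_fract (B\<^sup>2) = 0"
    using f(2) by (simp add: fract_deriv_def AB Fract_conv_to_fract add_divide_distrib)
  then have "a * (D1 A * B - A * D1 B) + b * (D2 A * B - A * D2 B) = 0"
    using B by (simp del: to_fract_add to_fract_mult to_fract_diff)
  then have "first_int (form_of_field (a, b)) A B"
    by (simp add: first_int_def form_of_field_def algebra_simps add_eq_0_iff)
  moreover have "A \<noteq> const2 k * B" for k
  proof
    assume "A = const2 k * B"
    then have "f = to_fract (const2 k)"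
      using B by (simp add: fAB del: mult_pCons_left)
    then show False
      using f(1) by blast
  qed
  ultimately show ?thesis
    using that cop B by blast
qed

section \<open>Translation to an arbitrary point of a chart\<close>

definition shift :: "complex \<Rightarrow> complex \<Rightarrow> bipoly \<Rightarrow> bipoly" where
  "shift s t P = subst2 const2 P (var1 + const2 s) (var2 + const2 t)"

lemma shift_simps:
  "shift s t (P + Q) = shift s t P + shift s t Q" "shift s t (P * Q) = shift s t P * shift s t Q"
  "shift s t [:[:c:]:] = const2 c" "shift s t 0 = 0"
  by (simp_all add: shift_def const2_subst2_simps)

lemma shift_eq_0_iff: "shift s t P = 0 \<longleftrightarrow> P = 0"
proof
  assume *: "shift s t P = 0"
  have "subst2 const2 (shift s t P) (var1 - const2 s) (var2 - const2 t) = P"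
    unfolding shift_def subst2_subst2[OF complex_hom_const2]
    by (simp add: const2_subst2_simps del: poly_fold_simps)
  with * show "P = 0" by simp
qed (simp add: shift_simps)

lemma at_origin_shift: "at_origin (shift s t P) = subst2 (\<lambda>c. c) P s t"
proof -
  have "at_origin (shift s t P) = subst2 (\<lambda>c. at_origin (const2 c)) P (at_origin (var1 + const2 s)) (at_origin (var2 + const2 t))"
    unfolding shift_def by (rule subst2_comp[OF complex_hom_const2]) (unfold_locales, auto)
  then show ?thesis
    by (simp del: poly_fold_simps)
qed

lemma poly_pullback_shift:
  "poly_pullback (var1 + const2 s, var2 + const2 t) (P, Q) = (shift s t P, shift s t Q)"
proof -
  have "D1 (var1 + const2 s) = 1" "D2 (var1 + const2 s) = 0" "D1 (var2 + const2 t) = 0" "D2 (var2 + const2 t) = 1"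
    by (simp_all add: D1_add D2_add del: poly_fold_simps)
  then show ?thesis
    by (simp add: pullback_def Let_def shift_def del: poly_fold_simps)
qed

lemma dicritical_form_at_0: "dicritical_form_at \<omega> (0, 0) \<longleftrightarrow> dicritical_form \<omega>"
  by (cases \<omega>) (simp add: dicritical_form_at_def poly_pullback_shift shift_def del: poly_fold_simps)

lemma nonbase_not_dicritical_at:
  assumes fi: "first_int \<omega> A B" and nz: "\<omega> \<noteq> (0, 0)" and "indep A B"
    and val: "subst2 (\<lambda>c. c) A s t \<noteq> 0 \<or> subst2 (\<lambda>c. c) B s t \<noteq> 0"
  shows "\<not> dicritical_form_at \<omega> (s, t)"
proof -
  define \<omega>' where "\<omega>' = poly_pullback (var1 + const2 s, var2 + const2 t) \<omega>"
  have "\<omega>' = (shift s t (fst \<omega>), shift s t (snd \<omega>))"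
    using poly_pullback_shift[of s t "fst \<omega>" "snd \<omega>"] by (simp add: \<omega>'_def)
  then have "\<omega>' \<noteq> (0, 0)"
    using nz by (cases \<omega>) (simp add: shift_eq_0_iff)
  moreover have "first_int \<omega>' (shift s t A) (shift s t B)"
    using pullback_wronskian[OF derivation_D1 derivation_D2 fi shift_def shift_def]
    by (simp add: first_int_def \<omega>'_def)
  moreover have "indep (shift s t A) (shift s t B)"
    unfolding indep_def
  proof (intro allI impI)
    fix c d assume "const2 c * shift s t A + const2 d * shift s t B = 0"
    then have "shift s t (const2 c * A + const2 d * B) = 0"
      unfolding shift_simps .
    then show "c = 0 \<and> d = 0"
      using assms(3) unfolding indep_def shift_eq_0_iff by blast
  qed
  ultimately have "\<not> dicritical_form \<omega>'"
    using nonbase_not_dicritical val by (simp add: at_origin_shift)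
  then show ?thesis
    by (simp add: dicritical_form_at_def \<omega>'_def)
qed

text \<open>Take a nonzero \<open>W\<close> of least degree in \<open>y\<close> in the ideal
  generated by \<open>A\<close> and \<open>B\<close>. Pseudo-division by \<open>W\<close> leaves a
  remainder in the ideal of smaller degree, hence zero, so the primitive part of \<open>W\<close>
  divides both \<open>A\<close> and \<open>B\<close>. By coprimality it is a unit, and
  \<open>W\<close> does not involve \<open>y\<close>.\<close>

lemma coprime_imp_eliminant:
  fixes A B :: bipoly
  assumes "coprime A B"
  shows "\<exists>U V R. U * A + V * B = [:R:] \<and> R \<noteq> 0"
proof -
  define I where "I = {U * A + V * B | U V. True}"
  have I_add: "p + q \<in> I" if "p \<in> I" "q \<in> I" for p q
  proof -
    obtain U V U' V' where "p = U * A + V * B" "q = U' * A + V' * B"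
      using \<open>p \<in> I\<close> \<open>q \<in> I\<close> by (auto simp: I_def)
    then have "p + q = (U + U') * A + (V + V') * B"
      by (simp add: algebra_simps)
    then show ?thesis
      unfolding I_def by blast
  qed
  have I_mult: "r * p \<in> I" if "p \<in> I" for p r
  proof -
    obtain U V where "p = U * A + V * B"
      using \<open>p \<in> I\<close> by (auto simp: I_def)
    then have "r * p = (r * U) * A + (r * V) * B"
      by (simp add: algebra_simps)
    then show ?thesis
      unfolding I_def by blast
  qed
  have A: "A \<in> I"
    unfolding I_def by (metis (mono_tags, lifting) add.right_neutral mem_Collect_eq mult_1 mult_zero_left)
  have B: "B \<in> I"
    unfolding I_def by (metis (mono_tags, lifting) add.left_neutral mem_Collect_eq mult_1 mult_zero_left)
  have "A \<noteq> 0 \<or> B \<noteq> 0"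
    using assms by auto
  then have "\<exists>p. p \<in> I \<and> p \<noteq> 0"
    using A B by blast
  then obtain W where W: "W \<in> I" "W \<noteq> 0" and least: "\<And>p. p \<in> I \<Longrightarrow> p \<noteq> 0 \<Longrightarrow> degree W \<le> degree p"
    using ex_has_least_nat[of "\<lambda>p. p \<in> I \<and> p \<noteq> 0" _ degree] by blast
  have "primitive_part W dvd Z" if Z: "Z \<in> I" for Z
  proof -
    obtain c q where c: "c \<noteq> 0" and cq: "Polynomial.smult c Z = W * q + pseudo_mod Z W"
      using pseudo_mod(1)[OF W(2), of Z] by blast
    have "pseudo_mod Z W = [:c:] * Z + (- q) * W"
      using cq by (simp add: algebra_simps)
    then have "pseudo_mod Z W \<in> I"
      using I_add[OF I_mult[OF Z] I_mult[OF W(1)]] by metis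
    then have "pseudo_mod Z W = 0"
      using least pseudo_mod(2)[OF W(2), of Z] by (meson not_le)
    \<comment> \<open>Gauss's lemma: divisibility over the rational functions in \<open>x\<close>
      descends to polynomials because the divisor is primitive.\<close>
    then have "fract_poly (primitive_part W) * fract_poly ([:content W:] * q) = fract_poly (Polynomial.smult c Z)"
      unfolding cq by (simp flip: fract_poly_mult fract_poly_smult) (metis add.right_neutral content_times_primitive_part mult.commute mult_smult_left)
    then have "fract_poly (primitive_part W) dvd Polynomial.smult (to_fract c) (fract_poly Z)"
      by (metis dvd_triv_left fract_poly_smult)
    then have "fract_poly (primitive_part W) dvd fract_poly Z"
      using c by (simp add: dvd_smult_iff)
    then show ?thesis
      by (rule fract_poly_dvdD) (use W(2) in simp)
  qed
  then have "is_unit (primitive_part W)"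
    using assms A B coprime_common_divisor by blast
  then have "degree W = 0"
    by (metis degree_primitive_part is_unit_iff_degree W(2) poly_dvd_1 )
  then obtain R where "W = [:R:]"
    by (metis degree_eq_zeroE)
  moreover obtain U V where "W = U * A + V * B"
    using W(1) by (auto simp: I_def)
  ultimately show ?thesis
    using W(2) by (intro exI[of _ U] exI[of _ V] exI[of _ R]) auto
qed

section \<open>Monomial substitutions\<close>

text \<open>Monomials are moved by arbitrary maps of exponents, so that a chart change which inverts
  a variable becomes polynomial once the exponents have been shifted to be nonnegative.\<close>

definition remonom :: "(nat \<Rightarrow> nat \<Rightarrow> nat) \<Rightarrow> (nat \<Rightarrow> nat) \<Rightarrow> bipoly \<Rightarrow> bipoly" where
  "remonom e f P =
     (\<Sum>j\<le>degree P. \<Sum>i\<le>degree (coeff P j). monom (monom (coeff (coeff P j) i) (e i j)) (f j))"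

lemma sum_coeffs_single:
  fixes g :: "nat \<Rightarrow> nat \<Rightarrow> 'a::comm_monoid_add" and P :: bipoly
  assumes "\<And>i j. (i, j) \<noteq> (i0, j0) \<Longrightarrow> g i j = 0"
    and "coeff (coeff P j0) i0 = 0 \<Longrightarrow> g i0 j0 = 0"
  shows "(\<Sum>j\<le>degree P. \<Sum>i\<le>degree (coeff P j). g i j) = g i0 j0"
proof -
  have "(\<Sum>i\<le>degree (coeff P j). g i j) = (if j = j0 then g i0 j0 else 0)" for j
  proof -
    have "(\<Sum>i\<le>degree (coeff P j). g i j) = (\<Sum>i\<le>degree (coeff P j). if i = i0 \<and> j = j0 then g i0 j0 else 0)"
      using assms(1) by (intro sum.cong) auto
    also have "\<dots> = (if j = j0 then g i0 j0 else 0)"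
      using assms(2) coeff_eq_0[of "coeff P j" i0] by (auto simp: sum.delta not_le)
    finally show ?thesis .
  qed
  then show ?thesis
    using assms(2) coeff_eq_0[of P j0] by (auto simp: sum.delta not_le)
qed

text \<open>The hypothesis says that no other monomial of \<open>P\<close> is sent to the same
  exponents, so no coefficients are added up.\<close>

lemma coeff_remonom:
  assumes "\<And>i j. coeff (coeff P j) i \<noteq> 0 \<Longrightarrow> f j = f j0 \<Longrightarrow> e i j = e i0 j0 \<Longrightarrow> i = i0 \<and> j = j0"
  shows "coeff (coeff (remonom e f P) (f j0)) (e i0 j0) = coeff (coeff P j0) i0"
proof -
  let ?g = "\<lambda>i j. if f j = f j0 \<and> e i j = e i0 j0 then coeff (coeff P j) i else 0"
  have "coeff (coeff (remonom e f P) (f j0)) (e i0 j0) = (\<Sum>j\<le>degree P. \<Sum>i\<le>degree (coeff P j). ?g i j)"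
    unfolding remonom_def coeff_sum by (intro sum.cong refl) (auto simp: coeff_monom)
  also have "\<dots> = ?g i0 j0"
    using assms by (intro sum_coeffs_single) auto
  finally show ?thesis by simp
qed

context complex_hom
begin

lemma subst2_expand:
  "subst2 hom P u v = (\<Sum>j\<le>degree P. \<Sum>i\<le>degree (coeff P j). hom (coeff (coeff P j) i) * u ^ i * v ^ j)"
proof -
  have "P = (\<Sum>j\<le>degree P. \<Sum>i\<le>degree (coeff P j). monom (monom (coeff (coeff P j) i) i) j)"
  proof -
    have "(\<Sum>i\<le>degree (coeff P j). monom (monom (coeff (coeff P j) i) i) j) = monom (coeff P j) j" for j
      by (simp add: poly_as_sum_of_monoms flip: monom_sum)
    then show ?thesis
      by (simp add: poly_as_sum_of_monoms)
  qed
  then have "subst2 hom P u v = subst2 hom (\<Sum>j\<le>degree P. \<Sum>i\<le>degree (coeff P j). monom (monom (coeff (coeff P j) i) i) j) u v"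
    by simp
  then show ?thesis
    by (simp add: subst2_simps subst2_monom)
qed

lemma subst2_remonom:
  "subst2 hom (remonom e f P) u v =
     (\<Sum>j\<le>degree P. \<Sum>i\<le>degree (coeff P j). hom (coeff (coeff P j) i) * u ^ e i j * v ^ f j)"
  by (simp add: remonom_def subst2_simps subst2_monom)

end

text \<open>At \<open>u = 0\<close> a monomial survives only if its new exponent
  \<open>e i j\<close> is 0, where the power is \<open>0 ^ 0 = 1\<close>.\<close>

lemma subst2_remonom_0:
  assumes "\<And>i j. coeff (coeff P j) i \<noteq> 0 \<Longrightarrow> e i j = 0 \<Longrightarrow> i = i0 \<and> j = j0" and "e i0 j0 = 0"
  shows "subst2 (\<lambda>c. c) (remonom e f P) 0 t = coeff (coeff P j0) i0 * t ^ f j0"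
  unfolding complex_hom.subst2_remonom[OF complex_hom_ident]
  by (subst sum_coeffs_single[of i0 j0]) (use assms in \<open>auto simp: power_0_left\<close>)

text \<open>\<open>s^K P(1/s, s^\<delta> t)\<close> and \<open>s^K t^n P(1/s, s^\<delta>/t)\<close>, provided that no subtraction is truncated, which
  \<open>weight_le\<close> guarantees for the first exponent.\<close>

definition to10 :: "nat \<Rightarrow> nat \<Rightarrow> bipoly \<Rightarrow> bipoly" where
  "to10 \<delta> K = remonom (\<lambda>i j. K + \<delta> * j - i) (\<lambda>j. j)"

definition to11 :: "nat \<Rightarrow> nat \<Rightarrow> nat \<Rightarrow> bipoly \<Rightarrow> bipoly" where
  "to11 \<delta> K n = remonom (\<lambda>i j. K + \<delta> * j - i) (\<lambda>j. n - j)"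

text \<open>In terms of \<open>s = 1 / x\<close> the monomial \<open>x^i y^j\<close> has a pole of
  order \<open>i - \<delta> * j\<close> along \<open>s = 0\<close>, so \<open>K\<close> bounds the
  pole order of \<open>P\<close> along the curve at infinity.\<close>

definition weight_le :: "nat \<Rightarrow> nat \<Rightarrow> bipoly \<Rightarrow> bool" where
  "weight_le \<delta> K P \<longleftrightarrow> (\<forall>i j. coeff (coeff P j) i \<noteq> 0 \<longrightarrow> i \<le> K + \<delta> * j)"

lemma subst2_to10:
  fixes u v :: "'a::field"
  assumes "complex_hom \<iota>" and "weight_le \<delta> K P" and u: "u \<noteq> 0"
  shows "subst2 \<iota> (to10 \<delta> K P) u v = u ^ K * subst2 \<iota> P (1 / u) (u ^ \<delta> * v)"
proof -
  interpret complex_hom \<iota> by fact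
  have *: "\<iota> (coeff (coeff P j) i) * u ^ (K + \<delta> * j - i) * v ^ j =
      u ^ K * (\<iota> (coeff (coeff P j) i) * (1 / u) ^ i * (u ^ \<delta> * v) ^ j)" for i j
  proof (cases "coeff (coeff P j) i = 0")
    case False
    then have "i \<le> K + \<delta> * j"
      using assms(2) by (simp add: weight_le_def)
    then have "u ^ (K + \<delta> * j - i) = u ^ K * u ^ (\<delta> * j) / u ^ i"
      using u by (simp add: power_diff power_add)
    then show ?thesis
      by (simp add: power_mult_distrib power_mult power_divide)
  qed simp
  show ?thesis
    unfolding to10_def subst2_remonom subst2_expand[of P] sum_distrib_left by (intro sum.cong refl *)
qed

lemma subst2_to11:
  fixes u v :: "'a::field"
  assumes "complex_hom \<iota>" and "weight_le \<delta> K P" and "degree P \<le> n" and u: "u \<noteq> 0" and v: "v \<noteq> 0"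
  shows "subst2 \<iota> (to11 \<delta> K n P) u v = u ^ K * v ^ n * subst2 \<iota> P (1 / u) (u ^ \<delta> / v)"
proof -
  interpret complex_hom \<iota> by fact
  have *: "\<iota> (coeff (coeff P j) i) * u ^ (K + \<delta> * j - i) * v ^ (n - j) =
      u ^ K * v ^ n * (\<iota> (coeff (coeff P j) i) * (1 / u) ^ i * (u ^ \<delta> / v) ^ j)" for i j
  proof (cases "coeff (coeff P j) i = 0")
    case False
    then have "i \<le> K + \<delta> * j"
      using assms(2) by (simp add: weight_le_def)
    then have "u ^ (K + \<delta> * j - i) = u ^ K * u ^ (\<delta> * j) / u ^ i"
      using u by (simp add: power_diff power_add)
    moreover have "j \<le> n"
      using False assms(3) by (metis coeff_0 le_degree order_trans)
    then have "v ^ (n - j) = v ^ n / v ^ j"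
      using v by (simp add: power_diff)
    ultimately show ?thesis
      by (simp add: power_mult power_divide)
  qed simp
  show ?thesis
    unfolding to11_def subst2_remonom subst2_expand[of P] sum_distrib_left by (intro sum.cong refl *)
qed

lemma coeff_to10:
  assumes "weight_le \<delta> K P" "i \<le> K + \<delta> * j"
  shows "coeff (coeff (to10 \<delta> K P) j) (K + \<delta> * j - i) = coeff (coeff P j) i"
  unfolding to10_def
proof (rule coeff_remonom[where f = "\<lambda>j. j"])
  fix i' j' assume "coeff (coeff P j') i' \<noteq> 0" "j' = j" "K + \<delta> * j' - i' = K + \<delta> * j - i"
  then show "i' = i \<and> j' = j"
    using assms by (metis weight_le_def diff_diff_cancel)
qed

lemma coeff_to11:
  assumes "weight_le \<delta> K P" "i \<le> K + \<delta> * j" "degree P \<le> n" "j \<le> n"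
  shows "coeff (coeff (to11 \<delta> K n P) (n - j)) (K + \<delta> * j - i) = coeff (coeff P j) i"
  unfolding to11_def
proof (rule coeff_remonom[where f = "\<lambda>j. n - j"])
  fix i' j' assume *: "coeff (coeff P j') i' \<noteq> 0" "n - j' = n - j" "K + \<delta> * j' - i' = K + \<delta> * j - i"
  then have "j' \<le> n"
    using assms(3) by (metis coeff_0 le_degree order_trans)
  then have "j' = j"
    using * assms(4) by simp
  then show "i' = i \<and> j' = j"
    using * assms by (metis weight_le_def diff_diff_cancel)
qed

lemma weight_le_exists: "\<exists>K. weight_le \<delta> K P"
proof
  show "weight_le \<delta> (\<Sum>j\<le>degree P. degree (coeff P j)) P"
    unfolding weight_le_def
  proof (intro allI impI)
    fix i j assume *: "coeff (coeff P j) i \<noteq> 0"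
    then have "j \<le> degree P"
      by (metis coeff_0 le_degree)
    then have "degree (coeff P j) \<le> (\<Sum>j\<le>degree P. degree (coeff P j))"
      by (intro member_le_sum) auto
    with * show "i \<le> (\<Sum>j\<le>degree P. degree (coeff P j)) + \<delta> * j"
      by (meson le_degree order_trans trans_le_add1)
  qed
qed

section \<open>Chart changes on rational functions\<close>

abbreviation (input) \<s> :: birat where "\<s> \<equiv> to_fract var1"
abbreviation (input) \<t> :: birat where "\<t> \<equiv> to_fract var2"
abbreviation rsubst :: "bipoly \<Rightarrow> birat \<Rightarrow> birat \<Rightarrow> birat" where
  "rsubst \<equiv> subst2 (\<lambda>c. to_fract (const2 c))"

lemma rsubst_vars: "rsubst P (to_fract var1) (to_fract var2) = to_fract P"
proof -
  have "to_fract (subst2 const2 P var1 var2) = rsubst P (to_fract var1) (to_fract var2)"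
    by (rule subst2_comp[OF complex_hom_const2]) (unfold_locales, auto)
  then show ?thesis by simp
qed

lemma to_fract_to10:
  assumes "weight_le \<delta> K P"
  shows "to_fract (to10 \<delta> K P) = \<s> ^ K * rsubst P (1 / \<s>) (\<s> ^ \<delta> * \<t>)"
  using subst2_to10[OF complex_hom_to_fract_const2 assms, of \<s> \<t>] by (simp add: rsubst_vars)

lemma to_fract_to11:
  assumes "weight_le \<delta> K P" "degree P \<le> n"
  shows "to_fract (to11 \<delta> K n P) = \<s> ^ K * \<t> ^ n * rsubst P (1 / \<s>) (\<s> ^ \<delta> / \<t>)"
  using subst2_to11[OF complex_hom_to_fract_const2 assms, of \<s> \<t>] by (simp add: rsubst_vars)

lemma bipoly_nonzero_coeff: "P \<noteq> (0::bipoly) \<Longrightarrow> \<exists>i j. coeff (coeff P j) i \<noteq> 0"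
  by (metis leading_coeff_0_iff)

text \<open>After clearing denominators the distinct monomials of \<open>P\<close> stay distinct, so
  all coefficients of \<open>P\<close> can still be read off.\<close>

lemma rsubst_U10_inj:
  assumes "P \<noteq> 0"
  shows "rsubst P (1 / \<s>) (\<s> ^ \<delta> * \<t>) \<noteq> 0"
proof
  assume *: "rsubst P (1 / \<s>) (\<s> ^ \<delta> * \<t>) = 0"
  obtain K where K: "weight_le \<delta> K P"
    using weight_le_exists by blast
  obtain i j where ij: "coeff (coeff P j) i \<noteq> 0"
    using assms bipoly_nonzero_coeff by blast
  have "to10 \<delta> K P = 0"
    using to_fract_to10[OF K] * by simp
  then show False
    using coeff_to10[OF K, of i j] K ij by (simp add: weight_le_def)
qed

lemma rsubst_U11_inj:
  assumes "P \<noteq> 0"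
  shows "rsubst P (1 / \<s>) (\<s> ^ \<delta> / \<t>) \<noteq> 0"
proof
  assume *: "rsubst P (1 / \<s>) (\<s> ^ \<delta> / \<t>) = 0"
  obtain K where K: "weight_le \<delta> K P"
    using weight_le_exists by blast
  obtain i j where ij: "coeff (coeff P j) i \<noteq> 0"
    using assms bipoly_nonzero_coeff by blast
  then have "j \<le> degree P"
    by (metis coeff_0 le_degree)
  have "to11 \<delta> K (degree P) P = 0"
    using to_fract_to11[OF K order_refl] * by simp
  then show False
    using coeff_to11[OF K, of i j "degree P"] K ij \<open>j \<le> degree P\<close> by (simp add: weight_le_def)
qed

lemma (in derivation) d_prod_power_const:
  assumes "d x = 0"
  shows "d (x ^ n) = 0"
  by (induction n) (simp_all add: d_mult assms)

lemma derivation_divide_1: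
  fixes x :: "'a::field"
  assumes "derivation \<iota> d" "x \<noteq> 0"
  shows "d (1 / x) = - d x / x\<^sup>2"
proof -
  interpret derivation \<iota> d by fact
  have "d (x * (1 / x)) = 0"
    using assms by simp
  then have "x * d (1 / x) + d x / x = 0"
    unfolding d_mult by simp
  then have "x * d (1 / x) = - d x / x"
    by (simp add: eq_neg_iff_add_eq_0)
  then have "x * (x * d (1 / x)) = - d x"
    using assms(2) by simp
  then show ?thesis
    using assms(2) by (simp add: field_simps power2_eq_square)
qed

text \<open>The Jacobian matrix of the chart change is triangular: \<open>u\<close> depends on
  \<open>s\<close> only, and the derivatives of \<open>u\<close> by \<open>s\<close> and of
  \<open>v\<close> by \<open>t\<close> are nonzero. If the pulled-back form vanished, its second
  component would give \<open>a = 0\<close> and then its first one \<open>b = 0\<close>. A nonzero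
  form has a coprime multiple.\<close>

lemma exists_extension_form:
  assumes "coprime a b" and c: "c = U10 \<or> c = U11"
  shows "\<exists>\<omega>. extension_form \<delta> (a, b) c \<omega>"
proof -
  note d1 = derivation_fract_deriv[OF derivation_D1] and d2 = derivation_fract_deriv[OF derivation_D2]
  let ?d1 = "fract_deriv D1" and ?d2 = "fract_deriv D2"
  have ds: "?d1 \<s> = 1" "?d1 \<t> = 0" "?d2 \<s> = 0" "?d2 \<t> = 1"
    using fract_deriv_to_fract[OF derivation_D1, of var1] fract_deriv_to_fract[OF derivation_D1, of var2]
      fract_deriv_to_fract[OF derivation_D2, of var1] fract_deriv_to_fract[OF derivation_D2, of var2]
    by simp_all
  have nz: "\<s> \<noteq> 0" "\<t> \<noteq> 0"
    by simp_all
  obtain u v where uv: "chart_change \<delta> c = (u, v)" by force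
  obtain F G where FG: "rat_pullback (u, v) (form_of_field (a, b)) = (F, G)" by force
  have u: "u = 1 / \<s>"
    using uv c by auto
  have v: "v = \<s> ^ \<delta> * \<t> \<and> c = U10 \<or> v = \<s> ^ \<delta> / \<t> \<and> c = U11"
    using uv c by auto
  have du: "?d1 u \<noteq> 0" "?d2 u = 0"
    unfolding u using derivation_divide_1[OF d1 nz(1)] derivation_divide_1[OF d2 nz(1)] nz ds by simp_all
  have d2_pow: "?d2 (\<s> ^ \<delta>) = 0"
    using derivation.d_prod_power_const[OF d2 ds(3)] .
  have dv: "?d2 v \<noteq> 0"
  proof (cases "c = U10")
    case True
    then have "v = \<s> ^ \<delta> * \<t>"
      using v by simp
    then show ?thesis
      using nz by (simp add: derivation.d_mult[OF d2] d2_pow ds)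
  next
    case False
    then have "v = \<s> ^ \<delta> * (1 / \<t>)"
      using v by simp
    then have "?d2 v = \<s> ^ \<delta> * (- 1 / \<t>\<^sup>2)"
      by (simp only: derivation.d_mult[OF d2] d2_pow derivation_divide_1[OF d2 nz(2)] ds mult_zero_right add_0_right)
    then show ?thesis
      using nz by simp
  qed
  have inj: "P \<noteq> 0 \<Longrightarrow> rsubst P u v \<noteq> 0" for P
    using v rsubst_U10_inj rsubst_U11_inj unfolding u by auto
  have "F \<noteq> 0 \<or> G \<noteq> 0"
  proof (rule ccontr)
    assume "\<not> ?thesis"
    then have 0: "F = 0" "G = 0"
      by auto
    have "rsubst (- a) u v * ?d2 v = 0"
      using FG 0(2) du(2) by (simp add: pullback_def form_of_field_def Let_def)
    then have "rsubst (- a) u v = 0"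
      using dv by simp
    then have "a = 0"
      using inj[of "- a"] by auto
    then have "rsubst b u v * ?d1 u = 0"
      using FG 0(1) complex_hom.subst2_0[OF complex_hom_to_fract_const2]
      by (simp add: pullback_def form_of_field_def Let_def)
    then have "b = 0"
      using du(1) inj[of b] by auto
    with \<open>a = 0\<close> assms(1) show False
      by simp
  qed
  then obtain g p q where "g \<noteq> 0" "coprime p q" "to_fract p = g * F" "to_fract q = g * G"
    using exists_coprime_multiple by blast
  then have "extension_form \<delta> (a, b) c (p, q)"
    by (auto simp: extension_form_def uv FG)
  then show ?thesis ..
qed

section \<open>No common arcs at infinity\<close>

lemma poly_const_fps_nonzero:
  fixes p :: "complex poly"
  assumes "p \<noteq> 0" "fps_nth y 0 = 0" "y \<noteq> 0"
  shows "poly (map_poly fps_const p) y \<noteq> 0"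
  using assms(1)
proof (induction p)
  case (pCons c p)
  interpret complex_hom fps_const
    by (rule complex_hom_fps_const)
  have e: "poly (map_poly fps_const (pCons c p)) y = fps_const c + y * poly (map_poly fps_const p) y"
    by (simp add: map_poly_pCons_hom)
  show ?case
  proof (cases "c = 0")
    case True
    then show ?thesis
      using pCons assms(3) e by auto
  next
    case False
    have "fps_nth (poly (map_poly fps_const (pCons c p)) y) 0 = c"
      using assms(2) by (simp add: e)
    with False show ?thesis
      by (metis fps_zero_nth)
  qed
qed simp

lemma along_0_left: "along P 0 y = poly (map_poly fps_const (map_poly (\<lambda>c. coeff c 0) P)) y"
proof -
  have "map_poly (\<lambda>c. poly (map_poly fps_const c) 0) P = map_poly fps_const (map_poly (\<lambda>c. coeff c 0) P)"
    by (rule poly_eqI) (simp add: coeff_map_poly poly_0_coeff_0)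
  then show ?thesis
    by (simp add: subst2_def)
qed

lemma along_0_right: "along P x 0 = poly (map_poly fps_const (coeff P 0)) x"
  by (simp add: subst2_def poly_0_coeff_0 coeff_map_poly)

lemma along_0_left_nonzero:
  assumes "coeff (coeff P j) 0 \<noteq> 0" "fps_nth y 0 = 0" "y \<noteq> 0"
  shows "along P 0 y \<noteq> 0"
  unfolding along_0_left
proof (rule poly_const_fps_nonzero)
  have "coeff (map_poly (\<lambda>c. coeff c 0) P) j \<noteq> 0"
    using assms(1) by (simp add: coeff_map_poly)
  then show "map_poly (\<lambda>c. coeff c 0) P \<noteq> 0"
    by auto
qed (use assms in auto)

lemma along_0_right_nonzero:
  assumes "coeff (coeff P 0) i \<noteq> 0" "fps_nth x 0 = 0" "x \<noteq> 0"
  shows "along P x 0 \<noteq> 0"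
  unfolding along_0_right by (rule poly_const_fps_nonzero) (use assms in auto)

text \<open>A common zero would be a zero of the eliminant \<open>R\<close>, which involves only the
  first variable, at \<open>1 / x\<close>. Reversing the coefficients of \<open>R\<close> makes
  \<open>x\<close> a root of a nonzero polynomial with constant coefficients, contrary to
  \<open>poly_const_fps_nonzero\<close>.\<close>

lemma coprime_no_common_zero_at_infinity:
  assumes "coprime A B" "fps_nth x 0 = 0" "x \<noteq> 0"
  shows "subst2 (\<lambda>c. to_fract (fps_const c)) A (1 / to_fract x) v \<noteq> 0 \<or>
         subst2 (\<lambda>c. to_fract (fps_const c)) B (1 / to_fract x) v \<noteq> 0"
proof (rule ccontr)
  let ?i = "\<lambda>c. to_fract (fps_const c)"
  interpret h: complex_hom ?i
    by (rule complex_hom_to_fract_fps)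
  assume "\<not> ?thesis"
  then have 0: "subst2 ?i A (1 / to_fract x) v = 0" "subst2 ?i B (1 / to_fract x) v = 0"
    by auto
  obtain U V R where R: "U * A + V * B = [:R:]" "R \<noteq> 0"
    using coprime_imp_eliminant[OF assms(1)] by blast
  have "subst2 ?i [:R:] (1 / to_fract x) v = 0"
    unfolding R(1)[symmetric] h.subst2_simps 0 by simp
  then have "poly (map_poly ?i R) (inverse (to_fract x)) = 0"
    by (simp add: h.subst2_pCons inverse_eq_divide)
  then have "poly (reflect_poly (map_poly ?i R)) (to_fract x) = 0"
    using poly_reflect_poly_nz[of "to_fract x" "map_poly ?i R"] assms(3) by simp
  moreover have "reflect_poly (map_poly ?i R) = map_poly to_fract (map_poly fps_const (reflect_poly R))"
  proof (rule poly_eqI)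
    have "degree (map_poly ?i R) = degree R"
      by (rule degree_map_poly) simp
    then show "coeff (reflect_poly (map_poly ?i R)) k = coeff (map_poly to_fract (map_poly fps_const (reflect_poly R))) k" for k
      by (simp add: coeff_reflect_poly coeff_map_poly)
  qed
  moreover have "poly (map_poly to_fract p) (to_fract x) = to_fract (poly p x)" for p :: "complex fps poly"
    by (induction p) (simp_all add: map_poly_pCons)
  ultimately have "poly (map_poly fps_const (reflect_poly R)) x = 0"
    by simp
  moreover have "reflect_poly R \<noteq> 0"
    using R(2) by (metis reflect_poly_0 reflect_poly_eq_0_iff)
  ultimately show False
    using poly_const_fps_nonzero assms(2,3) by blast
qed

lemma to_fract_along: "to_fract (along P x y) = subst2 (\<lambda>c. to_fract (fps_const c)) P (to_fract x) (to_fract y)"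
  by (rule subst2_comp[OF complex_hom_fps_const]) (unfold_locales, auto)

text \<open>Arcs with \<open>x \<noteq> 0\<close> leave the curve at infinity and are handled by
  coprimality. The curve \<open>s = 0\<close> itself is no common component because by
  \<open>ij\<close> the bound \<open>K\<close> is attained by a monomial.\<close>

lemma isolated_base_to10:
  assumes "coprime A B" and A: "weight_le \<delta> K A" and B: "weight_le \<delta> K B"
    and ij: "coeff (coeff A j) (K + \<delta> * j) \<noteq> 0 \<or> coeff (coeff B j) (K + \<delta> * j) \<noteq> 0"
  shows "isolated_base (to10 \<delta> K A) (to10 \<delta> K B)"
  unfolding isolated_base_def
proof (intro allI impI)
  fix x y :: "complex fps" assume xy: "fps_nth x 0 = 0" "fps_nth y 0 = 0" "x \<noteq> 0 \<or> y \<noteq> 0"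
  show "along (to10 \<delta> K A) x y \<noteq> 0 \<or> along (to10 \<delta> K B) x y \<noteq> 0"
  proof (cases "x = 0")
    case True
    have "coeff (coeff (to10 \<delta> K A) j) 0 \<noteq> 0 \<or> coeff (coeff (to10 \<delta> K B) j) 0 \<noteq> 0"
      using ij coeff_to10[OF A, of "K + \<delta> * j" j] coeff_to10[OF B, of "K + \<delta> * j" j] by simp
    then show ?thesis
      using along_0_left_nonzero xy True by blast
  next
    case False
    then have x: "to_fract x \<noteq> 0"
      by simp
    have "to_fract (along (to10 \<delta> K A) x y) \<noteq> 0 \<or> to_fract (along (to10 \<delta> K B) x y) \<noteq> 0"
      unfolding to_fract_along subst2_to10[OF complex_hom_to_fract_fps A x] subst2_to10[OF complex_hom_to_fract_fps B x]
      using coprime_no_common_zero_at_infinity[OF assms(1) xy(1) False] x by simp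
    then show ?thesis
      by simp
  qed
qed

text \<open>Here both axes need separate care. The axis \<open>s = 0\<close> is excluded because
  \<open>K\<close> is attained by a pure power of \<open>x\<close>, and the axis
  \<open>t = 0\<close> because \<open>n\<close> is exactly the larger degree in \<open>y\<close>;
  other arcs are handled by coprimality.\<close>

lemma isolated_base_to11:
  assumes "coprime A B" and A: "weight_le \<delta> K A" and B: "weight_le \<delta> K B"
    and n: "n = max (degree A) (degree B)"
    and a0: "coeff (coeff A 0) K \<noteq> 0 \<or> coeff (coeff B 0) K \<noteq> 0"
  shows "isolated_base (to11 \<delta> K n A) (to11 \<delta> K n B)"
  unfolding isolated_base_def
proof (intro allI impI)
  have nA: "degree A \<le> n" and nB: "degree B \<le> n"
    by (simp_all add: n)
  fix x y :: "complex fps" assume xy: "fps_nth x 0 = 0" "fps_nth y 0 = 0" "x \<noteq> 0 \<or> y \<noteq> 0"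
  show "along (to11 \<delta> K n A) x y \<noteq> 0 \<or> along (to11 \<delta> K n B) x y \<noteq> 0"
  proof (cases "x = 0")
    case True
    have "coeff (coeff (to11 \<delta> K n A) n) 0 \<noteq> 0 \<or> coeff (coeff (to11 \<delta> K n B) n) 0 \<noteq> 0"
      using a0 coeff_to11[OF A, of K 0 n] coeff_to11[OF B, of K 0 n] nA nB by simp
    then show ?thesis
      using along_0_left_nonzero xy True by blast
  next
    case x0: False
    then have x: "to_fract x \<noteq> 0"
      by simp
    show ?thesis
    proof (cases "y = 0")
      case True
      have AB: "A \<noteq> 0 \<or> B \<noteq> 0"
        using a0 by auto
      have "coeff A n \<noteq> 0 \<or> coeff B n \<noteq> 0"
      proof (cases "degree B \<le> degree A \<and> A \<noteq> 0")
        case True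
        then have "n = degree A" "coeff A (degree A) \<noteq> 0"
          by (simp_all add: n)
        then show ?thesis
          by simp
      next
        case False
        then have "B \<noteq> 0 \<and> degree A \<le> degree B"
          using AB by auto
        then show ?thesis
          by (simp add: n max_def)
      qed
      then obtain i where i: "coeff (coeff A n) i \<noteq> 0 \<or> coeff (coeff B n) i \<noteq> 0"
        by (metis leading_coeff_0_iff)
      then have "i \<le> K + \<delta> * n"
        using A B by (auto simp: weight_le_def)
      then have "coeff (coeff (to11 \<delta> K n A) 0) (K + \<delta> * n - i) \<noteq> 0 \<or>
          coeff (coeff (to11 \<delta> K n B) 0) (K + \<delta> * n - i) \<noteq> 0"
        using i coeff_to11[OF A, of i n n] coeff_to11[OF B, of i n n] nA nB by simp
      then show ?thesis
        using along_0_right_nonzero xy x0 True by blast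
    next
      case False
      then have y: "to_fract y \<noteq> 0"
        by simp
      have "to_fract (along (to11 \<delta> K n A) x y) \<noteq> 0 \<or> to_fract (along (to11 \<delta> K n B) x y) \<noteq> 0"
        unfolding to_fract_along subst2_to11[OF complex_hom_to_fract_fps A nA x y]
          subst2_to11[OF complex_hom_to_fract_fps B nB x y]
        using coprime_no_common_zero_at_infinity[OF assms(1) xy(1) x0] x y by simp
      then show ?thesis
        by simp
    qed
  qed
qed

section \<open>The curve at infinity\<close>

lemma wronskian_zero_imp_multiple:
  fixes P Q :: "'a::field_char_0 poly"
  assumes "Q * pderiv P = P * pderiv Q" "Q \<noteq> 0"
  shows "\<exists>k. P = Polynomial.smult k Q"
proof -
  define k where "k = coeff P (degree Q) / lead_coeff Q"
  define R where "R = P - Polynomial.smult k Q"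
  have "Q * pderiv R = R * pderiv Q"
    using assms(1) by (simp add: R_def pderiv_diff pderiv_smult algebra_simps)
  moreover have "coeff R (degree Q) = 0"
    using assms(2) by (simp add: R_def k_def)
  ultimately have "R = 0"
    using wronskian_zero_imp_degree_eq[of Q R] assms(2) by (metis leading_coeff_0_iff)
  then show ?thesis
    by (auto simp: R_def)
qed

lemma indepI:
  assumes "B \<noteq> 0" "\<And>k. A \<noteq> const2 k * B"
  shows "indep A B"
  unfolding indep_def
proof (intro allI impI)
  fix c d assume *: "const2 c * A + const2 d * B = 0"
  have "c = 0"
  proof (rule ccontr)
    assume "c \<noteq> 0"
    then have "A = const2 (1 / c) * (const2 c * A)"
      by (simp flip: one_pCons)
    also have "const2 c * A = - (const2 d * B)"
      using * by (simp add: eq_neg_iff_add_eq_0)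
    also have "const2 (1 / c) * - (const2 d * B) = const2 (- d / c) * B"
      by (simp flip: smult_minus_left)
    finally have "A = const2 (- d / c) * B" .
    with assms(2) show False ..
  qed
  with * assms(1) show "c = 0 \<and> d = 0"
    by simp
qed

text \<open>If \<open>A\<close> and \<open>B\<close> depend on \<open>x\<close> only, the relation
  reduces to \<open>a\<close> times their Wronskian in \<open>x\<close>, which is nonzero because
  \<open>A / B\<close> is not constant. So \<open>a = 0\<close>, and coprimality makes
  \<open>b\<close> a nonzero constant: a multiple of the vertical field.\<close>

lemma first_int_degree_pos:
  assumes fi: "first_int (form_of_field (a, b)) A B" and "coprime a b"
    and "\<nexists>c. c \<noteq> 0 \<and> (a, b) = (0, const2 c)"
    and "B \<noteq> 0" and nc: "\<And>k. A \<noteq> const2 k * B"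
  shows "degree A > 0 \<or> degree B > 0"
proof (rule ccontr)
  assume "\<not> ?thesis"
  then obtain A0 B0 where AB: "A = [:A0:]" "B = [:B0:]"
    by (metis degree_eq_zeroE neq0_conv)
  have "b * (B * D2 A - A * D2 B) + a * (B * D1 A - A * D1 B) = 0"
    using fi by (simp add: first_int_def form_of_field_def)
  then have "a * (B * D1 A - A * D1 B) = 0"
    by (simp add: AB)
  moreover have "B * D1 A - A * D1 B \<noteq> 0"
  proof
    assume "B * D1 A - A * D1 B = 0"
    moreover have "D1 [:p:] = [:pderiv p:]" for p
      by (rule poly_eqI) (simp add: D1_def coeff_map_poly coeff_pCons split: nat.split)
    ultimately have "B0 * pderiv A0 = A0 * pderiv B0"
      by (simp add: AB mult.commute)
    then obtain k where "A0 = Polynomial.smult k B0"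
      using wronskian_zero_imp_multiple[of B0 A0] \<open>B \<noteq> 0\<close> AB by auto
    then have "A = const2 k * B"
      by (simp add: AB)
    with nc show False ..
  qed
  ultimately have "a = 0"
    by simp
  then have "is_unit b"
    using \<open>coprime a b\<close> by simp
  then obtain p where p: "b = [:p:]" "is_unit p"
    by (auto simp: is_unit_poly_iff)
  then obtain c where "p = [:c:]" "c \<noteq> 0"
    by (auto simp: is_unit_iff_degree elim: degree_eq_zeroE)
  with assms(3) p \<open>a = 0\<close> show False
    by auto
qed

section \<open>The pencil in the charts along the curve at infinity\<close>

lemma extension_U10:
  assumes "extension_form \<delta> X U10 \<omega>" and fi: "first_int (form_of_field X) A B"
    and "weight_le \<delta> K A" "weight_le \<delta> K B"
  shows "first_int \<omega> (to10 \<delta> K A) (to10 \<delta> K B)"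
  by (rule extension_form_first_int[OF assms(1) fi, where m = "to_fract var1 ^ K"])
     (simp_all add: to_fract_to10 assms)

lemma extension_U11:
  assumes "extension_form \<delta> X U11 \<omega>" and fi: "first_int (form_of_field X) A B"
    and "weight_le \<delta> K A" "weight_le \<delta> K B" "degree A \<le> n" "degree B \<le> n"
  shows "first_int \<omega> (to11 \<delta> K n A) (to11 \<delta> K n B)"
  by (rule extension_form_first_int[OF assms(1) fi, where m = "to_fract var1 ^ K * to_fract var2 ^ n"])
     (simp_all add: to_fract_to11 assms)

lemma indep_to10:
  assumes "indep A B" "weight_le \<delta> K A" "weight_le \<delta> K B"
  shows "indep (to10 \<delta> K A) (to10 \<delta> K B)"
  unfolding indep_def
proof (intro allI impI)
  fix c d assume "const2 c * to10 \<delta> K A + const2 d * to10 \<delta> K B = 0"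
  then have "to_fract (const2 c * to10 \<delta> K A + const2 d * to10 \<delta> K B) = 0"
    by simp
  then have "to_fract var1 ^ K * (to_fract (const2 c) * rsubst A (1 / to_fract var1) (to_fract var1 ^ \<delta> * to_fract var2) +
      to_fract (const2 d) * rsubst B (1 / to_fract var1) (to_fract var1 ^ \<delta> * to_fract var2)) = 0"
    unfolding to_fract_add to_fract_mult to_fract_to10[OF assms(2)] to_fract_to10[OF assms(3)]
    by (simp only: algebra_simps)
  then have "rsubst (const2 c * A + const2 d * B) (1 / to_fract var1) (to_fract var1 ^ \<delta> * to_fract var2) = 0"
    unfolding complex_hom.subst2_simps[OF complex_hom_to_fract_const2] complex_hom.subst2_const2[OF complex_hom_to_fract_const2]
    by simp
  then show "c = 0 \<and> d = 0"
    using assms(1) rsubst_U10_inj unfolding indep_def by blast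
qed

lemma indep_to11:
  assumes "indep A B" "weight_le \<delta> K A" "weight_le \<delta> K B" "degree A \<le> n" "degree B \<le> n"
  shows "indep (to11 \<delta> K n A) (to11 \<delta> K n B)"
  unfolding indep_def
proof (intro allI impI)
  fix c d assume "const2 c * to11 \<delta> K n A + const2 d * to11 \<delta> K n B = 0"
  then have "to_fract (const2 c * to11 \<delta> K n A + const2 d * to11 \<delta> K n B) = 0"
    by simp
  then have "to_fract var1 ^ K * to_fract var2 ^ n * (to_fract (const2 c) * rsubst A (1 / to_fract var1) (to_fract var1 ^ \<delta> / to_fract var2) +
      to_fract (const2 d) * rsubst B (1 / to_fract var1) (to_fract var1 ^ \<delta> / to_fract var2)) = 0"
    unfolding to_fract_add to_fract_mult to_fract_to11[OF assms(2,4)] to_fract_to11[OF assms(3,5)]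
    by (simp only: algebra_simps)
  then have "rsubst (const2 c * A + const2 d * B) (1 / to_fract var1) (to_fract var1 ^ \<delta> / to_fract var2) = 0"
    unfolding complex_hom.subst2_simps[OF complex_hom_to_fract_const2] complex_hom.subst2_const2[OF complex_hom_to_fract_const2]
    by simp
  then show "c = 0 \<and> d = 0"
    using assms(1) rsubst_U11_inj unfolding indep_def by blast
qed

text \<open>Among the monomials allowed by the weight bound only \<open>x^K\<close> contributes to
  the value at the origin, so the hypotheses \<open>0\<close> make it a base point;
  \<open>ij\<close> says that \<open>K\<close> is the exact pole order.\<close>

lemma U10_origin_dicritical:
  assumes ext: "extension_form \<delta> X U10 \<omega>" and fi: "first_int (form_of_field X) A B"
    and "coprime A B" and AK: "weight_le \<delta> K A" and BK: "weight_le \<delta> K B"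
    and ij: "coeff (coeff A j) (K + \<delta> * j) \<noteq> 0 \<or> coeff (coeff B j) (K + \<delta> * j) \<noteq> 0"
    and 0: "coeff (coeff A 0) K = 0" "coeff (coeff B 0) K = 0"
  shows "dicritical_form_at \<omega> (0, 0)"
  unfolding dicritical_form_at_0
proof (rule base_point_dicritical)
  show "first_int \<omega> (to10 \<delta> K A) (to10 \<delta> K B)"
    by (rule extension_U10[OF ext fi AK BK])
  show "isolated_base (to10 \<delta> K A) (to10 \<delta> K B)"
    by (rule isolated_base_to10[OF assms(3) AK BK ij])
  show "at_origin (to10 \<delta> K A) = 0" "at_origin (to10 \<delta> K B) = 0"
    using coeff_to10[OF AK, of K 0] coeff_to10[OF BK, of K 0] 0 by (simp_all add: at_origin_def)
qed (rule extension_form_nonzero[OF ext])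

lemma U10_origin_not_dicritical:
  assumes ext: "extension_form \<delta> X U10 \<omega>" and fi: "first_int (form_of_field X) A B"
    and "indep A B" and AK: "weight_le \<delta> K A" and BK: "weight_le \<delta> K B"
    and "coeff (coeff A 0) K \<noteq> 0 \<or> coeff (coeff B 0) K \<noteq> 0"
  shows "\<not> dicritical_form_at \<omega> (0, 0)"
proof (rule nonbase_not_dicritical_at)
  show "first_int \<omega> (to10 \<delta> K A) (to10 \<delta> K B)"
    by (rule extension_U10[OF ext fi AK BK])
  show "indep (to10 \<delta> K A) (to10 \<delta> K B)"
    by (rule indep_to10[OF assms(3) AK BK])
  show "subst2 (\<lambda>c. c) (to10 \<delta> K A) 0 0 \<noteq> 0 \<or> subst2 (\<lambda>c. c) (to10 \<delta> K B) 0 0 \<noteq> 0"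
    using coeff_to10[OF AK, of K 0] coeff_to10[OF BK, of K 0] assms(6)
    by (simp add: at_origin_subst2 at_origin_def)
qed (rule extension_form_nonzero[OF ext])

text \<open>The strict inequality for \<open>j > 0\<close> leaves \<open>x^K\<close> as the only
  monomial that survives on \<open>s = 0\<close>; both members of the pencil thus restrict to
  multiples of a single function.\<close>

definition weight_less :: "nat \<Rightarrow> nat \<Rightarrow> bipoly \<Rightarrow> bool" where
  "weight_less \<delta> K P \<longleftrightarrow> weight_le \<delta> K P \<and>
     (\<forall>i j. coeff (coeff P j) i \<noteq> 0 \<longrightarrow> j > 0 \<longrightarrow> i < K + \<delta> * j)"

lemma weight_less_subst:
  assumes "weight_less \<delta> K P"
  shows "subst2 (\<lambda>c. c) (to10 \<delta> K P) 0 t = coeff (coeff P 0) K"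
    "subst2 (\<lambda>c. c) (to11 \<delta> K n P) 0 t = coeff (coeff P 0) K * t ^ n"
proof -
  have *: "i = K \<and> j = 0" if "coeff (coeff P j) i \<noteq> 0" "K + \<delta> * j - i = 0" for i j
  proof -
    have "i \<le> K + \<delta> * j" "j > 0 \<Longrightarrow> i < K + \<delta> * j"
      using that(1) assms unfolding weight_less_def weight_le_def by blast+
    then show ?thesis
      using that(2) by (cases "j = 0") auto
  qed
  show "subst2 (\<lambda>c. c) (to10 \<delta> K P) 0 t = coeff (coeff P 0) K"
    unfolding to10_def by (subst subst2_remonom_0[of P _ K 0]) (use * in auto)
  show "subst2 (\<lambda>c. c) (to11 \<delta> K n P) 0 t = coeff (coeff P 0) K * t ^ n"
    unfolding to11_def by (subst subst2_remonom_0[of P _ K 0]) (use * in auto)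
qed

lemma U10_not_dicritical:
  assumes ext: "extension_form \<delta> X U10 \<omega>" and fi: "first_int (form_of_field X) A B"
    and "indep A B" and AK: "weight_less \<delta> K A" and BK: "weight_less \<delta> K B"
    and "coeff (coeff A 0) K \<noteq> 0 \<or> coeff (coeff B 0) K \<noteq> 0"
  shows "\<not> dicritical_form_at \<omega> (0, t)"
proof (rule nonbase_not_dicritical_at)
  show "first_int \<omega> (to10 \<delta> K A) (to10 \<delta> K B)"
    by (rule extension_U10[OF ext fi]) (use AK BK in \<open>auto simp: weight_less_def\<close>)
  show "indep (to10 \<delta> K A) (to10 \<delta> K B)"
    by (rule indep_to10[OF assms(3)]) (use AK BK in \<open>auto simp: weight_less_def\<close>)
  show "subst2 (\<lambda>c. c) (to10 \<delta> K A) 0 t \<noteq> 0 \<or> subst2 (\<lambda>c. c) (to10 \<delta> K B) 0 t \<noteq> 0"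
    using assms(6) by (simp add: weight_less_subst AK BK)
qed (rule extension_form_nonzero[OF ext])

lemma U11_not_dicritical:
  assumes ext: "extension_form \<delta> X U11 \<omega>" and fi: "first_int (form_of_field X) A B"
    and "indep A B" and AK: "weight_less \<delta> K A" and BK: "weight_less \<delta> K B"
    and "coeff (coeff A 0) K \<noteq> 0 \<or> coeff (coeff B 0) K \<noteq> 0" and "t \<noteq> 0"
  shows "\<not> dicritical_form_at \<omega> (0, t)"
proof -
  define n where "n = max (degree A) (degree B)"
  have n: "degree A \<le> n" "degree B \<le> n"
    by (simp_all add: n_def)
  show ?thesis
  proof (rule nonbase_not_dicritical_at)
    show "first_int \<omega> (to11 \<delta> K n A) (to11 \<delta> K n B)"
      by (rule extension_U11[OF ext fi _ _ n]) (use AK BK in \<open>auto simp: weight_less_def\<close>)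
    show "indep (to11 \<delta> K n A) (to11 \<delta> K n B)"
      by (rule indep_to11[OF assms(3) _ _ n]) (use AK BK in \<open>auto simp: weight_less_def\<close>)
    show "subst2 (\<lambda>c. c) (to11 \<delta> K n A) 0 t \<noteq> 0 \<or> subst2 (\<lambda>c. c) (to11 \<delta> K n B) 0 t \<noteq> 0"
      using assms(6,7) by (simp add: weight_less_subst AK BK)
  qed (rule extension_form_nonzero[OF ext])
qed

text \<open>Both members restrict to multiples of \<open>t ^ n\<close> on \<open>s = 0\<close>, and
  \<open>n > 0\<close> by \<open>deg\<close>, so the origin is a base point. Taking \<open>n\<close>
  as the exact maximum of the two degrees keeps \<open>t\<close> from being a common factor.\<close>

lemma U11_origin_dicritical:
  assumes ext: "extension_form \<delta> X U11 \<omega>" and fi: "first_int (form_of_field X) A B"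
    and "coprime A B" and AK: "weight_less \<delta> K A" and BK: "weight_less \<delta> K B"
    and a0: "coeff (coeff A 0) K \<noteq> 0 \<or> coeff (coeff B 0) K \<noteq> 0"
    and deg: "degree A > 0 \<or> degree B > 0"
  shows "dicritical_form_at \<omega> (0, 0)"
  unfolding dicritical_form_at_0
proof -
  define n where "n = max (degree A) (degree B)"
  have n: "degree A \<le> n" "degree B \<le> n" "n > 0"
    using deg by (auto simp: n_def)
  have K: "weight_le \<delta> K A" "weight_le \<delta> K B"
    using AK BK by (auto simp: weight_less_def)
  show "dicritical_form \<omega>"
  proof (rule base_point_dicritical)
    show "first_int \<omega> (to11 \<delta> K n A) (to11 \<delta> K n B)"
      by (rule extension_U11[OF ext fi K n(1,2)])
    show "isolated_base (to11 \<delta> K n A) (to11 \<delta> K n B)"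
      by (rule isolated_base_to11[OF assms(3) K n_def a0])
    show "at_origin (to11 \<delta> K n A) = 0" "at_origin (to11 \<delta> K n B) = 0"
      using weight_less_subst(2)[OF AK, of n 0] weight_less_subst(2)[OF BK, of n 0] n(3)
      by (simp_all add: at_origin_subst2)
  qed (rule extension_form_nonzero[OF ext])
qed

section \<open>Points on the curve at infinity\<close>

lemma hpoint_in_hirzebruch: "h \<in> hirz_coords \<Longrightarrow> hpoint \<delta> h \<in> hirzebruch \<delta>"
  unfolding hpoint_def hirzebruch_def by (rule quotientI)

lemma mem_hpoint: "h \<in> hirz_coords \<Longrightarrow> h \<in> hpoint \<delta> h"
  using equiv_class_self[OF equiv_hirz_rel] by (simp add: hpoint_def)

lemma hpoint_X0_zero:
  assumes "(x0, x1, y0, y1) \<in> hpoint \<delta> (0, X1, Y0, Y1)" "(0, X1, Y0, Y1) \<in> hirz_coords"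
  shows "x0 = 0" "x1 \<noteq> 0" "y0 = 0 \<longleftrightarrow> Y0 = 0" "y1 = 0 \<longleftrightarrow> Y1 = 0"
  using assms by (auto simp: hpoint_def hirz_rel_def hirz_coords_def)

lemma hpoint_0101:
  assumes "X1 \<noteq> 0" "Y1 \<noteq> 0"
  shows "hpoint \<delta> (0, X1, 0, Y1) = hpoint \<delta> (0, 1, 0, 1)"
proof -
  have "((0, 1, 0, 1), (0, X1, 0, Y1)) \<in> hirz_rel \<delta>"
  proof -
    \<comment> \<open>The coordinate \<open>X1\<close> dictates \<open>l = X1\<close>, and then
      \<open>inverse (l ^ \<delta>) * m = Y1\<close> dictates \<open>m\<close>.\<close>
    have "\<exists>l m. l \<noteq> 0 \<and> m \<noteq> 0 \<and> 0 = l * 0 \<and> X1 = l * 1 \<and> 0 = m * 0 \<and> Y1 = inverse (l ^ \<delta>) * m * 1"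
      by (rule exI[of _ X1], rule exI[of _ "X1 ^ \<delta> * Y1"]) (use assms in auto)
    then show ?thesis
      by (simp add: hirz_rel_def hirz_coords_def)
  qed
  then show ?thesis
    unfolding hpoint_def using equiv_class_eq[OF equiv_hirz_rel] by metis
qed

theorem theorem4p2:
  fixes a b :: "complex poly poly"
  assumes "coprime a b"
    and "algebraically_integrable (a, b)"
    and "\<not> (\<exists>c. c \<noteq> 0 \<and> (a, b) = (0, const2 c))"
  shows "\<exists>\<delta>\<^sub>1::nat.
    (\<forall>\<delta>>\<delta>\<^sub>1. {p \<in> X0_curve \<delta>. dicritical_singularity \<delta> (a, b) p} = {hpoint \<delta> (0, 1, 0, 1)}) \<and>
    (\<forall>\<delta><\<delta>\<^sub>1. dicritical_singularity \<delta> (a, b) (hpoint \<delta> (0, 1, 1, 0))) \<and>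
    \<not> dicritical_singularity \<delta>\<^sub>1 (a, b) (hpoint \<delta>\<^sub>1 (0, 1, 1, 0))"
proof -
  obtain A B where cop: "coprime A B" and B: "B \<noteq> 0" and fi: "first_int (form_of_field (a, b)) A B"
    and nc: "\<And>k. A \<noteq> const2 k * B"
    using algebraically_integrable_first_int[OF assms(2)] by metis
  have ind: "indep A B"
    using indepI B nc by blast
  have deg: "degree A > 0 \<or> degree B > 0"
    using first_int_degree_pos[OF fi assms(1,3) B nc] .
  define d where "d = max (degree (coeff A 0)) (degree (coeff B 0))"
  \<comment> \<open>Coprimality forbids \<open>y\<close> to divide both members, so \<open>d\<close>
    is the exponent of a pure power of \<open>x\<close> that really occurs.\<close>
  have "coeff A 0 \<noteq> 0 \<or> coeff B 0 \<noteq> 0"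
  proof (rule ccontr)
    assume "\<not> ?thesis"
    then have "var2 dvd A" "var2 dvd B"
      using dvd_iff_poly_eq_0[of 0] by (auto simp: poly_0_coeff_0)
    then have "is_unit var2"
      using cop coprime_common_divisor by blast
    then show False
      by (auto simp: is_unit_poly_iff)
  qed
  then have d: "coeff (coeff A 0) d \<noteq> 0 \<or> coeff (coeff B 0) d \<noteq> 0"
  proof (cases "degree (coeff B 0) \<le> degree (coeff A 0) \<and> coeff A 0 \<noteq> 0")
    case True
    then have "d = degree (coeff A 0)" "lead_coeff (coeff A 0) \<noteq> 0"
      by (simp_all add: d_def)
    then show ?thesis by simp
  next
    case False
    then have "d = degree (coeff B 0)" "lead_coeff (coeff B 0) \<noteq> 0"
      using \<open>coeff A 0 \<noteq> 0 \<or> coeff B 0 \<noteq> 0\<close> by (auto simp: d_def max_def)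
    then show ?thesis by simp
  qed
  \<comment> \<open>The condition says that no monomial has a higher pole along the curve at
    infinity than \<open>x^d\<close>.\<close>
  define C where "C \<delta> \<longleftrightarrow> weight_le \<delta> d A \<and> weight_le \<delta> d B" for \<delta>
  have C_ex: "\<exists>\<delta>. C \<delta>"
  proof -
    obtain k l where kl: "weight_le 0 k A" "weight_le 0 l B"
      using weight_le_exists by blast
    \<comment> \<open>For \<open>j > 0\<close> a value of \<delta> at least as large as every
      exponent of \<open>x\<close> works, and \<open>k + l\<close> is one, by the bounds of slope 0.
      For \<open>j = 0\<close> the maximality of \<open>d\<close> applies.\<close>
    have "i \<le> d + (k + l) * j" if "coeff (coeff A j) i \<noteq> 0 \<or> coeff (coeff B j) i \<noteq> 0" for i j
    proof (cases "j = 0")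
      case True
      then show ?thesis
        using that by (auto simp: d_def le_degree le_max_iff_disj)
    next
      case False
      have "i \<le> k + l"
        using kl that by (auto simp: weight_le_def intro: trans_le_add1 trans_le_add2)
      also have "\<dots> \<le> d + (k + l) * j"
        using False by (cases j) auto
      finally show ?thesis .
    qed
    then show ?thesis
      unfolding C_def weight_le_def by blast
  qed
  define \<delta>1 where "\<delta>1 = (LEAST \<delta>. C \<delta>)"
  have C1: "C \<delta>1"
    unfolding \<delta>1_def using C_ex by (rule LeastI_ex)
  have less: "weight_less \<delta> d A" "weight_less \<delta> d B" if "\<delta> > \<delta>1" for \<delta>
  proof -
    \<comment> \<open>Raising \<delta> above \<open>\<delta>1\<close> keeps the bound for
      \<open>j = 0\<close> and makes it strict for all \<open>j > 0\<close>.\<close>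
    have *: "\<delta>1 * j \<le> \<delta> * j \<and> (0 < j \<longrightarrow> \<delta>1 * j < \<delta> * j)" for j
      using that by auto
    have "weight_le \<delta>1 d P \<Longrightarrow> weight_less \<delta> d P" for P
      unfolding weight_less_def weight_le_def using *
      by (meson add_left_mono add_strict_left_mono le_less_trans order_trans)
    then show "weight_less \<delta> d A" "weight_less \<delta> d B"
      using C1 by (auto simp: C_def)
  qed
  have 1: "{p \<in> X0_curve \<delta>. dicritical_singularity \<delta> (a, b) p} = {hpoint \<delta> (0, 1, 0, 1)}" if "\<delta> > \<delta>1" for \<delta>
  proof (intro equalityI subsetI)
    fix p assume "p \<in> {hpoint \<delta> (0, 1, 0, 1)}"
    then have p: "p = hpoint \<delta> (0, 1, 0, 1)"
      by simp
    have h: "(0, 1, 0, 1) \<in> hirz_coords"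
      by (simp add: hirz_coords_def)
    obtain \<omega> where \<omega>: "extension_form \<delta> (a, b) U11 \<omega>"
      using exists_extension_form[OF assms(1)] by blast
    have "dicritical_form_at \<omega> (0, 0)"
      by (rule U11_origin_dicritical[OF \<omega> fi cop less[OF that] d deg])
    then have "dicritical_singularity \<delta> (a, b) p"
      unfolding dicritical_singularity_def p
      using hpoint_in_hirzebruch[OF h] mem_hpoint[OF h] \<omega>
      by (intro conjI exI[of _ U11] exI[of _ "(0, 1, 0, 1)"] exI[of _ \<omega>]) simp_all
    moreover have "p \<in> X0_curve \<delta>"
      using h unfolding X0_curve_def p by blast
    ultimately show "p \<in> {p \<in> X0_curve \<delta>. dicritical_singularity \<delta> (a, b) p}"
      by simp
  next
    fix p assume "p \<in> {p \<in> X0_curve \<delta>. dicritical_singularity \<delta> (a, b) p}"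
    then obtain X1 Y0 Y1 where p: "p = hpoint \<delta> (0, X1, Y0, Y1)" and hc: "(0, X1, Y0, Y1) \<in> hirz_coords"
      and "dicritical_singularity \<delta> (a, b) p"
      by (auto simp: X0_curve_def)
    then obtain c x0 x1 y0 y1 \<omega> where h: "(x0, x1, y0, y1) \<in> p" "(x0, x1, y0, y1) \<in> chart_dom c"
      "extension_form \<delta> (a, b) c \<omega>" "dicritical_form_at \<omega> (chart_coords \<delta> c (x0, x1, y0, y1))"
      by (auto simp: dicritical_singularity_def)
    note x = hpoint_X0_zero[OF h(1)[unfolded p] hc]
    \<comment> \<open>A dicritical singularity is witnessed by some chart, representative and form,
      so all of them must be excluded when \<open>Y0\<close> is nonzero: such a point lies in
      \<open>U10\<close>, or in \<open>U11\<close> with nonzero second coordinate.\<close>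
    have "Y0 = 0"
    proof (rule ccontr)
      assume Y0: "Y0 \<noteq> 0"
      show False
      proof (cases c)
        case U10
        then show False
          using U10_not_dicritical[OF _ fi ind less[OF that] d] h x by auto
      next
        case U11
        then have "y0 / (x1 ^ \<delta> * y1) \<noteq> 0"
          using h(2) x Y0 by simp
        then show False
          using U11_not_dicritical[OF _ fi ind less[OF that] d] h x U11 by auto
      qed (use h(2) x in auto)
    qed
    then have "X1 \<noteq> 0" "Y1 \<noteq> 0"
      using hc by (auto simp: hirz_coords_def)
    then have "hpoint \<delta> (0, X1, 0, Y1) = hpoint \<delta> (0, 1, 0, 1)"
      by (rule hpoint_0101)
    then show "p \<in> {hpoint \<delta> (0, 1, 0, 1)}"
      by (simp add: p \<open>Y0 = 0\<close>)
  qed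
  have h: "(0, 1, 1, 0) \<in> hirz_coords"
    by (simp add: hirz_coords_def)
  have 2: "dicritical_singularity \<delta> (a, b) (hpoint \<delta> (0, 1, 1, 0))" if "\<delta> < \<delta>1" for \<delta>
  proof -
    have "\<not> C \<delta>"
      using that not_less_Least unfolding \<delta>1_def by blast
    \<comment> \<open>The pole orders of the monomials along the curve at infinity, cut off at 0.
      The cut-off is harmless: the maximum \<open>K\<close> exceeds \<open>d\<close>, so it is
      attained where the subtraction is not truncated.\<close>
    define S where "S = (\<lambda>(i, j). i - \<delta> * j) ` {(i, j). coeff (coeff A j) i \<noteq> 0 \<or> coeff (coeff B j) i \<noteq> 0}"
    obtain k l where kl: "weight_le \<delta> k A" "weight_le \<delta> l B"
      using weight_le_exists by blast
    have "S \<subseteq> {..k + l}"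
      using kl by (fastforce simp: S_def weight_le_def)
    then have fin: "finite S"
      by (rule finite_subset) simp
    obtain i0 j0 where ij0: "coeff (coeff A j0) i0 \<noteq> 0 \<or> coeff (coeff B j0) i0 \<noteq> 0" "i0 > d + \<delta> * j0"
      using \<open>\<not> C \<delta>\<close> by (auto simp: C_def weight_le_def not_le)
    define K where "K = Max S"
    have "i0 - \<delta> * j0 \<in> S"
      using ij0(1) by (force simp: S_def)
    then have "K \<ge> i0 - \<delta> * j0"
      unfolding K_def using fin by simp
    then have "K > d"
      using ij0(2) by simp
    have "K \<in> S"
      unfolding K_def using fin \<open>i0 - \<delta> * j0 \<in> S\<close> by (intro Max_in) auto
    then obtain i j where ij: "coeff (coeff A j) i \<noteq> 0 \<or> coeff (coeff B j) i \<noteq> 0" "K = i - \<delta> * j"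
      by (auto simp: S_def)
    then have i: "i = K + \<delta> * j"
      using \<open>K > d\<close> by simp
    have K: "i \<le> K + \<delta> * j" if "coeff (coeff A j) i \<noteq> 0 \<or> coeff (coeff B j) i \<noteq> 0" for i j
    proof -
      have "i - \<delta> * j \<in> S"
        using that by (force simp: S_def)
      then have "i - \<delta> * j \<le> K"
        unfolding K_def using fin by simp
      then show ?thesis by simp
    qed
    \<comment> \<open>Beyond \<open>d\<close> there is no pure power of \<open>x\<close>; the
      highest pole is therefore contributed only by monomials divisible by \<open>y\<close>, and the
      pencil vanishes at the origin of \<open>U10\<close>.\<close>
    have "coeff (coeff A 0) K = 0" "coeff (coeff B 0) K = 0"
      using \<open>K > d\<close> by (auto simp: d_def intro: coeff_eq_0)
    moreover obtain \<omega> where \<omega>: "extension_form \<delta> (a, b) U10 \<omega>"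
      using exists_extension_form[OF assms(1)] by blast
    ultimately have "dicritical_form_at \<omega> (0, 0)"
      using U10_origin_dicritical[OF \<omega> fi cop, of K j] K ij(1) i by (simp add: weight_le_def)
    then show ?thesis
      unfolding dicritical_singularity_def
      using hpoint_in_hirzebruch[OF h] mem_hpoint[OF h] \<omega>
      by (intro conjI exI[of _ U10] exI[of _ "(0, 1, 1, 0)"] exI[of _ \<omega>]) simp_all
  qed
  have 3: "\<not> dicritical_singularity \<delta>1 (a, b) (hpoint \<delta>1 (0, 1, 1, 0))"
  proof
    assume "dicritical_singularity \<delta>1 (a, b) (hpoint \<delta>1 (0, 1, 1, 0))"
    then obtain c x0 x1 y0 y1 \<omega> where *: "(x0, x1, y0, y1) \<in> hpoint \<delta>1 (0, 1, 1, 0)" "(x0, x1, y0, y1) \<in> chart_dom c"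
      "extension_form \<delta>1 (a, b) c \<omega>" "dicritical_form_at \<omega> (chart_coords \<delta>1 c (x0, x1, y0, y1))"
      by (auto simp: dicritical_singularity_def)
    note x = hpoint_X0_zero[OF *(1) h]
    \<comment> \<open>Every representative has zero first and last coordinates, which rules out the
      other three charts.\<close>
    then have "c = U10"
      using *(2) by (cases c) auto
    then show False
      using U10_origin_not_dicritical[OF _ fi ind _ _ d] C1 * x by (auto simp: C_def)
  qed
  show ?thesis
    using 1 2 3 by blast
qed

end
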